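(* Let $k\geqslant 4$ be a fixed integer, let $2\leqslant m\leqslant k-1$ and let $U_m\in\binom{[n]}{m}$. Then there exist absolute constants $\mu$, $\gamma_m$ and $\lambda$ such that, with high probability, the following hold for every $i\leqslant i_0$, where $$i_0=\frac{n^2}{k(k-1)}-\frac{\sqrt[3]{2}}{k(k-1)}\,n^{2-\frac{1}{k(k-1)-2}}\log^{\lambda}n:$$ $$\mathbf{Q}_k(i)\leqslant \frac{n^k}{k!}p^{\binom{k}{2}}+\frac{n^{k-1}}{2}p^{\binom{k}{2}-4},$$ $$\mathbf{Q}_k(i)\geqslant \frac{n^k}{k!}p^{\binom{k}{2}}-\sigma^2 n^{\alpha}p^{-1}\log^{\mu}n,$$ $$\mathbf{R}_{k,U_m}(i)=\frac{n^{k-m}}{(k-m)!}p^{\binom{k}{2}-\binom{m}{2}}\pm \sigma\, n^{\beta_m}\log^{\gamma_m}n,$$ where $$\alpha=k-\frac{\binom{k}{2}+1}{2\binom{k}{2}-2},\qquad \beta_m=k-m-\frac{\binom{k}{2}-\binom{m}{2}}{2\binom{k}{2}-2},$$ $p=p(i)=1-\frac{k(k-1)i}{n^2}$, and $\sigma=\sigma(i)=1-\frac{k(k-1)}{4}\log p$.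
   Context: The random $K_k$-removal algorithm: start with $G(0)$ the complete graph on vertex set $[n]$. Given $G(i)$, the graph $G(i+1)$ is obtained by choosing one copy of $K_k$ uniformly at random among all copies of $K_k$ in $G(i)$ and deleting all its edges; the process stops once no $K_k$ remains. $\mathbf{Q}_k(i)$ denotes the number of copies of $K_k$ in $G(i)$. For a vertex $u$, $N_u=N_u(i)$ is the neighbourhood of $u$ in $G(i)$, and for $U_m=\{u_1,\dots,u_m\}$, $N_{U_m}=\bigcap_{j=1}^m N_{u_j}$ is the common neighbourhood. For $2\leqslant m\leqslant k-1$, $\mathbf{R}_{k,U_m}(i)$ is the number of copies of $K_{k-m}$ in $G(i)$ all of whose vertices lie in $N_{U_m}$ (for $m=k-1$ this is $|N_{U_{k-1}}|$). Logarithms are natural; "with high probability" means with probability tending to $1$ as $n\to\infty$; $a=b\pm c$ means $a\in[b-c,b+c]$. *)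

theory Defs
  imports "HOL-Probability.Probability" "HOL-Library.Ramsey"
begin

text \<open>A graph on the vertex set \<open>{1..n}\<close> is given by its edge set \<open>E \<subseteq> nsets {1..n} 2\<close>.
  A copy of \<open>K\<^sub>j\<close> in a simple graph is determined by its vertices, so copies are represented
  by \<open>j\<close>-element vertex sets; \<open>cliques_in j W E\<close> are the copies with all vertices in \<open>W\<close>.\<close>

definition cliques_in :: "nat \<Rightarrow> nat set \<Rightarrow> nat set set \<Rightarrow> nat set set" where
  "cliques_in j W E = {S \<in> nsets W j. clique S E}"

definition neighbourhood :: "nat \<Rightarrow> nat set set \<Rightarrow> nat \<Rightarrow> nat set" where
  "neighbourhood n E u = {v \<in> {1..n}. {u, v} \<in> E}"

definition common_neighbourhood :: "nat \<Rightarrow> nat set set \<Rightarrow> nat set \<Rightarrow> nat set" where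
  "common_neighbourhood n E U = (\<Inter>u\<in>U. neighbourhood n E u)"

definition Q :: "nat \<Rightarrow> nat \<Rightarrow> nat set set \<Rightarrow> nat" where
  "Q k n E = card (cliques_in k {1..n} E)"

definition R :: "nat \<Rightarrow> nat \<Rightarrow> nat set \<Rightarrow> nat set set \<Rightarrow> nat" where
  "R k n U E = card (cliques_in (k - card U) (common_neighbourhood n E U) E)"

text \<open>The random list of graphs visited by the removal process started from \<open>E\<close>, up to and
  including the \<open>K\<^sub>k\<close>-free graph at which it stops. The test \<open>2 \<le> k\<close> only serves termination:
  a copy of \<open>K\<^sub>0\<close> or \<open>K\<^sub>1\<close> has no edges to delete.\<close>

function removal_run :: "nat \<Rightarrow> nat \<Rightarrow> nat set set \<Rightarrow> nat set set list pmf" where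
  "removal_run k n E =
     (if 2 \<le> k \<and> cliques_in k {1..n} E \<noteq> {}
      then bind_pmf (pmf_of_set (cliques_in k {1..n} E))
             (\<lambda>C. map_pmf ((#) E) (removal_run k n (E - nsets C 2)))
      else return_pmf [E])"
  by pat_completeness auto
termination
proof (relation "Wellfounded.measure (\<lambda>(k, n, E). card (E \<inter> nsets {1..n} 2))", goal_cases)
  case 1
  show ?case by (rule wf_measure)
next
  case (2 k n E C)
  have fin: "finite (cliques_in k {1..n} E)"
    unfolding cliques_in_def by (simp add: finite_imp_finite_nsets)
  have "C \<in> cliques_in k {1..n} E"
    using 2(1,2) fin by (simp add: set_pmf_of_set)
  then have sub: "C \<subseteq> {1..n}" and "finite C" and card: "card C = k" and cl: "clique C E"
    by (simp_all add: cliques_in_def nsets_def)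
  from card 2(1) obtain T where "T \<subseteq> C" "card T = 2"
    by (metis obtain_subset_with_card_n)
  then obtain x y where xy: "T = {x, y}" "x \<noteq> y"
    by (auto simp: card_2_iff)
  with \<open>T \<subseteq> C\<close> have "{x, y} \<in> E \<inter> nsets {1..n} 2"
    using cl sub by (force simp: clique_def nsets_def)
  moreover have "{x, y} \<in> nsets C 2"
    using xy \<open>T \<subseteq> C\<close> by (simp add: nsets_def)
  ultimately have "(E - nsets C 2) \<inter> nsets {1..n} 2 \<subset> E \<inter> nsets {1..n} 2"
    by blast
  moreover have "finite (E \<inter> nsets {1..n} 2)"
    by (simp add: finite_imp_finite_nsets)
  ultimately have "card ((E - nsets C 2) \<inter> nsets {1..n} 2) < card (E \<inter> nsets {1..n} 2)"
    by (rule psubset_card_mono[rotated])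
  then show ?case by simp
qed

declare removal_run.simps [simp del]

definition removal_process :: "nat \<Rightarrow> nat \<Rightarrow> nat set set list pmf" where
  "removal_process k n = removal_run k n (nsets {1..n} 2)"

definition density :: "nat \<Rightarrow> nat \<Rightarrow> nat \<Rightarrow> real" where
  "density k n i = 1 - real (k * (k - 1)) * real i / real n ^ 2"

definition sigma :: "nat \<Rightarrow> nat \<Rightarrow> nat \<Rightarrow> real" where
  "sigma k n i = 1 - real (k * (k - 1)) / 4 * ln (density k n i)"

definition alpha :: "nat \<Rightarrow> real" where
  "alpha k = real k - (real (k choose 2) + 1) / (2 * real (k choose 2) - 2)"

definition beta :: "nat \<Rightarrow> nat \<Rightarrow> real" where
  "beta k m = real k - real m
     - (real (k choose 2) - real (m choose 2)) / (2 * real (k choose 2) - 2)"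

definition last_step :: "nat \<Rightarrow> real \<Rightarrow> nat \<Rightarrow> real" where
  "last_step k lam n = real n ^ 2 / real (k * (k - 1))
     - root 3 2 / real (k * (k - 1))
       * real n powr (2 - 1 / (real (k * (k - 1)) - 2)) * ln (real n) powr lam"

end

theory Submission
  imports Defs "HOL-Real_Asymp.Real_Asymp"
begin

text \<open>The counts \<open>Q\<close> and \<open>R\<close> only decrease along the process, and given the present graph their expected
  decrease is governed by the edge degrees \<open>R({u,v})\<close>. For each constraint let \<open>Z\<close> be the amount by which it
  is violated. The error terms are chosen so that whenever \<open>Z\<close> is close to 0 (\<open>Z \<ge> -w\<close>) its drift is
  at most \<open>-d\<close>, with \<open>\<theta> V \<le> d\<close> for a bound \<open>V\<close> on the second moment of the step and a suitable \<open>\<theta> > 0\<close>;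
  hence \<open>exp (\<theta> Z)\<close> grows in expectation by at most \<open>exp (1 - \<theta> w)\<close> per step, whatever the value
  of \<open>Z\<close>. The sum of these exponentials over all constraints dominates the probability of a
  future failure, by induction on the number of remaining steps, which makes stopping times and
  union bounds over critical intervals unnecessary. The upper bound on \<open>Q\<close> is much sharper than the lower
  one because \<open>\<Sum> R({u,v})\<^sup>2\<close> over the edges is at least the value predicted by the mean (Cauchy--Schwarz), so
  that variation among the degrees only accelerates the decrease of \<open>Q\<close>.\<close>

section \<open>Extensions and lost copies\<close>

text \<open>The obstacle is that the errors feed on each other: the drift of every count is computed
  from edge degrees, which are known only up to \<open>eps 2\<close>. Write r, e for the trajectory
  and error of a count and r2, e2 for those of the degrees. A count at r + e loses faster than the
  trajectory by about e * r2, while small degrees slow the loss by at most r * e2. The sizes in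
  \<open>om\<close> are chosen so that r * e2 \<le> r2 * e; hence the two effects cancel at worst,
  and the lower boundary behaves in the same way. A strictly negative drift then comes from the
  growth of the allowance itself: the logarithm in \<open>sg\<close> adds at least
  \<open>K / 2 * (h / p) * om m\<close> per step, out of which the window, the error of
  \<open>Q\<close> and all second-order terms are paid. For the upper bound on \<open>Q\<close> the
  reserve is the exponent \<open>K - 4\<close>: an excess of \<open>Q\<close> contracts faster than
  \<open>Bq\<close> shrinks. For the lower bound the spread of the degrees costs only the square of
  \<open>eps 2\<close>, which is why \<open>Aq\<close> carries the square of \<open>sg\<close>. The
  windows are chosen so that \<open>\<theta> * w\<close> is at least \<open>L ^ 2 / 8\<close>; as
  \<open>L\<close> is the logarithm of n, this beats the polynomially many steps and
  constraints.\<close>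

lemma clique_iff_nsets_subset: "clique S E \<longleftrightarrow> nsets S 2 \<subseteq> E"
  by (auto simp: clique_def nsets_2_eq)

text \<open>\<open>exts k n U E\<close> consists of the copies counted by \<open>R\<close> for \<open>U \<noteq> {}\<close>, and of all copies
  of \<open>K\<^sub>k\<close> for \<open>U = {}\<close>, where \<open>common_neighbourhood\<close> degenerates to \<open>UNIV\<close>. Edges inside \<open>U\<close> are not required.\<close>

definition ext_edges :: "nat set \<Rightarrow> nat set \<Rightarrow> nat set set" where
  "ext_edges U S = nsets (S \<union> U) 2 - nsets U 2"

definition exts :: "nat \<Rightarrow> nat \<Rightarrow> nat set \<Rightarrow> nat set set \<Rightarrow> nat set set" where
  "exts k n U E = {S \<in> nsets ({1..n} - U) (k - card U). ext_edges U S \<subseteq> E}"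

lemma finite_exts [simp]: "finite (exts k n U E)"
  by (simp add: exts_def finite_imp_finite_nsets)

lemma finite_cliques_in [simp]: "finite W \<Longrightarrow> finite (cliques_in j W E)"
  by (simp add: cliques_in_def finite_imp_finite_nsets)

lemma cliques_in_eq_exts: "cliques_in k {1..n} E = exts k n {} E"
  by (auto simp: cliques_in_def exts_def clique_iff_nsets_subset ext_edges_def nsets_def)

text \<open>Since \<open>E\<close> has no loops, a common neighbour of \<open>U\<close> cannot
  belong to \<open>U\<close>; this makes the two ways of confining \<open>S\<close> agree.\<close>

lemma R_eq_card_exts:
  assumes E: "E \<subseteq> nsets {1..n} 2" and U: "U \<subseteq> {1..n}" "U \<noteq> {}"
  shows "R k n U E = card (exts k n U E)"
proof -
  have "S \<subseteq> common_neighbourhood n E U \<and> nsets S 2 \<subseteq> E \<longleftrightarrow>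
        S \<subseteq> {1..n} - U \<and> ext_edges U S \<subseteq> E" (is "?l \<longleftrightarrow> ?r") for S
  proof
    assume l: ?l
    have "v \<in> {1..n} - U" if "v \<in> S" for v
    proof -
      have "v \<in> neighbourhood n E u" if "u \<in> U" for u
        using l that \<open>v \<in> S\<close> by (auto simp: common_neighbourhood_def)
      moreover have "{v, v} \<notin> E" using E by (auto simp: nsets_2_eq)
      moreover have "v \<notin> U"
      proof
        assume "v \<in> U"
        with calculation have "{v, v} \<in> E" unfolding neighbourhood_def by blast
        then show False using E by (auto simp: nsets_def)
      qed
      ultimately show ?thesis using U by (auto simp: neighbourhood_def)
    qed
    moreover have "e \<in> E" if "e \<in> ext_edges U S" for e
    proof -
      from that obtain x y where xy: "e = {x, y}" "x \<noteq> y" "x \<in> S \<union> U" "y \<in> S \<union> U" "\<not> (x \<in> U \<and> y \<in> U)"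
        by (auto simp: ext_edges_def nsets_2_eq)
      have *: "{u, v} \<in> E" if "u \<in> U" "v \<in> S" for u v
        using l that by (auto simp: common_neighbourhood_def neighbourhood_def)
      show ?thesis
      proof (cases "x \<in> S \<and> y \<in> S")
        case True
        then have "e \<in> nsets S 2" using xy by (auto simp: nsets_2_eq)
        with l show ?thesis by blast
      next
        case False
        then show ?thesis using xy * by (metis Un_iff insert_commute)
      qed
    qed
    ultimately show ?r by auto
  next
    assume r: ?r
    have "nsets S 2 \<subseteq> ext_edges U S"
      using r by (auto simp: ext_edges_def nsets_2_eq)
    moreover have "{u, v} \<in> ext_edges U S" if "u \<in> U" "v \<in> S" for u v
      using r that by (auto simp: ext_edges_def doubleton_in_nsets_2)
    ultimately show ?l
      using r by (auto simp: common_neighbourhood_def neighbourhood_def)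
  qed
  note iff = this
  have "S \<in> cliques_in (k - card U) (common_neighbourhood n E U) E \<longleftrightarrow> S \<in> exts k n U E" for S
    using iff[of S] unfolding cliques_in_def exts_def clique_iff_nsets_subset nsets_def mem_Collect_eq
    by argo
  then have "cliques_in (k - card U) (common_neighbourhood n E U) E = exts k n U E" by blast
  then show ?thesis by (simp add: R_def)
qed

lemma finite_ext_edges [simp]: "finite U \<Longrightarrow> finite S \<Longrightarrow> finite (ext_edges U S)"
  by (simp add: ext_edges_def finite_imp_finite_nsets)

lemma ext_edges_card2: "e \<in> ext_edges U S \<Longrightarrow> card e = 2 \<and> finite e"
  by (auto simp: ext_edges_def nsets_def)

lemma card_ext_edges:
  assumes "finite U" "S \<in> nsets ({1..n} - U) (k - card U)" "card U \<le> k"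
  shows "card (ext_edges U S) = (k choose 2) - (card U choose 2)"
proof -
  have S: "finite S" "card S = k - card U" "S \<inter> U = {}"
    using assms by (auto simp: nsets_def)
  have "nsets U 2 \<subseteq> nsets (S \<union> U) 2" by (rule nsets_mono) auto
  then have "card (ext_edges U S) = card (nsets (S \<union> U) 2) - card (nsets U 2)"
    using assms S by (simp add: ext_edges_def card_Diff_subset finite_imp_finite_nsets del: card_nsets)
  then show ?thesis using S assms by (simp add: card_Un_disjoint)
qed

lemma exts_Diff:
  "exts k n U (E - F) = {S \<in> exts k n U E. ext_edges U S \<inter> F = {}}"
  by (auto simp: exts_def)

definition loss :: "nat \<Rightarrow> nat \<Rightarrow> nat set \<Rightarrow> nat set set \<Rightarrow> nat set \<Rightarrow> nat set set" where
  "loss k n U E C = {S \<in> exts k n U E. \<exists>e\<in>ext_edges U S. e \<subseteq> C}"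

lemma card_exts_Diff:
  assumes "finite C"
  shows "real (card (exts k n U (E - nsets C 2))) = real (card (exts k n U E)) - real (card (loss k n U E C))"
proof -
  have "exts k n U (E - nsets C 2) = exts k n U E - loss k n U E C"
    using assms by (auto simp: exts_Diff loss_def nsets_def dest: ext_edges_card2)
  moreover have "loss k n U E C \<subseteq> exts k n U E" by (auto simp: loss_def)
  ultimately show ?thesis
    by (simp add: card_Diff_subset card_mono finite_subset of_nat_diff)
qed

section \<open>Counting points that are covered several times\<close>

lemma binomial_le_power: "n choose j \<le> n ^ j"
  by (cases "j \<le> n") (auto intro: binomial_le_pow simp: binomial_eq_0)

lemma card_supersets_le:
  assumes "T \<subseteq> {1..n::nat}" "card T = t"
  shows "card {S \<in> nsets {1..n} k. T \<subseteq> S} \<le> n ^ (k - t)"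
proof -
  have fT: "finite T" using assms finite_subset by blast
  have inj: "inj_on (\<lambda>S. S - T) {S \<in> nsets {1..n} k. T \<subseteq> S}"
    by (rule inj_onI) blast
  have "(\<lambda>S. S - T) ` {S \<in> nsets {1..n} k. T \<subseteq> S} \<subseteq> nsets {1..n} (k - t)"
    using fT assms by (auto simp: nsets_def card_Diff_subset)
  then have "card {S \<in> nsets {1..n} k. T \<subseteq> S} \<le> card (nsets {1..n} (k - t))"
    by (intro card_inj_on_le[OF inj]) (auto simp: finite_imp_finite_nsets)
  also have "\<dots> \<le> n ^ (k - t)" using binomial_le_power by simp
  finally show ?thesis .
qed

lemma card_filter_eq_sum: "finite A \<Longrightarrow> card {x \<in> A. P x} = (\<Sum>x\<in>A. if P x then 1 else 0)"
  by (simp add: sum.If_cases Int_def)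

lemma card_hit_le:
  assumes "finite A" "finite H"
  shows "card {x \<in> A. \<exists>e\<in>H. P e x} \<le> (\<Sum>e\<in>H. card {x \<in> A. P e x})"
proof -
  have "{x \<in> A. \<exists>e\<in>H. P e x} = (\<Union>e\<in>H. {x \<in> A. P e x})" by auto
  then show ?thesis using card_UN_le[OF assms(2)] by metis
qed

text \<open>A point lying in \<open>s > 0\<close> of the sets is overcounted \<open>s - 1 \<le> s (s - 1) / 2\<close> times.\<close>

lemma card_hit_ge:
  assumes "finite A" "finite H"
  shows "2 * (\<Sum>e\<in>H. card {x \<in> A. P e x}) \<le> 2 * card {x \<in> A. \<exists>e\<in>H. P e x}
    + (\<Sum>e\<in>H. \<Sum>e'\<in>H - {e}. card {x \<in> A. P e x \<and> P e' x})"
proof -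
  define t where "t x = card {e \<in> H. P e x}" for x
  have 1: "(\<Sum>e\<in>H. card {x \<in> A. P e x}) = (\<Sum>x\<in>A. t x)"
    using assms unfolding t_def by (simp add: card_filter_eq_sum) (rule sum.swap)
  have 2: "card {x \<in> A. \<exists>e\<in>H. P e x} = (\<Sum>x\<in>A. if t x > 0 then 1 else 0)"
    using assms unfolding t_def card_gt_0_iff by (subst card_filter_eq_sum) (auto intro!: sum.cong)
  \<comment> \<open>The double sum counts ordered pairs of distinct indices whose sets both contain
    \<open>x\<close>.\<close>
  have pt: "(\<Sum>e\<in>H. \<Sum>e'\<in>H - {e}. if P e x \<and> P e' x then 1 else 0) = t x * (t x - 1)" for x
  proof -
    have "(\<Sum>e'\<in>H - {e}. if P e x \<and> P e' x then 1 else 0) = (if P e x then t x - 1 else 0)" if "e \<in> H" for e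
    proof (cases "P e x")
      case True
      have "{e' \<in> H - {e}. P e' x} = {e' \<in> H. P e' x} - {e}" by auto
      moreover have "e \<in> {e' \<in> H. P e' x}" using True that by auto
      ultimately have "card {e' \<in> H - {e}. P e' x} = t x - 1"
        using assms by (simp add: t_def)
      then show ?thesis using True assms by (simp flip: card_filter_eq_sum)
    qed simp
    then have "(\<Sum>e\<in>H. \<Sum>e'\<in>H - {e}. if P e x \<and> P e' x then 1 else 0) = (\<Sum>e\<in>H. if P e x then t x - 1 else 0)"
      by (auto intro: sum.cong)
    also have "\<dots> = t x * (t x - 1)"
      using assms by (simp add: sum.If_cases Int_def t_def)
    finally show ?thesis .
  qed
  have "(\<Sum>e\<in>H. \<Sum>e'\<in>H - {e}. card {x \<in> A. P e x \<and> P e' x})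
      = (\<Sum>e\<in>H. \<Sum>e'\<in>H - {e}. \<Sum>x\<in>A. if P e x \<and> P e' x then 1 else 0)"
    using assms by (simp add: card_filter_eq_sum)
  also have "\<dots> = (\<Sum>e\<in>H. \<Sum>x\<in>A. \<Sum>e'\<in>H - {e}. if P e x \<and> P e' x then 1 else 0)"
    by (intro sum.cong refl sum.swap)
  also have "\<dots> = (\<Sum>x\<in>A. \<Sum>e\<in>H. \<Sum>e'\<in>H - {e}. if P e x \<and> P e' x then 1 else 0)"
    by (rule sum.swap)
  also have "\<dots> = (\<Sum>x\<in>A. t x * (t x - 1))" by (simp add: pt)
  finally have 3: "(\<Sum>e\<in>H. \<Sum>e'\<in>H - {e}. card {x \<in> A. P e x \<and> P e' x}) = (\<Sum>x\<in>A. t x * (t x - 1))" .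
  have le: "2 * s \<le> 2 * (if s > 0 then 1 else 0) + s * (s - 1)" for s :: nat
  proof -
    consider "s = 0" | "s = 1" | "s = 2" | "s \<ge> 3" by linarith
    then show ?thesis
    proof cases
      case 4
      then have "s * 2 \<le> s * (s - 1)" by (intro mult_left_mono) auto
      then show ?thesis by (intro trans_le_add2) linarith
    qed auto
  qed
  show ?thesis unfolding 1 2 3 sum_distrib_left sum.distrib[symmetric]
    by (rule sum_mono) (use le in auto)
qed

section \<open>Degrees of vertex sets\<close>

definition deg :: "nat \<Rightarrow> nat \<Rightarrow> nat set set \<Rightarrow> nat set \<Rightarrow> nat" where
  "deg k n E T = card {C \<in> cliques_in k {1..n} E. T \<subseteq> C}"

lemma deg_le_power:
  assumes "T \<subseteq> {1..n}" "card T = t"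
  shows "deg k n E T \<le> n ^ (k - t)"
proof -
  have "deg k n E T \<le> card {S \<in> nsets {1..n} k. T \<subseteq> S}"
    unfolding deg_def by (rule card_mono) (auto simp: cliques_in_def finite_imp_finite_nsets)
  with card_supersets_le[OF assms] show ?thesis by (meson order_trans)
qed

text \<open>Removing \<open>T\<close> from a copy is injective. Only an inequality results, because
  \<open>exts\<close> does not ask for the edges inside \<open>T\<close>.\<close>

lemma deg_le_exts:
  assumes "T \<subseteq> {1..n}"
  shows "deg k n E T \<le> card (exts k n T E)"
proof -
  have fT: "finite T" using assms finite_subset by blast
  have inj: "inj_on (\<lambda>S. S - T) {C \<in> cliques_in k {1..n} E. T \<subseteq> C}"
    by (rule inj_onI) blast
  have "(\<lambda>S. S - T) ` {C \<in> cliques_in k {1..n} E. T \<subseteq> C} \<subseteq> exts k n T E"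
  proof clarify
    fix C assume C: "C \<in> cliques_in k {1..n} E" "T \<subseteq> C"
    then have "C - T \<union> T = C" by auto
    then show "C - T \<in> exts k n T E"
      using C fT by (auto simp: cliques_in_def exts_def nsets_def card_Diff_subset clique_iff_nsets_subset ext_edges_def)
  qed
  then show ?thesis unfolding deg_def by (intro card_inj_on_le[OF inj]) auto
qed

text \<open>The only pair inside \<open>e\<close> is \<open>e\<close> itself, which is present, so
  adding \<open>e\<close> to an extension gives back a copy. This identifies the edge degrees with
  the counts tracked for \<open>m = 2\<close>.\<close>

lemma deg_edge:
  assumes E: "E \<subseteq> nsets {1..n} 2" and "e \<in> E" "k \<ge> 2"
  shows "deg k n E e = card (exts k n e E)"
proof (rule antisym)
  have e: "e \<subseteq> {1..n}" "card e = 2" "finite e" using assms by (auto simp: nsets_def)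
  then show "deg k n E e \<le> card (exts k n e E)" by (intro deg_le_exts)
  have inj: "inj_on (\<lambda>S. S \<union> e) (exts k n e E)"
    by (rule inj_onI) (auto simp: exts_def nsets_def)
  have "(\<lambda>S. S \<union> e) ` exts k n e E \<subseteq> {C \<in> cliques_in k {1..n} E. e \<subseteq> C}"
  proof clarify
    fix S assume S: "S \<in> exts k n e E"
    have "nsets e 2 = {e}"
      using e card_subset_eq[of e] by (auto simp: nsets_def)
    then have "nsets (S \<union> e) 2 \<subseteq> E"
      using S \<open>e \<in> E\<close> by (auto simp: exts_def ext_edges_def)
    moreover have "card (S \<union> e) = k"
      using S e \<open>k \<ge> 2\<close> by (auto simp: exts_def nsets_def card_Un_disjoint disjoint_iff subset_iff)
    ultimately show "S \<union> e \<in> cliques_in k {1..n} E \<and> e \<subseteq> S \<union> e"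
      using S e by (auto simp: exts_def cliques_in_def clique_iff_nsets_subset nsets_def)
  qed
  then show "card (exts k n e E) \<le> deg k n E e"
    unfolding deg_def using inj by (intro card_inj_on_le[OF inj]) auto
qed

lemma card_Un_edges:
  assumes "card e = 2" "card e' = 2" "e \<noteq> e'"
  shows "card (e \<union> e') \<ge> 3"
proof (rule ccontr)
  assume "\<not> ?thesis"
  moreover have f: "finite e" "finite e'" using assms by (auto intro: card_ge_0_finite)
  moreover have "card e \<le> card (e \<union> e')" using f by (intro card_mono) auto
  ultimately have "card (e \<union> e') = 2" using assms by linarith
  then have "e = e \<union> e'" by (intro card_subset_eq) (use f assms in auto)
  moreover have "e' = e \<union> e'" by (intro card_subset_eq) (use f assms \<open>card (e \<union> e') = 2\<close> in auto)
  ultimately show False using assms(3) by metis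
qed

text \<open>Inclusion-exclusion cut off after the pairs. Two distinct edges span at least three
  vertices, so at most \<open>n ^ (k - 3)\<close> copies contain both.\<close>

lemma hit_bounds:
  fixes E :: "nat set set"
  assumes H: "finite H" "H \<subseteq> nsets {1..n} 2" and "k \<ge> 3" and "n \<ge> 1"
  defines "hit \<equiv> real (card {C \<in> cliques_in k {1..n} E. \<exists>e\<in>H. e \<subseteq> C})"
  shows "hit \<le> (\<Sum>e\<in>H. real (deg k n E e))"
    and "hit \<ge> (\<Sum>e\<in>H. real (deg k n E e)) - real (card H) ^ 2 * real n ^ (k - 3)"
proof -
  let ?A = "cliques_in k {1..n} E"
  have "card {C \<in> ?A. \<exists>e\<in>H. e \<subseteq> C} \<le> (\<Sum>e\<in>H. deg k n E e)"
    unfolding deg_def by (rule card_hit_le) (use H in auto)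
  from of_nat_mono[OF this, where ?'a = real] show "hit \<le> (\<Sum>e\<in>H. real (deg k n E e))"
    unfolding hit_def by simp
  have pair: "card {C \<in> ?A. e \<subseteq> C \<and> e' \<subseteq> C} \<le> n ^ (k - 3)" if "e \<in> H" "e' \<in> H - {e}" for e e'
  proof -
    have c: "e \<union> e' \<subseteq> {1..n}" "card (e \<union> e') \<ge> 3"
      using that H by (auto intro!: card_Un_edges simp: nsets_def subset_iff)
    have "card {C \<in> ?A. e \<subseteq> C \<and> e' \<subseteq> C} = deg k n E (e \<union> e')" by (simp add: deg_def)
    also have "\<dots> \<le> n ^ (k - card (e \<union> e'))" by (rule deg_le_power) (use c in auto)
    also have "\<dots> \<le> n ^ (k - 3)" by (rule power_increasing) (use c assms in auto)
    finally show ?thesis .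
  qed
  have "(\<Sum>e\<in>H. \<Sum>e'\<in>H - {e}. card {C \<in> ?A. e \<subseteq> C \<and> e' \<subseteq> C}) \<le> (\<Sum>e\<in>H. \<Sum>e'\<in>H - {e}. n ^ (k - 3))"
    by (intro sum_mono pair)
  also have "\<dots> \<le> card H * (card H * n ^ (k - 3))"
    using H by (simp add: mult_le_mono)
  finally have "2 * (\<Sum>e\<in>H. deg k n E e) \<le> 2 * card {C \<in> ?A. \<exists>e\<in>H. e \<subseteq> C} + card H ^ 2 * n ^ (k - 3)"
    using card_hit_ge[of ?A H "\<lambda>e C. e \<subseteq> C"] H unfolding deg_def
    by (simp add: power2_eq_square mult.assoc)
  from of_nat_mono[OF this, where ?'a = real]
  have "2 * (\<Sum>e\<in>H. real (deg k n E e)) \<le> 2 * hit + real (card H) ^ 2 * real n ^ (k - 3)"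
    unfolding hit_def by simp
  moreover have "0 \<le> real (card H) ^ 2 * real n ^ (k - 3)" by simp
  ultimately show "hit \<ge> (\<Sum>e\<in>H. real (deg k n E e)) - real (card H) ^ 2 * real n ^ (k - 3)"
    by linarith
qed

text \<open>Double counting of pairs (deleted copy, destroyed extension): the average loss becomes a
  sum over extensions of the number of copies that would destroy them.\<close>

lemma sum_card_loss:
  assumes U: "finite U" "card U \<le> k"
  shows "(\<Sum>C\<in>cliques_in k {1..n} E. card (loss k n U E C)) =
    (\<Sum>S\<in>exts k n U E. card {C \<in> cliques_in k {1..n} E. \<exists>e\<in>ext_edges U S. e \<subseteq> C})"
  unfolding loss_def by (simp add: card_filter_eq_sum) (rule sum.swap)

lemma ext_edges_subset:
  "S \<in> exts k n U E \<Longrightarrow> ext_edges U S \<subseteq> E"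
  by (auto simp: exts_def)

text \<open>An extension has \<open>\<kappa>\<close> edges, and each is hit by as many copies as its
  degree says. The crude correction \<open>n ^ (k - 3)\<close> for copies hitting two edges is
  affordable for the drift of \<open>R\<close>, see \<open>traj_N3_le\<close>.\<close>

lemma sum_loss_bounds:
  assumes E: "E \<subseteq> nsets {1..n} 2" and U: "U \<subseteq> {1..n}" "card U = m" "m \<le> k" and "k \<ge> 3" "n \<ge> 1"
    and deg: "\<And>e. e \<in> E \<Longrightarrow> lo \<le> real (deg k n E e) \<and> real (deg k n E e) \<le> hi"
  defines "\<kappa> \<equiv> real ((k choose 2) - (m choose 2))"
  shows "(\<Sum>C\<in>cliques_in k {1..n} E. real (card (loss k n U E C))) \<le> real (card (exts k n U E)) * (\<kappa> * hi)"
    and "(\<Sum>C\<in>cliques_in k {1..n} E. real (card (loss k n U E C))) \<ge>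
      real (card (exts k n U E)) * (\<kappa> * lo - \<kappa> ^ 2 * real n ^ (k - 3))"
proof -
  have fU: "finite U" using U finite_subset by blast
  let ?hit = "\<lambda>S. real (card {C \<in> cliques_in k {1..n} E. \<exists>e\<in>ext_edges U S. e \<subseteq> C})"
  have eq: "(\<Sum>C\<in>cliques_in k {1..n} E. real (card (loss k n U E C))) = (\<Sum>S\<in>exts k n U E. ?hit S)"
    using arg_cong[OF sum_card_loss[of U k n E], of real] fU U by simp
  have cardH: "real (card (ext_edges U S)) = \<kappa>" if "S \<in> exts k n U E" for S
    using card_ext_edges[of U S n k] that fU U by (auto simp: exts_def \<kappa>_def)
  have "?hit S \<le> \<kappa> * hi \<and> ?hit S \<ge> \<kappa> * lo - \<kappa> ^ 2 * real n ^ (k - 3)" if S: "S \<in> exts k n U E" for S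
  proof -
    have sub: "ext_edges U S \<subseteq> E" using ext_edges_subset[OF S] .
    have fin: "finite (ext_edges U S)" using S fU by (auto simp: exts_def nsets_def)
    have sub2: "ext_edges U S \<subseteq> nsets {1..n} 2" using sub E by auto
    note hb = hit_bounds[OF fin sub2 \<open>k \<ge> 3\<close> \<open>n \<ge> 1\<close>, of E]
    have "(\<Sum>e\<in>ext_edges U S. real (deg k n E e)) \<le> \<kappa> * hi"
      using sum_bounded_above[of "ext_edges U S" "\<lambda>e. real (deg k n E e)" hi] deg sub cardH[OF S] by auto
    moreover have "(\<Sum>e\<in>ext_edges U S. real (deg k n E e)) \<ge> \<kappa> * lo"
      using sum_bounded_below[of "ext_edges U S" lo "\<lambda>e. real (deg k n E e)"] deg sub cardH[OF S] by auto
    ultimately show ?thesis using hb cardH[OF S] by auto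
  qed
  note b = this
  show "(\<Sum>C\<in>cliques_in k {1..n} E. real (card (loss k n U E C))) \<le> real (card (exts k n U E)) * (\<kappa> * hi)"
    unfolding eq using b by (intro sum_bounded_above) auto
  show "(\<Sum>C\<in>cliques_in k {1..n} E. real (card (loss k n U E C))) \<ge>
      real (card (exts k n U E)) * (\<kappa> * lo - \<kappa> ^ 2 * real n ^ (k - 3))"
    unfolding eq using b by (intro sum_bounded_below) auto
qed

text \<open>A destroyed extension has an edge inside \<open>C\<close> that is not contained in
  \<open>U\<close>, so it shares with \<open>C\<close> a vertex outside \<open>U\<close>: there are
  \<open>k\<close> choices for that vertex and at most \<open>n ^ (k - m - 1)\<close> completions.
  This is the maximal step of \<open>R\<close>.\<close>

lemma card_loss_le:
  assumes U: "U \<subseteq> {1..n}" "card U = m" "m < k" and C: "C \<in> nsets {1..n} k"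
  shows "card (loss k n U E C) \<le> k * n ^ (k - m - 1)"
proof -
  have fU: "finite U" using U finite_subset by blast
  have "loss k n U E C \<subseteq> (\<Union>v\<in>C. {S \<in> nsets {1..n} (k - m). {v} \<subseteq> S})"
  proof
    fix S assume S: "S \<in> loss k n U E C"
    then obtain e where e: "e \<in> ext_edges U S" "e \<subseteq> C" and SS: "S \<in> nsets ({1..n} - U) (k - m)"
      using U by (auto simp: loss_def exts_def)
    from e have "\<not> e \<subseteq> U" "e \<subseteq> S \<union> U" by (auto simp: ext_edges_def nsets_def)
    then obtain v where "v \<in> e" "v \<in> S" by blast
    then show "S \<in> (\<Union>v\<in>C. {S \<in> nsets {1..n} (k - m). {v} \<subseteq> S})"
      using e SS by (auto simp: nsets_def)
  qed
  then have "card (loss k n U E C) \<le> card (\<Union>v\<in>C. {S \<in> nsets {1..n} (k - m). {v} \<subseteq> S})"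
    using C by (intro card_mono) (auto simp: finite_imp_finite_nsets nsets_def)
  also have "\<dots> \<le> (\<Sum>v\<in>C. card {S \<in> nsets {1..n} (k - m). {v} \<subseteq> S})"
    using C by (intro card_UN_le) (auto simp: nsets_def)
  also have "\<dots> \<le> (\<Sum>v\<in>C. n ^ (k - m - 1))"
    using C by (intro sum_mono card_supersets_le) (auto simp: nsets_def)
  also have "\<dots> = k * n ^ (k - m - 1)" using C by (simp add: nsets_def)
  finally show ?thesis .
qed

section \<open>Loss in the number of copies of the complete graph\<close>

lemma loss_empty:
  "loss k n {} E C = {C' \<in> cliques_in k {1..n} E. \<exists>e\<in>nsets C 2. e \<subseteq> C'}" if "finite C"
proof -
  have "ext_edges {} C' = nsets C' 2" for C'
    by (auto simp: ext_edges_def nsets_def)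
  moreover have "(\<exists>e\<in>nsets C' 2. e \<subseteq> C) \<longleftrightarrow> (\<exists>e\<in>nsets C 2. e \<subseteq> C')" for C'
    by (auto simp: nsets_def)
  ultimately show ?thesis unfolding loss_def cliques_in_eq_exts by simp
qed

text \<open>For constant \<open>f\<close> this is the handshake identity. For \<open>f\<close> the
  degree it yields the sum of the squared degrees, on which both bounds on \<open>Q\<close>
  rest.\<close>

lemma sum_deg:
  assumes E: "E \<subseteq> nsets {1..n} 2"
  shows "(\<Sum>C\<in>cliques_in k {1..n} E. \<Sum>e\<in>nsets C 2. f e) = (\<Sum>e\<in>E. real (deg k n E e) * f e)"
proof -
  have fE: "finite E" using E finite_subset finite_imp_finite_nsets by blast
  have "nsets C 2 = {e \<in> E. e \<subseteq> C}" if "C \<in> cliques_in k {1..n} E" for C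
    using that E by (auto simp: cliques_in_def clique_iff_nsets_subset nsets_def)
  then have "(\<Sum>e\<in>nsets C 2. f e) = (\<Sum>e\<in>E. if e \<subseteq> C then f e else 0)"
    if "C \<in> cliques_in k {1..n} E" for C
    using that sum.inter_filter[OF fE, of f "\<lambda>e. e \<subseteq> C"] by simp
  then have "(\<Sum>C\<in>cliques_in k {1..n} E. \<Sum>e\<in>nsets C 2. f e) =
    (\<Sum>C\<in>cliques_in k {1..n} E. \<Sum>e\<in>E. if e \<subseteq> C then f e else 0)"
    by (rule sum.cong[OF refl])
  also have "\<dots> = (\<Sum>e\<in>E. \<Sum>C\<in>cliques_in k {1..n} E. if e \<subseteq> C then f e else 0)"
    by (rule sum.swap)
  also have "\<dots> = (\<Sum>e\<in>E. real (deg k n E e) * f e)"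
    unfolding deg_def by (intro sum.cong refl) (simp add: sum.If_cases Int_def)
  finally show ?thesis .
qed

lemma sum_deg_eq:
  assumes E: "E \<subseteq> nsets {1..n} 2"
  shows "(\<Sum>e\<in>E. real (deg k n E e)) = real (k choose 2) * real (Q k n E)"
proof -
  have "(\<Sum>e\<in>E. real (deg k n E e)) = (\<Sum>C\<in>cliques_in k {1..n} E. \<Sum>e\<in>nsets C 2. 1::real)"
    using sum_deg[OF E, where f = "\<lambda>_. 1"] by simp
  also have "\<dots> = (\<Sum>C\<in>cliques_in k {1..n} E. real (k choose 2))"
    by (intro sum.cong refl) (auto simp: cliques_in_def nsets_def[of _ k])
  finally show ?thesis by (simp add: Q_def)
qed

text \<open>The correction \<open>n ^ (k - 3)\<close> in the lower bound is too large for the drift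
  of \<open>Bq\<close>, which decays with \<open>p\<close>; this lower bound controls the size of
  individual steps, and \<open>clique_lossQ_ge\<close> serves the drift.\<close>

lemma clique_lossQ_bounds:
  assumes E: "E \<subseteq> nsets {1..n} 2" and C: "C \<in> cliques_in k {1..n} E" and k: "k \<ge> 4" "n \<ge> 1"
  shows "real (card (loss k n {} E C)) \<le> (\<Sum>e\<in>nsets C 2. real (deg k n E e))"
    and "real (card (loss k n {} E C)) \<ge> (\<Sum>e\<in>nsets C 2. real (deg k n E e)) - real (k choose 2)^2 * real n ^ (k - 3)"
proof -
  have C': "C \<subseteq> {1..n}" "finite C" "card C = k" using C by (auto simp: cliques_in_def nsets_def)
  have H: "finite (nsets C 2)" "nsets C 2 \<subseteq> nsets {1..n} 2"
    using C' by (auto simp: finite_imp_finite_nsets nsets_def)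
  show "real (card (loss k n {} E C)) \<le> (\<Sum>e\<in>nsets C 2. real (deg k n E e))"
    "real (card (loss k n {} E C)) \<ge> (\<Sum>e\<in>nsets C 2. real (deg k n E e)) - real (k choose 2)^2 * real n ^ (k - 3)"
    using hit_bounds[OF H, of k E] k C' by (simp_all add: loss_empty)
qed

lemma card_adjacent_edges_le:
  assumes C: "finite C" "card C = k" and e: "e \<in> nsets C 2"
  shows "card {e' \<in> nsets C 2 - {e}. e \<inter> e' \<noteq> {}} \<le> 2 * (k - 2)"
proof -
  have e': "e \<subseteq> C" "card e = 2" "finite e" using e by (auto simp: nsets_def)
  have "{e' \<in> nsets C 2 - {e}. e \<inter> e' \<noteq> {}} \<subseteq> (\<lambda>(a, w). {a, w}) ` (e \<times> (C - e))"
  proof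
    fix f assume f: "f \<in> {e' \<in> nsets C 2 - {e}. e \<inter> e' \<noteq> {}}"
    then obtain a where a: "a \<in> e" "a \<in> f" by auto
    from f a obtain w where w: "f = {a, w}" "w \<noteq> a" "w \<in> C" by (auto simp: nsets_2_eq)
    have "w \<notin> e"
    proof
      assume "w \<in> e"
      then have "f \<subseteq> e" "card f = card e" using a w e' by auto
      then have "f = e" using e' card_subset_eq by blast
      with f show False by auto
    qed
    with a w show "f \<in> (\<lambda>(a, w). {a, w}) ` (e \<times> (C - e))" by force
  qed
  then have "card {e' \<in> nsets C 2 - {e}. e \<inter> e' \<noteq> {}} \<le> card ((\<lambda>(a, w). {a, w}) ` (e \<times> (C - e)))"
    using C e' by (intro card_mono) auto
  also have "\<dots> \<le> card (e \<times> (C - e))" using C e' by (intro card_image_le) auto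
  also have "\<dots> = 2 * (k - 2)" using C e' by (simp add: card_Diff_subset card_cartesian_product)
  finally show ?thesis .
qed

text \<open>Pairs of edges of \<open>C\<close> that meet span three vertices, and the tracked count
  \<open>t3\<close> bounds the copies through these; disjoint pairs span four, where
  \<open>n ^ (k - 4)\<close> is small enough. Each edge meets at most \<open>2 * (k - 2)\<close>
  others, and the factor 2 disappears when ordered pairs are halved.\<close>

lemma clique_lossQ_ge:
  assumes E: "E \<subseteq> nsets {1..n} 2" and C: "C \<in> cliques_in k {1..n} E" and k: "k \<ge> 4" "n \<ge> 1"
    and T: "\<And>T. T \<in> nsets {1..n} 3 \<Longrightarrow> real (card (exts k n T E)) \<le> t3"
  shows "real (card (loss k n {} E C)) \<ge> (\<Sum>e\<in>nsets C 2. real (deg k n E e))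
     - (real (k choose 2) * (real k - 2) * t3 + real (k choose 2)^2 / 2 * real n ^ (k - 4))"
proof -
  let ?A = "cliques_in k {1..n} E" and ?H = "nsets C 2"
  have C': "C \<subseteq> {1..n}" "finite C" "card C = k" using C by (auto simp: cliques_in_def nsets_def)
  have fH: "finite ?H" using C' by (simp add: finite_imp_finite_nsets)
  obtain T where "T \<subseteq> C" "card T = 3" "finite T"
    using obtain_subset_with_card_n[of 3 C] C' k by auto
  then have "T \<in> nsets {1..n} 3" using C' by (auto simp: nsets_def)
  then have t3: "t3 \<ge> 0" using T by (meson of_nat_0_le_iff order_trans)
  have pair: "real (card {C' \<in> ?A. e \<subseteq> C' \<and> e' \<subseteq> C'}) \<le> (if e \<inter> e' \<noteq> {} then t3 else 0) + real n ^ (k - 4)"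
    if "e \<in> ?H" "e' \<in> ?H - {e}" for e e'
  proof -
    have ee: "e \<subseteq> {1..n}" "e' \<subseteq> {1..n}" "card e = 2" "card e' = 2" "e \<noteq> e'" "finite e" "finite e'"
      using that C' by (auto simp: nsets_def)
    have eq: "card {C' \<in> ?A. e \<subseteq> C' \<and> e' \<subseteq> C'} = deg k n E (e \<union> e')" by (simp add: deg_def)
    show ?thesis
    proof (cases "e \<inter> e' = {}")
      case True
      then have "card (e \<union> e') = 4" using ee by (simp add: card_Un_disjoint)
      then have "deg k n E (e \<union> e') \<le> n ^ (k - 4)" using ee by (intro deg_le_power) auto
      then show ?thesis using True eq by (simp add: of_nat_le_iff flip: of_nat_power)
    next
      case False
      then have "card (e \<inter> e') \<noteq> 0" using ee by auto
      then have "card (e \<union> e') = 3"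
        using card_Un_Int[of e e'] card_Un_edges[of e e'] ee by linarith
      then have "e \<union> e' \<in> nsets {1..n} 3" using ee by (auto simp: nsets_def)
      then have "real (deg k n E (e \<union> e')) \<le> t3"
        using T deg_le_exts[of "e \<union> e'" n k E] ee by (metis Un_least of_nat_le_iff order_trans)
      then show ?thesis using False eq by (simp add: add_increasing2)
    qed
  qed
  have "(\<Sum>e\<in>?H. \<Sum>e'\<in>?H - {e}. real (card {C' \<in> ?A. e \<subseteq> C' \<and> e' \<subseteq> C'}))
     \<le> (\<Sum>e\<in>?H. \<Sum>e'\<in>?H - {e}. (if e \<inter> e' \<noteq> {} then t3 else 0) + real n ^ (k - 4))"
    by (intro sum_mono pair)
  also have "\<dots> \<le> (\<Sum>e\<in>?H. 2 * (real k - 2) * t3 + real (k choose 2) * real n ^ (k - 4))"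
  proof (rule sum_mono)
    fix e assume e: "e \<in> ?H"
    have "(\<Sum>e'\<in>?H - {e}. (if e \<inter> e' \<noteq> {} then t3 else 0) + real n ^ (k - 4)) =
        real (card {e' \<in> ?H - {e}. e \<inter> e' \<noteq> {}}) * t3 + real (card (?H - {e})) * real n ^ (k - 4)"
      using fH by (simp add: sum.distrib sum.If_cases Int_def del: card_nsets)
    moreover have "real (card {e' \<in> ?H - {e}. e \<inter> e' \<noteq> {}}) * t3 \<le> 2 * (real k - 2) * t3"
    proof (rule mult_right_mono)
      have "real (card {e' \<in> ?H - {e}. e \<inter> e' \<noteq> {}}) \<le> real (2 * (k - 2))"
        using card_adjacent_edges_le[OF C'(2,3) e] by linarith
      then show "real (card {e' \<in> ?H - {e}. e \<inter> e' \<noteq> {}}) \<le> 2 * (real k - 2)"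
        using k by (simp add: of_nat_diff)
    qed (rule t3)
    moreover have "real (card (?H - {e})) * real n ^ (k - 4) \<le> real (k choose 2) * real n ^ (k - 4)"
    proof (rule mult_right_mono)
      have "card (?H - {e}) \<le> card ?H" using fH by (intro card_mono) auto
      then show "real (card (?H - {e})) \<le> real (k choose 2)" using C' by (simp)
    qed simp
    ultimately show "(\<Sum>e'\<in>?H - {e}. (if e \<inter> e' \<noteq> {} then t3 else 0) + real n ^ (k - 4)) \<le>
      2 * (real k - 2) * t3 + real (k choose 2) * real n ^ (k - 4)" by linarith
  qed
  also have "\<dots> = 2 * (real (k choose 2) * (real k - 2) * t3 + real (k choose 2)^2 / 2 * real n ^ (k - 4))"
    using C' by (simp add: algebra_simps power2_eq_square)
  finally have 1: "(\<Sum>e\<in>?H. \<Sum>e'\<in>?H - {e}. real (card {C' \<in> ?A. e \<subseteq> C' \<and> e' \<subseteq> C'})) \<le>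
     2 * (real (k choose 2) * (real k - 2) * t3 + real (k choose 2)^2 / 2 * real n ^ (k - 4))" .
  have "2 * (\<Sum>e\<in>?H. deg k n E e) \<le> 2 * card (loss k n {} E C)
    + (\<Sum>e\<in>?H. \<Sum>e'\<in>?H - {e}. card {C' \<in> ?A. e \<subseteq> C' \<and> e' \<subseteq> C'})"
    using card_hit_ge[of ?A ?H "\<lambda>e C. e \<subseteq> C"] fH C' by (simp add: loss_empty deg_def)
  then have "real (2 * (\<Sum>e\<in>?H. deg k n E e)) \<le> real (2 * card (loss k n {} E C)
    + (\<Sum>e\<in>?H. \<Sum>e'\<in>?H - {e}. card {C' \<in> ?A. e \<subseteq> C' \<and> e' \<subseteq> C'}))"
    by (rule of_nat_mono)
  then have "2 * (\<Sum>e\<in>?H. real (deg k n E e)) \<le> 2 * real (card (loss k n {} E C))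
    + (\<Sum>e\<in>?H. \<Sum>e'\<in>?H - {e}. real (card {C' \<in> ?A. e \<subseteq> C' \<and> e' \<subseteq> C'}))"
    by simp
  moreover have "x - y \<le> l" if "z \<le> 2 * y" "2 * x \<le> 2 * l + z" for x y z l :: real
    using that by linarith
  ultimately show ?thesis using 1 by blast
qed

section \<open>The exponential estimator\<close>

lemma exp_le_quadratic:
  fixes x :: real
  assumes "\<bar>x\<bar> \<le> 1"
  shows "exp x \<le> 1 + x + x\<^sup>2"
proof (cases "x \<ge> 0")
  case True
  then show ?thesis using exp_bound[of x] assms by simp
next
  case False
  define y where "y = - x"
  have y: "0 < y" "x = - y" using False by (auto simp: y_def)
  have "exp x = 1 / exp y" using y by (simp add: exp_minus inverse_eq_divide)
  also have "\<dots> \<le> 1 / (1 + y)"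
    using y exp_ge_add_one_self[of y] by (intro divide_left_mono) auto
  also have "\<dots> \<le> 1 - y + y\<^sup>2"
  proof -
    have "(1 - y + y\<^sup>2) * (1 + y) = 1 + y ^ 3" by (simp add: algebra_simps power2_eq_square power3_eq_cube)
    then show ?thesis using y by (simp add: divide_le_eq)
  qed
  finally show ?thesis using y by simp
qed

text \<open>The sums over \<open>A\<close> are \<open>card A\<close> times expectations under the
  uniform choice. Inside the window the quadratic expansion gives a factor at most
  \<open>1 - \<theta> * d + \<theta>\<^sup>2 * V\<close>, which is at most 1. Below the window a
  single step can raise \<open>\<theta> * Z\<close> by at most 1, so the exponential stays under
  \<open>exp (1 - \<theta> * w)\<close>.\<close>

lemma exp_supermartingale_step:
  fixes Z :: "'a \<Rightarrow> real"
  assumes A: "finite A" and \<theta>: "\<theta> > 0"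
    and step: "\<And>x. x \<in> A \<Longrightarrow> \<theta> * \<bar>Z x - z\<bar> \<le> 1"
    and drift: "z \<ge> - w \<Longrightarrow> (\<Sum>x\<in>A. Z x - z) \<le> - d * real (card A)"
    and var: "z \<ge> - w \<Longrightarrow> (\<Sum>x\<in>A. (Z x - z)\<^sup>2) \<le> V * real (card A)"
    and "\<theta> * V \<le> d"
  shows "(\<Sum>x\<in>A. exp (\<theta> * Z x)) \<le> real (card A) * (exp (\<theta> * z) + exp (1 - \<theta> * w))"
proof (cases "z \<ge> - w")
  case True
  have "exp (\<theta> * Z x) \<le> exp (\<theta> * z) * (1 + \<theta> * (Z x - z) + \<theta>\<^sup>2 * (Z x - z)\<^sup>2)" if "x \<in> A" for x
  proof -
    have "exp (\<theta> * Z x) = exp (\<theta> * z) * exp (\<theta> * (Z x - z))" by (simp add: exp_add[symmetric] algebra_simps)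
    moreover have "exp (\<theta> * (Z x - z)) \<le> 1 + \<theta> * (Z x - z) + (\<theta> * (Z x - z))\<^sup>2"
      using step[OF that] \<theta> by (intro exp_le_quadratic) (simp add: abs_mult)
    ultimately show ?thesis by (simp add: power_mult_distrib)
  qed
  then have "(\<Sum>x\<in>A. exp (\<theta> * Z x)) \<le> (\<Sum>x\<in>A. exp (\<theta> * z) * (1 + \<theta> * (Z x - z) + \<theta>\<^sup>2 * (Z x - z)\<^sup>2))"
    by (rule sum_mono)
  also have "\<dots> = exp (\<theta> * z) * (real (card A) + \<theta> * (\<Sum>x\<in>A. Z x - z) + \<theta>\<^sup>2 * (\<Sum>x\<in>A. (Z x - z)\<^sup>2))"
    by (simp add: sum_distrib_left[symmetric] sum.distrib)
  also have "\<dots> \<le> exp (\<theta> * z) * real (card A)"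
  proof (rule mult_left_mono)
    have "\<theta> * (\<Sum>x\<in>A. Z x - z) \<le> \<theta> * (- d * real (card A))"
      using drift[OF True] \<theta> by (intro mult_left_mono) auto
    moreover have "\<theta>\<^sup>2 * (\<Sum>x\<in>A. (Z x - z)\<^sup>2) \<le> \<theta>\<^sup>2 * (V * real (card A))"
      using var[OF True] by (intro mult_left_mono) auto
    moreover have "\<theta>\<^sup>2 * (V * real (card A)) = \<theta> * (\<theta> * V * real (card A))"
      by (simp add: power2_eq_square)
    moreover have "\<theta> * (\<theta> * V * real (card A)) \<le> \<theta> * (d * real (card A))"
      using \<theta> assms(6) by (intro mult_left_mono mult_right_mono) auto
    ultimately show "real (card A) + \<theta> * (\<Sum>x\<in>A. Z x - z) + \<theta>\<^sup>2 * (\<Sum>x\<in>A. (Z x - z)\<^sup>2) \<le> real (card A)"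
      by simp
  qed simp
  also have "\<dots> \<le> real (card A) * (exp (\<theta> * z) + exp (1 - \<theta> * w))"
    by (simp add: algebra_simps)
  finally show ?thesis .
next
  case False
  have "exp (\<theta> * Z x) \<le> exp (\<theta> * z) + exp (1 - \<theta> * w)" if "x \<in> A" for x
  proof -
    have "\<theta> * (Z x - z) \<le> 1"
      using step[OF that] \<theta> by (smt (verit) mult_left_mono)
    moreover have "\<theta> * z \<le> \<theta> * (- w)" using False \<theta> by (intro mult_left_mono) auto
    ultimately have "\<theta> * Z x \<le> 1 - \<theta> * w" by (simp add: algebra_simps)
    then show ?thesis by (simp add: add_increasing)
  qed
  then show ?thesis by (rule sum_bounded_above)
qed

section \<open>From one step to the whole run\<close>

lemma prob_bind_pmf:
  "measure_pmf.prob (bind_pmf p f) A = (\<integral>x. measure_pmf.prob (f x) A \<partial>measure_pmf p)"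
proof -
  have "ennreal (measure_pmf.prob (bind_pmf p f) A) = (\<integral>\<^sup>+x. ennreal (measure_pmf.prob (f x) A) \<partial>measure_pmf p)"
    using emeasure_bind_pmf[of p f A] by (simp add: measure_pmf.emeasure_eq_measure)
  also have "\<dots> = ennreal (\<integral>x. measure_pmf.prob (f x) A \<partial>measure_pmf p)"
    by (intro nn_integral_eq_integral measure_pmf.integrable_const_bound[where B = 1]) auto
  finally show ?thesis by (simp add: integral_nonneg_AE)
qed

text \<open>\<open>inv\<close> holds deterministically along the run, \<open>good\<close> only with
  high probability. The step inequality is asked for in good states only: in a bad state the
  potential is at least 1 and the claim is trivial. In a good state the induction averages over the
  next copy and pays \<open>\<rho>\<close> once.\<close>

lemma removal_run_failure_bound:
  fixes \<Phi> :: "nat \<Rightarrow> nat set set \<Rightarrow> real" and good inv :: "nat \<Rightarrow> nat set set \<Rightarrow> bool"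
  assumes k: "k \<ge> 2" and "\<rho> \<ge> 0" and \<Phi>: "\<And>i E. \<Phi> i E \<ge> 0"
    and bad: "\<And>i E. i \<le> N \<Longrightarrow> inv i E \<Longrightarrow> \<not> good i E \<Longrightarrow> \<Phi> i E \<ge> 1"
    and ne: "\<And>i E. i \<le> N \<Longrightarrow> inv i E \<Longrightarrow> good i E \<Longrightarrow> cliques_in k {1..n} E \<noteq> {}"
    and inv: "\<And>i E C. i < N \<Longrightarrow> inv i E \<Longrightarrow> good i E \<Longrightarrow> C \<in> cliques_in k {1..n} E \<Longrightarrow> inv (Suc i) (E - nsets C 2)"
    and step: "\<And>i E. i < N \<Longrightarrow> inv i E \<Longrightarrow> good i E \<Longrightarrow>
       (\<Sum>C\<in>cliques_in k {1..n} E. \<Phi> (Suc i) (E - nsets C 2)) \<le> real (card (cliques_in k {1..n} E)) * (\<Phi> i E + \<rho>)"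
  shows "i \<le> N \<Longrightarrow> inv i E \<Longrightarrow>
    measure_pmf.prob (removal_run k n E) {G. \<not> (\<forall>j. i + j \<le> N \<longrightarrow> j < length G \<and> good (i + j) (G ! j))}
      \<le> \<Phi> i E + real (N - i) * \<rho>"
proof (induction "N - i" arbitrary: i E)
  case 0
  then have i: "i = N" by simp
  show ?case
  proof (cases "good i E")
    case False
    then have "1 \<le> \<Phi> i E" using bad 0 by blast
    then show ?thesis using i by (simp add: order_trans[OF measure_pmf.prob_le_1])
  next
    case True
    have "G \<noteq> [] \<and> G ! 0 = E" if "G \<in> set_pmf (removal_run k n E)" for G
      using that by (subst (asm) removal_run.simps) (auto split: if_splits)
    then have "set_pmf (removal_run k n E) \<inter> {G. \<not> (\<forall>j. i + j \<le> N \<longrightarrow> j < length G \<and> good (i + j) (G ! j))} = {}"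
      using i True by auto
    then have "measure_pmf.prob (removal_run k n E) {G. \<not> (\<forall>j. i + j \<le> N \<longrightarrow> j < length G \<and> good (i + j) (G ! j))} = 0"
      by (simp add: measure_pmf_zero_iff)
    then show ?thesis using \<Phi>[of i E] \<open>\<rho> \<ge> 0\<close> by simp
  qed
next
  case (Suc l)
  then have i: "i < N" by simp
  let ?A = "cliques_in k {1..n} E"
  let ?bad = "\<lambda>i. {G. \<not> (\<forall>j. i + j \<le> N \<longrightarrow> j < length G \<and> good (i + j) (G ! j))}"
  show ?case
  proof (cases "good i E")
    case False
    then have "1 \<le> \<Phi> i E" using bad Suc by blast
    moreover have "0 \<le> real (N - i) * \<rho>" using \<open>\<rho> \<ge> 0\<close> by simp
    moreover have "measure_pmf.prob (removal_run k n E) (?bad i) \<le> 1" by simp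
    ultimately show ?thesis by linarith
  next
    case True
    have ne': "?A \<noteq> {}" using ne Suc True by blast
    have fin: "finite ?A" by simp
    have run: "removal_run k n E = bind_pmf (pmf_of_set ?A) (\<lambda>C. map_pmf ((#) E) (removal_run k n (E - nsets C 2)))"
      using k ne' by (subst removal_run.simps) auto
    \<comment> \<open>Position 0 is the present graph, which is good; a failure therefore lies in
      the tail, one index earlier.\<close>
    have vim: "(#) E -` ?bad i \<subseteq> ?bad (Suc i)"
    proof
      fix G assume "G \<in> (#) E -` ?bad i"
      then obtain j where j: "i + j \<le> N" "\<not> (j < length (E # G) \<and> good (i + j) ((E # G) ! j))" by auto
      with True obtain j' where "j = Suc j'" by (cases j) auto
      with j show "G \<in> ?bad (Suc i)" by auto
    qed
    have le: "measure_pmf.prob (map_pmf ((#) E) (removal_run k n (E - nsets C 2))) (?bad i)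
        \<le> \<Phi> (Suc i) (E - nsets C 2) + real (N - Suc i) * \<rho>" if C: "C \<in> ?A" for C
    proof -
      have "measure_pmf.prob (map_pmf ((#) E) (removal_run k n (E - nsets C 2))) (?bad i)
        \<le> measure_pmf.prob (removal_run k n (E - nsets C 2)) (?bad (Suc i))"
        unfolding measure_map_pmf by (rule measure_pmf.finite_measure_mono[OF vim]) simp
      also have "\<dots> \<le> \<Phi> (Suc i) (E - nsets C 2) + real (N - Suc i) * \<rho>"
        using Suc.hyps(1)[of "Suc i" "E - nsets C 2"] Suc.hyps(2) Suc.prems inv[OF i Suc.prems(2) True C] i by simp
      finally show ?thesis .
    qed
    have "measure_pmf.prob (removal_run k n E) (?bad i) =
      (\<Sum>C\<in>?A. measure_pmf.prob (map_pmf ((#) E) (removal_run k n (E - nsets C 2))) (?bad i)) / real (card ?A)"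
      unfolding run prob_bind_pmf by (rule integral_pmf_of_set[OF ne' fin])
    also have "\<dots> \<le> (\<Sum>C\<in>?A. \<Phi> (Suc i) (E - nsets C 2) + real (N - Suc i) * \<rho>) / real (card ?A)"
      by (intro divide_right_mono sum_mono le) auto
    also have "\<dots> \<le> (real (card ?A) * (\<Phi> i E + \<rho>) + real (card ?A) * (real (N - Suc i) * \<rho>)) / real (card ?A)"
      using step[OF i Suc.prems(2) True] by (intro divide_right_mono) (auto simp: sum.distrib)
    also have "\<dots> = \<Phi> i E + real (N - i) * \<rho>"
    proof -
      have "real (card ?A) \<noteq> 0" using ne' fin by simp
      moreover have "real (N - i) = real (N - Suc i) + 1" using i by simp
      ultimately show ?thesis by (simp add: field_simps)
    qed
    finally show ?thesis .
  qed
qed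

section \<open>Trajectories and error terms\<close>

lemma self_le_mult: "a \<le> a * b" "a \<le> b * a" if "1 \<le> b" "0 \<le> a" for a b :: real
  using mult_left_mono[OF that] by (simp_all add: mult.commute)

text \<open>Bernoulli's inequality from below and an induction from above. The derivative is written
  with \<open>p ^ j / p\<close> rather than \<open>p ^ (j - 1)\<close>, which avoids truncated
  subtraction; for \<open>j = 0\<close> its coefficient vanishes.\<close>

lemma power_diff_bounds:
  fixes p h :: real
  assumes "0 \<le> h" "h \<le> p" "p \<le> 1" "p > 0"
  shows "p ^ j - real j * h * p ^ j / p \<le> (p - h) ^ j"
    and "(p - h) ^ j \<le> p ^ j - real j * h * p ^ j / p + (real j)\<^sup>2 * h\<^sup>2"
proof -
  have "1 + real j * (- (h / p)) \<le> (1 + (- (h / p))) ^ j"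
    using assms by (intro Bernoulli_inequality) (simp add: divide_le_eq)
  then have "p ^ j * (1 + real j * (- (h / p))) \<le> p ^ j * (1 + (- (h / p))) ^ j"
    using assms by (intro mult_left_mono) auto
  also have "\<dots> = (p * (1 + (- (h / p)))) ^ j" by (simp add: power_mult_distrib)
  also have "p * (1 + (- (h / p))) = p - h" using assms by (simp add: field_simps)
  finally show "p ^ j - real j * h * p ^ j / p \<le> (p - h) ^ j"
    by (simp add: algebra_simps)
  show "(p - h) ^ j \<le> p ^ j - real j * h * p ^ j / p + (real j)\<^sup>2 * h\<^sup>2"
  proof (induction j)
    case (Suc j)
    have "(p - h) ^ Suc j \<le> (p - h) * (p ^ j - real j * h * p ^ j / p + (real j)\<^sup>2 * h\<^sup>2)"
      using Suc assms by (simp add: mult_left_mono)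
    also have "\<dots> = p ^ Suc j - real (Suc j) * h * p ^ Suc j / p
        + (real j * h\<^sup>2 * (p ^ j / p) + (p - h) * (real j)\<^sup>2 * h\<^sup>2)"
      using assms by (simp add: field_simps power2_eq_square)
    also have "real j * h\<^sup>2 * (p ^ j / p) + (p - h) * (real j)\<^sup>2 * h\<^sup>2 \<le> (real (Suc j))\<^sup>2 * h\<^sup>2"
    proof -
      have "real j * (p ^ j / p) \<le> real j"
      proof (cases j)
        case (Suc i)
        then have "p ^ j / p \<le> 1" using assms by (simp add: power_le_one)
        then show ?thesis using mult_left_mono[of "p ^ j / p" 1 "real j"] by simp
      qed simp
      moreover have "(p - h) * (real j)\<^sup>2 \<le> 1 * (real j)\<^sup>2" using assms by (intro mult_right_mono) auto
      ultimately have "real j * (p ^ j / p) + (p - h) * (real j)\<^sup>2 \<le> (real (Suc j))\<^sup>2"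
        by (simp add: power2_eq_square algebra_simps)
      then have "(real j * (p ^ j / p) + (p - h) * (real j)\<^sup>2) * h\<^sup>2 \<le> (real (Suc j))\<^sup>2 * h\<^sup>2"
        by (intro mult_right_mono) auto
      then show ?thesis by (simp add: algebra_simps)
    qed
    finally show ?case by simp
  qed simp
qed

text \<open>All asymptotics are confined to \<open>L_large\<close> and \<open>g_large\<close>. What
  follows is exact for every \<open>n\<close> satisfying them.\<close>

locale removal_regime =
  fixes k n K :: nat and g L :: real
  assumes k: "4 \<le> k" and K_eq: "K = k choose 2"
    and n_eq: "real n = g ^ (2 * K - 2)" and L_eq: "L = ln (real n)"
    and L_large: "2 ^ 10 * real K ^ 4 * fact k \<le> L" and g_large: "L ^ 8 \<le> g"
begin

abbreviation N :: real where "N \<equiv> real n"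
abbreviation kap :: "nat \<Rightarrow> nat" where "kap m \<equiv> K - (m choose 2)"

text \<open>With \<open>g = n powr (1 / (2 K - 2))\<close> the exponents of the statement become integral:
  \<open>n powr alpha k = N ^ k / g ^ (K + 1)\<close>, \<open>n powr beta k m = N ^ (k - m) / g ^ kap m\<close>, and the density
  stays above \<open>L ^ 4 / g\<close> up to the last step. One step of the process lowers the density by \<open>h\<close>.
  The logarithmic exponents are \<open>mu = 4\<close>, \<open>lam = 4\<close> and \<open>gam m = 2\<close>, giving the error terms \<open>Aq\<close> and \<open>eps\<close>.
  The constants \<open>th\<close>, \<open>v\<close> and \<open>d\<close> are the values of \<open>\<theta>\<close>, \<open>V\<close> and \<open>d\<close> used for \<open>R\<close> and \<open>Q\<close>; \<open>cR\<close> bounds the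
  change of the trajectory of \<open>R\<close> in one step, and \<open>NQ\<close> that of the deviation of \<open>Q\<close>.\<close>

definition h :: real where "h = 2 * real K / N\<^sup>2"
definition traj :: "nat \<Rightarrow> real \<Rightarrow> real" where "traj m p = N ^ (k - m) / fact (k - m) * p ^ kap m"
definition q :: "real \<Rightarrow> real" where "q p = N ^ k / fact k * p ^ K"
definition sg :: "real \<Rightarrow> real" where "sg p = 1 - real K / 2 * ln p"
definition om :: "nat \<Rightarrow> real" where "om m = N ^ (k - m) * L\<^sup>2 / g ^ kap m"
definition eps :: "nat \<Rightarrow> real \<Rightarrow> real" where "eps m p = sg p * om m"
definition Aq :: "real \<Rightarrow> real" where "Aq p = (sg p)\<^sup>2 * (N ^ k * L ^ 4 / g ^ (K + 1)) / p"
definition Bq :: "real \<Rightarrow> real" where "Bq p = N ^ (k - 1) / 2 * p ^ (K - 4)"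
definition cR :: "nat \<Rightarrow> real" where "cR m = 4 * (real K)\<^sup>2 * N ^ (k - m) / N\<^sup>2"
definition vR :: "nat \<Rightarrow> real" where "vR m = 64 * real K ^ 4 * (N ^ (k - m))\<^sup>2 / N ^ 3"
definition thR :: "nat \<Rightarrow> real" where "thR m = g ^ (K - 1) / N ^ (k - m)"
definition dR :: "nat \<Rightarrow> real" where "dR m = h * real K * om m / 4"
definition G :: real where "G = g ^ (K - 1)"
definition X :: real where "X = N ^ (k - 2)"
definition NQ :: real where "NQ = X * L ^ 4 / G"
definition thQ :: real where "thQ = 1 / (X * G)"
definition dQ :: real where "dQ = X * L ^ 8 / G ^ 3"

lemma K_k: "2 * real K = real k * (real k - 1)" "K = (k - 1) + ((k - 1) choose 2)"
proof -
  have "even (k * (k - 1))" using k by (cases "even k") auto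
  then have "2 * K = k * (k - 1)" unfolding K_eq choose_two by simp
  then have "real (2 * K) = real (k * (k - 1))" by (rule arg_cong)
  then show "2 * real K = real k * (real k - 1)" using k by (simp add: of_nat_diff)
  obtain j where "k = Suc j" using k by (cases k) auto
  then show "K = (k - 1) + ((k - 1) choose 2)" by (simp add: K_eq numeral_2_eq_2)
qed

lemma K6: "6 \<le> K" and k_le_K: "k \<le> K" and K6': "6 \<le> real K"
proof -
  have "(3::nat) choose 2 \<le> (k - 1) choose 2" using k by (intro binomial_right_mono) auto
  then have "3 \<le> (k - 1) choose 2" by (simp add: choose_two)
  then show "6 \<le> K" "k \<le> K" using K_k k by linarith+
  then show "6 \<le> real K" by simp
qed

text \<open>As \<open>K = (k - 1) + ((k - 1) choose 2)\<close> and \<open>m \<le> k - 1\<close>, an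
  extension has at least \<open>k - 1\<close> edges. The resulting minimum 3 decides which power of
  \<open>L\<close> the density must keep, see \<open>eps_le_traj\<close>.\<close>

lemma kap_facts:
  assumes "2 \<le> m" "m \<le> k - 1"
  shows "1 \<le> m choose 2" "3 \<le> kap m" "kap m \<le> K - 1" "kap m + (m choose 2) = K"
    "real (kap m) \<le> real K" "k - m \<ge> 1"
proof -
  have "(2::nat) choose 2 \<le> m choose 2" using assms by (intro binomial_right_mono) auto
  then show 1: "1 \<le> m choose 2" by simp
  have "m choose 2 \<le> (k - 1) choose 2" using assms by (intro binomial_right_mono) auto
  then have 2: "(m choose 2) + (k - 1) \<le> K" using K_k(2) by linarith
  then show "3 \<le> kap m" using k by linarith
  show "kap m \<le> K - 1" using 1 by linarith
  show "kap m + (m choose 2) = K" using 2 by linarith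
  show "real (kap m) \<le> real K" by simp
  show "k - m \<ge> 1" using assms k by linarith
qed

lemma kap_small: "kap 2 = K - 1" "kap 3 = K - 3"
  by (simp_all add: choose_two)

lemma L_bounds: "1000 * real K ^ 4 \<le> L" "1000 * real K \<le> L" "1000 * real K ^ 2 \<le> L" "1000 \<le> L" "1 \<le> L"
    "1000 * (real K * fact k) \<le> L"
proof -
  have f: "1 \<le> (fact k :: real)" by simp
  have K1: "1 \<le> real K" using K6' by simp
  have e: "real K ^ 4 \<le> real K ^ 4 * fact k" using f by (intro self_le_mult) auto
  have Kf0: "0 \<le> real K ^ 4 * fact k" by simp
  have top: "1000 * (real K ^ 4 * fact k) \<le> L" using L_large Kf0 by (auto simp: mult.assoc intro: order_trans[rotated])
  then show 4: "1000 * real K ^ 4 \<le> L" using e by linarith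
  have 1: "real K ^ 1 \<le> real K ^ 4" and 2: "real K ^ 2 \<le> real K ^ 4"
    using K1 by (intro power_increasing; simp)+
  then show "1000 * real K \<le> L" "1000 * real K ^ 2 \<le> L" using 4 unfolding power_one_right by linarith+
  then show "1000 \<le> L" "1 \<le> L" using K1 by linarith+
  have "real K * fact k \<le> real K ^ 4 * fact k" using 1 by (intro mult_right_mono) auto
  then show "1000 * (real K * fact k) \<le> L" using top by linarith
qed

lemma L_fact:
  assumes "j \<le> k"
  shows "1000 * (real K * fact j) \<le> L" "fact j \<le> L"
proof -
  have "real K * fact j \<le> real K * fact k" using assms by (intro mult_left_mono fact_mono) auto
  then show *: "1000 * (real K * fact j) \<le> L" using L_bounds(6) by linarith
  have "fact j \<le> real K * fact j" using K6' by (intro self_le_mult) auto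
  moreover have "0 \<le> real K * fact j" by simp
  ultimately show "fact j \<le> L" using * by linarith
qed

lemma Lg: "L \<le> g" "L \<le> L ^ 8" "1 \<le> g" "0 < g" "0 < L" "0 < N" "1 \<le> N" "g \<le> N" "L \<le> N"
proof -
  show a: "L \<le> L ^ 8" using L_bounds(5) by (simp add: self_le_power)
  then show b: "L \<le> g" using g_large by linarith
  show "1 \<le> g" "0 < g" "0 < L" using b L_bounds(5) by linarith+
  then show "0 < N" "1 \<le> N" "g \<le> N" unfolding n_eq using K6 by (auto intro: self_le_power)
  then show "L \<le> N" using b by linarith
qed

lemma N_gg: "N = g ^ (K - 1) * g ^ (K - 1)" "g ^ (K - 1) \<le> N" "L \<le> g ^ (K - 1)" "j \<le> K - 1 \<Longrightarrow> g ^ j \<le> g ^ (K - 1)"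
proof -
  have "2 * K - 2 = (K - 1) + (K - 1)" by simp
  then show "N = g ^ (K - 1) * g ^ (K - 1)" unfolding n_eq by (simp only: power_add)
  show "g ^ (K - 1) \<le> N" unfolding n_eq using Lg K6 by (intro power_increasing) auto
  have "g \<le> g ^ (K - 1)" using Lg K6 by (intro self_le_power) auto
  then show "L \<le> g ^ (K - 1)" using Lg by linarith
  show "j \<le> K - 1 \<Longrightarrow> g ^ j \<le> g ^ (K - 1)" using Lg by (intro power_increasing) auto
qed

lemma h_pos: "0 < h" using Lg K6' by (simp add: h_def)

lemma om_pos: "0 < om m" using Lg by (simp add: om_def)

lemma om_ge: "m \<le> k - 1 \<Longrightarrow> 2 \<le> m \<Longrightarrow> N ^ (k - m) * L\<^sup>2 \<le> om m * g ^ (K - 1)"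
proof -
  assume m: "m \<le> k - 1" "2 \<le> m"
  have "N ^ (k - m) * L\<^sup>2 / g ^ (K - 1) \<le> om m"
    unfolding om_def using N_gg(4)[of "kap m"] kap_facts[OF m(2,1)] Lg
    by (intro divide_left_mono) auto
  then show ?thesis using Lg by (simp add: field_simps)
qed

lemma thR_pos: "0 < thR m" and thQ_pos: "0 < thQ"
  using Lg by (auto simp: thR_def thQ_def X_def G_def)

end

text \<open>One moment of the process. With the density measured in units of \<open>1 / g\<close>,
  the comparisons below reduce to powers of \<open>p * g\<close>, each of which is worth four powers
  of \<open>L\<close>.\<close>

locale removal_density = removal_regime +
  fixes p :: real
  assumes pL: "L ^ 4 \<le> p * g" and p1: "p \<le> 1"
begin

section \<open>Size comparisons at a fixed density\<close>

lemma p_pos: "0 < p"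
proof -
  have "0 < p * g" using pL Lg by (smt (verit) zero_less_power)
  then show ?thesis using Lg by (simp add: zero_less_mult_iff)
qed

lemma P_facts: "L ^ (4 * j) \<le> (p * g) ^ j" "1 \<le> p * g" "p * g \<le> g" "L \<le> p * g"
proof -
  have "(L ^ 4) ^ j \<le> (p * g) ^ j" using pL Lg by (intro power_mono) auto
  then show "L ^ (4 * j) \<le> (p * g) ^ j" by (simp add: power_mult)
  have "L \<le> L ^ 4" using L_bounds by (intro self_le_power) auto
  then show "L \<le> p * g" "1 \<le> p * g" using pL L_bounds(5) by linarith+
  show "p * g \<le> g" using p1 Lg by simp
qed

lemma P_obtain: obtains P where "p = P / g" "1 \<le> P" "P \<le> g" "L \<le> P" "\<And>j. L ^ (4 * j) \<le> P ^ j" "0 < P"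
  using that[of "p * g"] P_facts Lg by simp

lemma ln_N_g: "L = (2 * real K - 2) * ln g"
proof -
  have "L = real (2 * K - 2) * ln g" unfolding L_eq n_eq using Lg by (simp add: ln_realpow)
  then show ?thesis using K6 by (simp add: of_nat_diff)
qed

text \<open>Since \<open>p \<ge> 1 / g\<close> and \<open>ln g\<close> equals
  \<open>L / (2 * K - 2)\<close>, the growth of \<open>sg\<close> over the whole run costs at most
  one factor \<open>L\<close>.\<close>

lemma sg_bounds: "1 \<le> sg p" "sg p \<le> L"
proof -
  have "ln p \<le> 0" using p_pos p1 by simp
  then show "1 \<le> sg p" unfolding sg_def by (simp add: mult_nonneg_nonpos)
  have "1 / g \<le> p" using P_facts(2) Lg by (simp add: divide_le_eq)
  then have "ln (1 / g) \<le> ln p" using Lg p_pos by (subst ln_le_cancel_iff) auto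
  then have "- ln g \<le> ln p" using Lg by (simp add: ln_div)
  then have "real K / 2 * (- ln p) \<le> real K / 2 * ln g" by (intro mult_left_mono) auto
  also have "\<dots> \<le> L / 2"
  proof -
    have "0 \<le> ln g" using Lg by simp
    then have "real K * ln g \<le> (2 * real K - 2) * ln g" using K6' by (intro mult_right_mono) auto
    then show ?thesis using ln_N_g by simp
  qed
  finally show "sg p \<le> L" unfolding sg_def using L_bounds(4) by simp
qed

lemma sg2: "0 < sg p" "(sg p)\<^sup>2 \<le> L\<^sup>2" "1 \<le> (sg p)\<^sup>2"
  using sg_bounds by (auto intro: power_mono)

text \<open>Twelve powers of \<open>L\<close> are to be covered: one for \<open>sg\<close>, two in
  \<open>om\<close>, the eight claimed and one for the factorial. The trajectory offers
  \<open>(p * g) ^ kap m\<close> with \<open>kap m \<ge> 3\<close>, and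
  \<open>p * g \<ge> L ^ 4\<close> makes this at least \<open>L ^ 12\<close>.\<close>

lemma eps_le_traj:
  assumes m: "2 \<le> m" "m \<le> k - 1"
  shows "eps m p * L ^ 8 \<le> traj m p"
proof -
  obtain P where P: "p = P / g" "1 \<le> P" "P \<le> g" "L \<le> P" "\<And>j. L ^ (4 * j) \<le> P ^ j" "0 < P"
    by (rule P_obtain) (rule that)
  define c where "c = N ^ (k - m) / (fact (k - m) * g ^ kap m)"
  have c: "0 \<le> c" unfolding c_def using Lg by auto
  have "L ^ 10 = L\<^sup>2 * L ^ 8" by (simp flip: power_add)
  then have 1: "eps m p * L ^ 8 = c * (sg p * L ^ 10 * fact (k - m))"
    unfolding eps_def om_def c_def by simp
  have 2: "traj m p = c * P ^ kap m"
    unfolding traj_def c_def P(1) by (simp add: power_divide mult_ac)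
  have "sg p * L ^ 10 * fact (k - m) \<le> L * L ^ 10 * L"
    using sg_bounds sg2 L_fact(2)[of "k - m"] Lg by (intro mult_mono) auto
  also have "\<dots> = L ^ (4 * 3)" by (simp add: algebra_simps flip: power_Suc power_Suc2)
  also have "\<dots> \<le> P ^ 3" by (rule P)
  also have "\<dots> \<le> P ^ kap m" using P kap_facts[OF m] by (intro power_increasing) auto
  finally show ?thesis unfolding 1 2 using c by (intro mult_left_mono) auto
qed

text \<open>Edge degrees have the smallest relative error among the tracked counts. For
  \<open>m > 2\<close> the exponent \<open>kap m\<close> is smaller than \<open>K - 1\<close>, and
  one spare factor \<open>p * g\<close> absorbs \<open>fact (k - 2)\<close>. This is the inequality
  that stops errors from reinforcing each other.\<close>

lemma traj_om_le:
  assumes m: "2 \<le> m" "m \<le> k - 1"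
  shows "traj m p * om 2 \<le> traj 2 p * om m"
proof -
  obtain P where P: "p = P / g" "1 \<le> P" "P \<le> g" "L \<le> P" "\<And>j. L ^ (4 * j) \<le> P ^ j" "0 < P"
    by (rule P_obtain) (rule that)
  define c where "c = N ^ (k - m) * N ^ (k - 2) * L\<^sup>2 / (fact (k - m) * fact (k - 2) * g ^ kap m * g ^ (K - 1))"
  have c: "0 \<le> c" unfolding c_def using Lg by auto
  have 1: "traj m p * om 2 = c * (P ^ kap m * fact (k - 2))"
    unfolding traj_def om_def c_def P(1) kap_small by (simp add: power_divide mult_ac)
  have 2: "traj 2 p * om m = c * (P ^ (K - 1) * fact (k - m))"
    unfolding traj_def om_def c_def P(1) kap_small by (simp add: power_divide mult_ac)
  have "P ^ kap m * fact (k - 2) \<le> P ^ (K - 1) * fact (k - m)"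
  proof (cases "m = 2")
    case True
    then show ?thesis by (simp add: kap_small)
  next
    case False
    then have "(3::nat) choose 2 \<le> m choose 2" using m by (intro binomial_right_mono) auto
    then have M: "K - 1 = kap m + ((m choose 2) - 1)" "1 \<le> (m choose 2) - 1"
      using kap_facts[OF m] choose_two[of 3] by (simp_all; linarith)+
    have "fact (k - 2) \<le> P" using L_fact(2)[of "k - 2"] P by simp
    also have "P \<le> P ^ ((m choose 2) - 1)" using P M by (intro self_le_power) auto
    also have "\<dots> \<le> P ^ ((m choose 2) - 1) * fact (k - m)"
      using P by (intro self_le_mult) auto
    finally have "P ^ kap m * fact (k - 2) \<le> P ^ kap m * (P ^ ((m choose 2) - 1) * fact (k - m))"
      using P by (intro mult_left_mono) auto
    also have "\<dots> = P ^ (K - 1) * fact (k - m)" unfolding M(1) by (simp add: power_add)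
    finally show ?thesis .
  qed
  then show ?thesis unfolding 1 2 using c by (intro mult_left_mono) auto
qed

text \<open>\<open>Q\<close> enters the drift of \<open>R\<close> as a denominator; its relative
  uncertainty \<open>Aq / q\<close> is smaller than the window scale \<open>om m / traj m\<close> by
  three powers of \<open>L\<close>.\<close>

lemma traj_Aq_le:
  assumes m: "2 \<le> m" "m \<le> k - 1"
  shows "traj m p * Aq p * L ^ 3 \<le> q p * om m"
proof -
  obtain P where P: "p = P / g" "1 \<le> P" "P \<le> g" "L \<le> P" "\<And>j. L ^ (4 * j) \<le> P ^ j" "0 < P"
    by (rule P_obtain) (rule that)
  define c where "c = N ^ (k - m) * N ^ k / (fact (k - m) * fact k * g ^ kap m * g ^ K * P)"
  have c: "0 \<le> c" unfolding c_def using Lg P by auto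
  have "traj m p * Aq p * L ^ 3 = N ^ (k - m) * N ^ k / (fact (k - m) * g ^ kap m * g ^ K * P)
      * (P ^ kap m * (sg p)\<^sup>2) * (L ^ 4 * L ^ 3)"
    unfolding traj_def Aq_def P(1) using Lg P by (simp add: power_divide mult_ac)
  also have "L ^ 4 * L ^ 3 = L ^ 7" by (simp flip: power_add)
  finally have 1: "traj m p * Aq p * L ^ 3 = c * (P ^ kap m * ((sg p)\<^sup>2 * L ^ 7 * fact k))"
    unfolding c_def by (simp add: mult_ac)
  have 2: "q p * om m = c * (P ^ (K + 1) * fact (k - m) * L\<^sup>2)"
    unfolding q_def om_def c_def P(1) using P by (simp add: power_divide mult_ac)
  have "(sg p)\<^sup>2 * L ^ 7 * fact k \<le> L\<^sup>2 * L ^ 7 * L"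
    using sg2 L_fact(2)[of k] Lg by (intro mult_mono) auto
  also have "\<dots> = L ^ (4 * 2) * L\<^sup>2" by (simp flip: power_add power_Suc2)
  also have "\<dots> \<le> P ^ 2 * L\<^sup>2" using P(5)[of 2] by (intro mult_right_mono) auto
  also have "\<dots> \<le> P ^ ((m choose 2) + 1) * L\<^sup>2"
    using P kap_facts[OF m] by (intro mult_right_mono power_increasing) auto
  also have "\<dots> \<le> P ^ ((m choose 2) + 1) * L\<^sup>2 * fact (k - m)"
      using P by (intro self_le_mult) auto
  finally have "P ^ kap m * ((sg p)\<^sup>2 * L ^ 7 * fact k) \<le> P ^ kap m * (P ^ ((m choose 2) + 1) * L\<^sup>2 * fact (k - m))"
    using P by (intro mult_left_mono) auto
  also have "\<dots> = P ^ (K + 1) * fact (k - m) * L\<^sup>2"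
  proof -
    have "K + 1 = kap m + ((m choose 2) + 1)" using kap_facts(4)[OF m] by linarith
    then have "P ^ (K + 1) = P ^ kap m * P ^ ((m choose 2) + 1)" by (simp only: power_add)
    then show ?thesis by (simp only: mult_ac)
  qed
  finally show ?thesis unfolding 1 2 using c by (intro mult_left_mono) auto
qed

lemma Aq_le: "Aq p * L ^ 16 \<le> q p"
proof -
  obtain P where P: "p = P / g" "1 \<le> P" "P \<le> g" "L \<le> P" "\<And>j. L ^ (4 * j) \<le> P ^ j" "0 < P"
    by (rule P_obtain) (rule that)
  define c where "c = N ^ k / (fact k * g ^ K * P)"
  have c: "0 \<le> c" unfolding c_def using Lg P by auto
  have "L ^ 4 * L ^ 16 = L ^ 20" by (simp flip: power_add)
  then have 1: "Aq p * L ^ 16 = c * ((sg p)\<^sup>2 * L ^ 20 * fact k)"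
    unfolding Aq_def c_def P(1) using Lg P by simp
  have 2: "q p = c * P ^ (K + 1)"
    unfolding q_def c_def P(1) using P by (simp add: power_divide mult_ac)
  have "(sg p)\<^sup>2 * L ^ 20 * fact k \<le> L\<^sup>2 * L ^ 20 * L"
    using sg2 L_fact(2)[of k] Lg by (intro mult_mono) auto
  also have "\<dots> = L ^ 23" by (simp flip: power_add power_Suc2)
  also have "\<dots> \<le> L ^ (4 * 7)" using L_bounds by (intro power_increasing) auto
  also have "\<dots> \<le> P ^ 7" by (rule P)
  also have "\<dots> \<le> P ^ (K + 1)" using P K6 by (intro power_increasing) auto
  finally show ?thesis unfolding 1 2 using c by (intro mult_left_mono) auto
qed

text \<open>The counterpart of \<open>traj_Aq_le\<close> for the upper error of \<open>Q\<close>.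
  The gain lies in \<open>N = g ^ (K - 1) * g ^ (K - 1)\<close>, against which at most
  \<open>g ^ (K - 1)\<close> has to be paid after \<open>p ^ 4\<close> is split off.\<close>

lemma traj_Bq_le:
  assumes m: "2 \<le> m" "m \<le> k - 1"
  shows "traj m p * Bq p * L \<le> q p * om m"
proof -
  obtain P where P: "p = P / g" "1 \<le> P" "P \<le> g" "L \<le> P" "\<And>j. L ^ (4 * j) \<le> P ^ j" "0 < P"
    by (rule P_obtain) (rule that)
  define c where "c = N ^ (k - m) * N ^ (k - 1) * p ^ (K - 4) / (fact (k - m) * fact k * g ^ kap m)"
  have c: "0 \<le> c" unfolding c_def using Lg P by auto
  have 1: "traj m p * Bq p * L = c * (P ^ kap m * L * fact k / 2)"
    unfolding traj_def Bq_def c_def using Lg P by (simp add: power_divide mult_ac)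
  have pK: "p ^ K = p ^ (K - 4) * p ^ 4" using K6 by (simp flip: power_add)
  have Nk: "N ^ k = N ^ (k - 1) * N" using k by (simp flip: power_Suc2)
  have 2: "q p * om m = c * (N * p ^ 4 * L\<^sup>2 * fact (k - m))"
    unfolding q_def om_def c_def pK Nk by simp
  have "P ^ kap m * L * fact k / 2 \<le> P ^ (K - 1) * L * L"
  proof -
    have "P ^ kap m * L * fact k \<le> P ^ (K - 1) * L * L"
      using P kap_facts[OF m] L_fact(2)[of k] Lg by (intro mult_mono power_increasing) auto
    moreover have "0 \<le> P ^ (K - 1) * L * L" using P Lg by simp
    ultimately show ?thesis by linarith
  qed
  also have "P ^ (K - 1) = P ^ 4 * P ^ (K - 5)" using K6 by (simp flip: power_add)
  also have "P ^ 4 * P ^ (K - 5) * L * L \<le> P ^ 4 * g ^ (K - 5) * L * L"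
    using P Lg by (intro mult_right_mono mult_left_mono power_mono) auto
  also have "\<dots> = p ^ 4 * g ^ (K - 1) * L\<^sup>2"
  proof -
    have "g ^ (K - 1) = g ^ 4 * g ^ (K - 5)" using K6 by (simp flip: power_add)
    then show ?thesis unfolding P(1) using Lg by (simp add: power_divide power2_eq_square)
  qed
  also have "\<dots> \<le> p ^ 4 * N * L\<^sup>2" using N_gg by (intro mult_right_mono mult_left_mono) auto
  also have "\<dots> \<le> N * p ^ 4 * L\<^sup>2 * fact (k - m)"
    using Lg self_le_mult(1)[of "fact (k - m)" "p ^ 4 * N * L\<^sup>2"] by (simp add: mult_ac)
  finally show ?thesis unfolding 1 2 using c by (intro mult_left_mono) auto
qed

text \<open>The ratio \<open>Bq p / q p\<close> is a constant multiple of
  \<open>1 / (N * p ^ 4)\<close>, so this makes the upper error of \<open>Q\<close> negligible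
  against \<open>q\<close>.\<close>

lemma Np4_ge: "g ^ 6 \<le> N * p ^ 4"
proof -
  have 1: "1 / g \<le> p" using P_facts(2) Lg by (simp add: divide_le_eq)
  have *: "g ^ (2 * K - 2 - j) \<le> N * p ^ j" if "j \<le> 2 * K - 2" for j
  proof -
    have "g ^ (2 * K - 2 - j) = N * (1 / g) ^ j"
      unfolding n_eq using that Lg power_diff[of g j "2 * K - 2"] by (simp add: power_divide del: diff_diff_left)
    also have "\<dots> \<le> N * p ^ j" using 1 Lg by (intro mult_left_mono power_mono) auto
    finally show ?thesis .
  qed
  have "g ^ 6 \<le> g ^ (2 * K - 2 - 4)" using Lg K6 by (intro power_increasing) auto
  then show ?thesis using *[of 4] K6 by linarith
qed

lemma Bq_le: "Bq p * L \<le> q p"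
proof -
  have pK: "p ^ K = p ^ (K - 4) * p ^ 4" using K6 by (simp flip: power_add)
  have Nk: "N ^ k = N ^ (k - 1) * N" using k by (simp flip: power_Suc2)
  define c where "c = N ^ (k - 1) * p ^ (K - 4) / fact k"
  have c: "0 \<le> c" unfolding c_def using p_pos by simp
  have 1: "Bq p * L = c * (L * fact k / 2)" unfolding Bq_def c_def by simp
  have 2: "q p = c * (N * p ^ 4)" unfolding q_def c_def pK Nk by simp
  have "L * fact k \<le> L * L" using L_fact(2)[of k] Lg by (intro mult_left_mono) auto
  also have "\<dots> \<le> g * g" using Lg by (intro mult_mono) auto
  also have "\<dots> = g ^ 2" by (simp add: power2_eq_square)
  also have "\<dots> \<le> g ^ 6" using Lg by (intro power_increasing) auto
  also have "\<dots> \<le> N * p ^ 4" by (rule Np4_ge)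
  finally have "L * fact k / 2 \<le> N * p ^ 4" using Lg by (smt (verit) field_sum_of_halves fact_ge_zero mult_nonneg_nonneg)
  then show ?thesis unfolding 1 2 using c by (intro mult_left_mono) auto
qed

text \<open>Makes the double counting correction \<open>N ^ (k - 3)\<close> of
  \<open>sum_loss_bounds\<close> negligible in the drift of \<open>R\<close>.\<close>

lemma traj_N3_le:
  assumes m: "2 \<le> m" "m \<le> k - 1"
  shows "traj m p * N ^ (k - 3) * L ^ 3 \<le> traj 2 p * om m"
proof -
  obtain P where P: "p = P / g" "1 \<le> P" "P \<le> g" "L \<le> P" "\<And>j. L ^ (4 * j) \<le> P ^ j" "0 < P"
    by (rule P_obtain) (rule that)
  define c where "c = N ^ (k - m) * N ^ (k - 3) * L\<^sup>2 / (fact (k - m) * fact (k - 2) * g ^ kap m * g ^ (K - 1))"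
  have c: "0 \<le> c" unfolding c_def using Lg by auto
  have 1: "traj m p * N ^ (k - 3) * L ^ 3 = c * (P ^ kap m * (L * fact (k - 2) * g ^ (K - 1)))"
    unfolding traj_def c_def P(1) using Lg by (simp add: power_divide power2_eq_square power3_eq_cube mult_ac)
  have Nk: "N ^ (k - 2) = N ^ (k - 3) * N" using k by (simp flip: power_Suc2 add: Suc_diff_le numeral_eq_Suc Suc_diff_Suc)
  have 2: "traj 2 p * om m = c * (P ^ (K - 1) * (N * fact (k - m)))"
    unfolding traj_def om_def c_def P(1) kap_small Nk by (simp add: power_divide mult_ac)
  have "L * fact (k - 2) \<le> L * L" using L_fact(2)[of "k - 2"] Lg by (intro mult_left_mono) auto
  also have "\<dots> \<le> g * g" using Lg by (intro mult_mono) auto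
  also have "\<dots> = g ^ 2" by (simp add: power2_eq_square)
  also have "\<dots> \<le> g ^ (K - 1)" using K6 by (intro N_gg) auto
  finally have "L * fact (k - 2) * g ^ (K - 1) \<le> g ^ (K - 1) * g ^ (K - 1)" using Lg by (intro mult_right_mono) auto
  also have "\<dots> = N" using N_gg(1) by simp
  also have "\<dots> \<le> N * fact (k - m)" by (intro self_le_mult) auto
  finally have "P ^ kap m * (L * fact (k - 2) * g ^ (K - 1)) \<le> P ^ (K - 1) * (N * fact (k - m))"
    by (intro mult_mono'[OF power_increasing]) (use P kap_facts[OF m] Lg in auto)
  then show ?thesis unfolding 1 2 using c by (intro mult_left_mono) auto
qed

text \<open>Here and in \<open>traj_le_p\<close> one factor \<open>p\<close> is kept in order to
  cancel the denominator of \<open>h / p\<close>, so that one-step changes are of order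
  \<open>h * N ^ (k - m)\<close>.\<close>

lemma om_le_p:
  assumes m: "2 \<le> m" "m \<le> k - 1"
  shows "om m \<le> N ^ (k - m) * p"
proof -
  obtain P where P: "p = P / g" "1 \<le> P" "P \<le> g" "L \<le> P" "\<And>j. L ^ (4 * j) \<le> P ^ j" "0 < P"
    by (rule P_obtain) (rule that)
  have "L\<^sup>2 \<le> L ^ (4 * 1)" using L_bounds by (intro power_increasing) auto
  also have "\<dots> \<le> P" using P(5)[of 1] by simp
  finally have "L\<^sup>2 \<le> P" .
  have "g ^ 1 \<le> g ^ kap m" using Lg kap_facts[OF m] by (intro power_increasing) auto
  then have "om m \<le> N ^ (k - m) * L\<^sup>2 / g" unfolding om_def using Lg by (intro divide_left_mono) auto
  also have "\<dots> \<le> N ^ (k - m) * P / g" using \<open>L\<^sup>2 \<le> P\<close> Lg by (intro divide_right_mono mult_left_mono) auto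
  finally show ?thesis using P(1) by simp
qed

lemma traj_le_p:
  assumes m: "2 \<le> m" "m \<le> k - 1"
  shows "traj m p \<le> N ^ (k - m) * p"
proof -
  have "p ^ kap m \<le> p ^ 1" using kap_facts[OF m] p_pos p1 by (intro power_decreasing) auto
  moreover have "N ^ (k - m) / fact (k - m) \<le> N ^ (k - m)"
    by (simp add: divide_le_eq self_le_mult)
  ultimately show ?thesis unfolding traj_def using p_pos by (intro mult_mono) auto
qed

lemma traj_pos: "0 < traj m p" and q_pos: "0 < q p" and Bq_pos: "0 < Bq p" and Aq_pos: "0 < Aq p"
  using p_pos Lg sg2 by (simp_all add: traj_def q_def Bq_def Aq_def)

text \<open>The handshake identity for trajectories: \<open>K * q p\<close> spread over
  \<open>N\<^sup>2 * p / 2\<close> edges. It turns the rate \<open>traj 2 p / q p\<close> at which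
  an edge is hit into the relative decrease \<open>h / p\<close> of the density.\<close>

lemma traj2_q: "traj 2 p = (h / p) * q p"
proof -
  have f: "fact k = real k * (real k - 1) * fact (k - 2)"
  proof -
    define j where "j = k - 2"
    have "k = Suc (Suc j)" using k by (simp add: j_def)
    then show ?thesis by (simp add: algebra_simps)
  qed
  have pK: "p ^ K = p ^ (K - 1) * p" using K6 by (simp flip: power_Suc2)
  have "k = (k - 2) + 2" using k by simp
  then have Nk: "N ^ k = N ^ (k - 2) * N\<^sup>2" by (metis power_add)
  show ?thesis unfolding traj_def q_def h_def kap_small pK Nk f K_k(1)
    using p_pos Lg k by (simp add: field_simps)
qed

lemma h_le_p: "h * 1000 \<le> p"
proof -
  have "h * 1000 = 2000 * real K / N\<^sup>2" by (simp add: h_def)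
  also have "\<dots> \<le> (L * L) / N\<^sup>2"
  proof (intro divide_right_mono)
    have "2000 * real K \<le> 2 * L" using L_bounds by linarith
    also have "\<dots> \<le> L * L" using L_bounds by (intro mult_right_mono) auto
    finally show "2000 * real K \<le> L * L" .
  qed auto
  also have "L * L \<le> L ^ 8" using L_bounds power_increasing[of 2 8 L] by (simp add: power2_eq_square)
  also have "L ^ 8 \<le> g" by (rule g_large)
  also have "g / N\<^sup>2 \<le> N / N\<^sup>2" using Lg by (intro divide_right_mono) auto
  also have "N / N\<^sup>2 = 1 / N" by (simp add: power2_eq_square)
  also have "1 / N \<le> 1 / g" using Lg by (intro divide_left_mono) auto
  also have "1 / g \<le> p" using P_facts(2) Lg by (simp add: divide_le_eq)
  finally show ?thesis using Lg by (simp add: divide_right_mono)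
qed

text \<open>The lower bound is the reserve on which the drift estimates for \<open>R\<close> draw;
  the upper bound, with its spare factor 2, only controls step sizes.\<close>

lemma sg_diff: "real K / 2 * (h / p) \<le> sg (p - h) - sg p" "sg (p - h) - sg p \<le> real K * (h / p)"
proof -
  have h: "0 < p - h" "h / p \<le> 1 / 2" using h_le_p p_pos h_pos by (auto simp: divide_le_eq)
  have "ln (p - h) - ln p = ln ((p - h) / p)" using h p_pos by (simp add: ln_div)
  also have "\<dots> \<le> (p - h) / p - 1" using h p_pos by (intro ln_le_minus_one) auto
  finally have 1: "h / p \<le> ln p - ln (p - h)" using p_pos by (simp add: diff_divide_distrib)
  have "ln p - ln (p - h) = ln (p / (p - h))" using h p_pos by (simp add: ln_div)
  also have "\<dots> \<le> p / (p - h) - 1" using h p_pos by (intro ln_le_minus_one) auto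
  also have "\<dots> = h / (p - h)" using h by (simp add: field_simps)
  also have "\<dots> \<le> h / (p / 2)" using h p_pos h_pos by (intro divide_left_mono) (auto simp: field_simps)
  also have "h / (p / 2) = 2 * (h / p)" by simp
  finally have 2: "ln p - ln (p - h) \<le> 2 * (h / p)" .
  have e: "sg (p - h) - sg p = real K / 2 * (ln p - ln (p - h))" by (simp add: sg_def algebra_simps)
  show "real K / 2 * (h / p) \<le> sg (p - h) - sg p" unfolding e using 1 by (intro mult_left_mono) auto
  have "real K / 2 * (ln p - ln (p - h)) \<le> real K / 2 * (2 * (h / p))" using 2 by (intro mult_left_mono) auto
  also have "\<dots> = real K * (h / p)" by simp
  finally show "sg (p - h) - sg p \<le> real K * (h / p)" unfolding e .
qed

end

section \<open>Drift of the extension counts\<close>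

text \<open>\<open>r2\<close>, \<open>e2\<close> belong to the degrees, \<open>n3\<close> is the
  double counting correction and \<open>yB\<close> the possible excess of \<open>Q\<close> times
  \<open>h / p\<close>. The products \<open>r * r2\<close> cancel, \<open>r * e2\<close> is paid by
  \<open>r2 * e\<close>, and \<open>K' * om / 4\<close> covers the window \<open>om / 8\<close>
  together with four thousandths from the remaining terms.\<close>

lemma upper_drift_arith:
  fixes r2 e2 n3 yB r e om \<kappa> K' Rv :: real
  assumes nn: "0 \<le> r2" "0 \<le> e2" "0 \<le> n3" "0 \<le> yB" "0 \<le> om" "0 \<le> \<kappa>" "\<kappa> \<le> K'"
    and a1: "r * e2 \<le> r2 * e" and a2: "e * e2 \<le> r2 * om / 1000" and a3: "\<kappa> * (r * n3) \<le> r2 * om / 1000"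
    and a4: "e \<le> r" and a5: "yB * r \<le> r2 * om / 1000"
    and Rv: "r + e - om / 8 \<le> Rv" "Rv \<le> r + e"
  shows "(r2 + yB) * (\<kappa> * r - K' * om / 4) \<le> Rv * (\<kappa> * (r2 - e2) - \<kappa>\<^sup>2 * n3)"
proof -
  have 1: "(r + e - om / 8) * r2 \<le> Rv * r2" using Rv nn by (intro mult_right_mono) auto
  have "Rv * e2 \<le> (r + e) * e2" using Rv nn by (intro mult_right_mono) auto
  then have 2: "Rv * e2 \<le> r2 * e + r2 * om / 1000" using a1 a2 by (simp add: algebra_simps)
  have "\<kappa> * (Rv * n3) \<le> \<kappa> * ((r + r) * n3)" using Rv nn a4 by (intro mult_left_mono mult_right_mono) auto
  then have 3: "\<kappa> * (Rv * n3) \<le> 2 * (r2 * om / 1000)" using a3 by (simp add: algebra_simps)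
  have "r * r2 - om * r2 / 8 - 3 * (r2 * om / 1000) \<le> Rv * r2 - Rv * e2 - \<kappa> * (Rv * n3)"
    using 1 2 3 by (simp add: algebra_simps)
  from mult_left_mono[OF this, of \<kappa>]
  have 4: "\<kappa> * (r * r2 - om * r2 / 8 - 3 * (r2 * om / 1000)) \<le> Rv * (\<kappa> * (r2 - e2) - \<kappa>\<^sup>2 * n3)"
    using nn by (simp add: algebra_simps power2_eq_square)
  have 5: "\<kappa> * (yB * r) \<le> \<kappa> * (r2 * om / 1000)" using a5 nn by (intro mult_left_mono) auto
  have 6: "\<kappa> * (r2 * om) \<le> K' * (r2 * om)" using nn by (intro mult_right_mono) auto
  have 7: "0 \<le> K' * (yB * om)" "0 \<le> K' * (r2 * om)" "0 \<le> \<kappa> * (r2 * om)" using nn by auto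
  have "(r2 + yB) * (\<kappa> * r - K' * om / 4) = \<kappa> * (r * r2) + \<kappa> * (yB * r) - K' * (r2 * om) / 4 - K' * (yB * om) / 4"
    by (simp add: algebra_simps)
  also have "\<dots> \<le> \<kappa> * (r * r2) - \<kappa> * (r2 * om) / 8 - 3 * (\<kappa> * (r2 * om)) / 1000"
    using 5 6 7 by (simp add: algebra_simps)
  also have "\<dots> = \<kappa> * (r * r2 - om * r2 / 8 - 3 * (r2 * om / 1000))" by (simp add: algebra_simps)
  finally show ?thesis using 4 by linarith
qed

text \<open>The reserve taken here is 3/16 instead of 1/4; the missing 1/16 is left for the
  curvature of the trajectory in \<open>R_lower_step\<close>.\<close>

lemma lower_drift_arith:
  fixes r2 e2 yA r e om \<kappa> K' Rv :: real
  assumes nn: "0 \<le> r2" "0 \<le> e2" "0 \<le> yA" "0 \<le> om" "0 \<le> \<kappa>" "\<kappa> \<le> K'"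
    and a1: "r * e2 \<le> r2 * e" and a4: "om / 8 \<le> e" and a5: "yA * r \<le> r2 * om / 1000" and a6: "yA \<le> r2 / 1000"
    and Rv: "Rv \<le> r - e + om / 8"
  shows "Rv * (\<kappa> * (r2 + e2)) \<le> (r2 - yA) * (\<kappa> * r + 3 / 16 * (K' * om))"
proof -
  have 1: "Rv * r2 \<le> (r - e + om / 8) * r2" using Rv nn by (intro mult_right_mono) auto
  have "Rv * e2 \<le> r * e2" using Rv a4 nn by (intro mult_right_mono) auto
  then have "Rv * r2 + Rv * e2 \<le> r * r2 + r2 * om / 8" using 1 a1 by (simp add: algebra_simps)
  from mult_left_mono[OF this, of \<kappa>]
  have 2: "Rv * (\<kappa> * (r2 + e2)) \<le> \<kappa> * (r * r2) + \<kappa> * (r2 * om) / 8" using nn by (simp add: algebra_simps)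
  have 5: "\<kappa> * (yA * r) \<le> \<kappa> * (r2 * om / 1000)" using a5 nn by (intro mult_left_mono) auto
  have 6: "\<kappa> * (r2 * om) \<le> K' * (r2 * om)" using nn by (intro mult_right_mono) auto
  have 7: "K' * (yA * om) \<le> K' * (r2 / 1000 * om)" using a6 nn by (intro mult_left_mono mult_right_mono) auto
  have 8: "0 \<le> K' * (r2 * om)" using nn by auto
  have "(r2 - yA) * (\<kappa> * r + 3 / 16 * (K' * om)) = \<kappa> * (r * r2) - \<kappa> * (yA * r) + 3 / 16 * (K' * (r2 * om)) - 3 / 16 * (K' * (yA * om))"
    by (simp add: field_simps)
  also have "\<dots> \<ge> \<kappa> * (r * r2) + \<kappa> * (r2 * om) / 8"
    using 5 6 7 8 by (simp add: algebra_simps)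
  finally show ?thesis using 2 by linarith
qed

context removal_density
begin

section \<open>Changes of trajectory and allowance in one step\<close>

lemma traj_diff:
  fixes m :: nat
  defines "\<delta> \<equiv> traj m p - traj m (p - h)"
  shows "\<delta> \<le> real (kap m) * (h / p) * traj m p" "0 \<le> \<delta>"
    "real (kap m) * (h / p) * traj m p - (real (kap m))\<^sup>2 * h\<^sup>2 * N ^ (k - m) \<le> \<delta>"
proof -
  have hp: "0 \<le> h" "h \<le> p" "p \<le> 1" "0 < p" using h_pos h_le_p p1 p_pos by auto
  define c where "c = N ^ (k - m) / fact (k - m)"
  have c: "0 \<le> c" "c \<le> N ^ (k - m)" unfolding c_def by (auto simp: divide_le_eq intro: self_le_mult)
  have t: "traj m x = c * x ^ kap m" for x by (simp add: traj_def c_def)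
  have "c * (p ^ kap m - real (kap m) * h * p ^ kap m / p) \<le> c * (p - h) ^ kap m"
    using c power_diff_bounds(1)[OF hp] by (intro mult_left_mono) auto
  then show "\<delta> \<le> real (kap m) * (h / p) * traj m p" unfolding \<delta>_def t by (simp add: algebra_simps)
  have "c * (p - h) ^ kap m \<le> c * p ^ kap m" using c hp by (intro mult_left_mono power_mono) auto
  then show "0 \<le> \<delta>" unfolding \<delta>_def t by simp
  have "c * (p - h) ^ kap m \<le> c * (p ^ kap m - real (kap m) * h * p ^ kap m / p + (real (kap m))\<^sup>2 * h\<^sup>2)"
    using c power_diff_bounds(2)[OF hp] by (intro mult_left_mono) auto
  moreover have "c * ((real (kap m))\<^sup>2 * h\<^sup>2) \<le> N ^ (k - m) * ((real (kap m))\<^sup>2 * h\<^sup>2)"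
    using c by (intro mult_right_mono) auto
  ultimately show "real (kap m) * (h / p) * traj m p - (real (kap m))\<^sup>2 * h\<^sup>2 * N ^ (k - m) \<le> \<delta>"
    unfolding \<delta>_def t by (simp add: algebra_simps)
qed

lemma eps_diff:
  shows "real K / 2 * (h / p) * om m \<le> eps m (p - h) - eps m p" "eps m (p - h) - eps m p \<le> real K * (h / p) * om m"
  using mult_right_mono[OF sg_diff(1), of "om m"] mult_right_mono[OF sg_diff(2), of "om m"] om_pos[of m]
  by (simp_all add: eps_def algebra_simps)

lemma eps_pos: "0 < eps m p" "om m \<le> eps m p" "eps m p \<le> L * om m"
  using sg_bounds sg2 om_pos[of m] by (auto simp: eps_def intro: self_le_mult)

lemma L_pow: "1000 \<le> L ^ 3" "1000 * real K \<le> L ^ 3" "1000 * L \<le> L ^ 8" "1000 \<le> L ^ 16" "1000 * (real K)\<^sup>2 \<le> L\<^sup>2" "1000 \<le> L ^ 8"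
proof -
  have 1: "L \<le> L ^ 3" "L \<le> L ^ 16" "L \<le> L ^ 2" using L_bounds by (auto intro!: self_le_power)
  then show "1000 \<le> L ^ 3" "1000 * real K \<le> L ^ 3" "1000 \<le> L ^ 16" "1000 * (real K)\<^sup>2 \<le> L\<^sup>2" using L_bounds by linarith+
  have "L * L \<le> L ^ 8" using L_bounds power_increasing[of 2 8 L] by (simp add: power2_eq_square)
  moreover have "1000 * L \<le> L * L" using L_bounds by (intro mult_right_mono) auto
  ultimately show "1000 * L \<le> L ^ 8" by linarith
  then show "1000 \<le> L ^ 8" using L_bounds by linarith
qed

lemma div1000: "x * c \<le> b \<Longrightarrow> 0 \<le> x \<Longrightarrow> 1000 \<le> c \<Longrightarrow> x \<le> b / 1000" for x c b :: real
  using mult_left_mono[of 1000 c x] by simp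

lemma eps_le: "2 \<le> m \<Longrightarrow> m \<le> k - 1 \<Longrightarrow> eps m p \<le> traj m p / 1000"
  using eps_le_traj[of m] eps_pos[of m] L_pow by (intro div1000[where c = "L ^ 8"]) auto

lemma Aq_q: "Aq p \<le> q p / 1000" and Bq_q: "Bq p \<le> q p / 1000"
  using div1000[OF Aq_le _ L_pow(4)] div1000[OF Bq_le _ L_bounds(4)] Aq_pos Bq_pos by simp_all

lemma y_pos: "0 < h / p" "h \<le> h / p"
  using h_pos p_pos p1 by (auto simp: le_divide_eq mult_left_le)

lemma traj_eps2: "2 \<le> m \<Longrightarrow> m \<le> k - 1 \<Longrightarrow> traj m p * eps 2 p \<le> traj 2 p * eps m p"
  using mult_left_mono[OF traj_om_le, of m "sg p"] sg2 by (simp add: eps_def algebra_simps)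

lemma eps_eps2:
  assumes m: "2 \<le> m" "m \<le> k - 1"
  shows "eps m p * eps 2 p \<le> traj 2 p * om m / 1000"
proof -
  have "eps 2 p * (1000 * L) \<le> eps 2 p * L ^ 8" using eps_pos[of 2] L_pow by (intro mult_left_mono) auto
  also have "\<dots> \<le> traj 2 p" using k by (intro eps_le_traj) auto
  finally have 1: "eps 2 p * L \<le> traj 2 p / 1000" by simp
  have "eps m p * eps 2 p \<le> (L * om m) * eps 2 p" using eps_pos[of m] eps_pos[of 2] by (intro mult_right_mono) auto
  also have "\<dots> = om m * (eps 2 p * L)" by simp
  also have "\<dots> \<le> om m * (traj 2 p / 1000)" using 1 om_pos[of m] by (intro mult_left_mono) auto
  finally show ?thesis by (simp add: mult.commute)
qed

lemma traj_yB:
  assumes m: "2 \<le> m" "m \<le> k - 1"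
  shows "(h / p * Bq p) * traj m p \<le> traj 2 p * om m / 1000"
proof -
  have "traj m p * Bq p \<le> q p * om m / 1000"
    using traj_Bq_le[OF m] traj_pos[of m] Bq_pos L_bounds(4) by (intro div1000) auto
  from mult_left_mono[OF this, of "h / p"] show ?thesis unfolding traj2_q using y_pos by (simp add: mult_ac)
qed

lemma traj_yA:
  assumes m: "2 \<le> m" "m \<le> k - 1"
  shows "(h / p * Aq p) * traj m p \<le> traj 2 p * om m / 1000"
proof -
  have "traj m p * Aq p \<le> q p * om m / 1000"
    using traj_Aq_le[OF m] traj_pos[of m] Aq_pos L_pow(1) by (intro div1000) auto
  from mult_left_mono[OF this, of "h / p"] show ?thesis unfolding traj2_q using y_pos by (simp add: mult_ac)
qed

lemma traj_n3:
  assumes m: "2 \<le> m" "m \<le> k - 1"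
  shows "real (kap m) * (traj m p * N ^ (k - 3)) \<le> traj 2 p * om m / 1000"
proof -
  have t: "0 \<le> traj m p * N ^ (k - 3)" using traj_pos[of m] by simp
  have "real (kap m) * 1000 \<le> L ^ 3" using kap_facts(5)[OF m] L_pow(2) by linarith
  from mult_left_mono[OF this t] have "traj m p * N ^ (k - 3) * (real (kap m) * 1000) \<le> traj 2 p * om m"
    using traj_N3_le[OF m] by linarith
  then show ?thesis by (simp add: mult_ac)
qed

section \<open>Step size and second moment for the extension counts\<close>

lemma thR_om: "2 \<le> m \<Longrightarrow> m \<le> k - 1 \<Longrightarrow> L\<^sup>2 \<le> thR m * om m"
  using om_ge[of m] Lg by (simp add: thR_def field_simps)

text \<open>With \<open>N = G\<^sup>2\<close>, the left side is of order \<open>X / G ^ 5\<close>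
  and the right side at least of order \<open>X * L\<^sup>2 / G ^ 5\<close>: the powers of n agree
  in the extreme case, and the two logarithms in \<open>om\<close> outweigh the constants.\<close>

lemma thR_vR:
  assumes m: "2 \<le> m" "m \<le> k - 1"
  shows "thR m * vR m \<le> dR m"
proof -
  define X where "X = N ^ (k - m)"
  define G where "G = g ^ (K - 1)"
  have pos: "0 < X" "0 < G" "N = G * G" unfolding X_def G_def using Lg N_gg(1) by auto
  have "128 * (real K)\<^sup>2 \<le> L\<^sup>2" using L_pow(5) zero_le_power2[of "real K"] by linarith
  then have "128 * (real K)\<^sup>2 * X \<le> L\<^sup>2 * X" using pos by (intro mult_right_mono) auto
  also have "\<dots> \<le> om m * G" using om_ge[OF m(2,1)] by (simp add: X_def G_def mult.commute)
  finally have "128 * (real K)\<^sup>2 * X * ((real K)\<^sup>2 * G) \<le> om m * G * ((real K)\<^sup>2 * G)"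
    using pos by (intro mult_right_mono) auto
  then have 1: "64 * real K ^ 4 * G * X \<le> (real K)\<^sup>2 * om m * N / 2"
    unfolding pos(3) by (simp add: algebra_simps power2_eq_square power4_eq_xxxx)
  have "thR m * vR m = 64 * real K ^ 4 * G * X / N ^ 3"
    using pos(1) unfolding thR_def vR_def X_def G_def by (simp add: power2_eq_square)
  also have "\<dots> \<le> (real K)\<^sup>2 * om m * N / 2 / N ^ 3" using 1 Lg by (intro divide_right_mono) auto
  also have "\<dots> = dR m" using Lg by (simp add: dR_def h_def power2_eq_square power3_eq_cube field_simps)
  finally show ?thesis .
qed

lemma traj_eps_diff_le:
  assumes m: "2 \<le> m" "m \<le> k - 1"
  shows "real (kap m) * (h / p) * traj m p + real K * (h / p) * om m \<le> cR m"
proof -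
  have "real (kap m) * (h / p) * traj m p \<le> real K * (h / p) * (N ^ (k - m) * p)"
    using kap_facts(5)[OF m] h_pos p_pos traj_le_p[OF m] traj_pos[of m] by (intro mult_mono) auto
  moreover have "real K * (h / p) * om m \<le> real K * (h / p) * (N ^ (k - m) * p)"
    using h_pos p_pos om_le_p[OF m] by (intro mult_left_mono) auto
  moreover have "real K * (h / p) * (N ^ (k - m) * p) = real K * h * N ^ (k - m)" using p_pos by simp
  moreover have "cR m = 2 * (real K * h * N ^ (k - m))" by (simp add: cR_def h_def power2_eq_square)
  ultimately show ?thesis by linarith
qed

text \<open>\<open>D\<close> stands for the change of either one-sided deviation. Its second moment
  is bounded by maximal loss times mean loss, which gains a factor of order \<open>N\<close> over
  the square of the maximal loss.\<close>

lemma R_step_bounds: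
  fixes l D :: "'a \<Rightarrow> real"
  assumes m: "2 \<le> m" "m \<le> k - 1" and A: "finite A"
    and l: "\<And>C. C \<in> A \<Longrightarrow> 0 \<le> l C \<and> l C \<le> real k * N ^ (k - m) / N"
    and hi: "(\<Sum>C\<in>A. l C) \<le> Rv * (real (kap m) * (traj 2 p + eps 2 p))"
    and card: "q p - Aq p \<le> real (card A)"
    and Rv: "0 \<le> Rv" "Rv \<le> traj m p + eps m p"
    and D: "\<And>C. C \<in> A \<Longrightarrow> \<bar>D C\<bar> \<le> l C + cR m"
  shows "C \<in> A \<Longrightarrow> thR m * \<bar>D C\<bar> \<le> 1" "(\<Sum>C\<in>A. (D C)\<^sup>2) \<le> vR m * real (card A)"
proof -
  define X where "X = N ^ (k - m)"
  define G where "G = g ^ (K - 1)"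
  have pos: "0 < X" "0 < G" "N = G * G" "1 \<le> G" "L \<le> G" unfolding X_def G_def using Lg N_gg by auto
  have c0: "0 \<le> cR m" by (simp add: cR_def)
  show "thR m * \<bar>D C\<bar> \<le> 1" if C: "C \<in> A"
  proof -
    have "thR m * \<bar>D C\<bar> \<le> thR m * (real k * X / N + cR m)"
      using D[OF C] l[OF C] thR_pos[of m] by (intro mult_left_mono) (auto simp: X_def)
    also have "\<dots> = real k * ((thR m * X) / N) + 4 * (real K)\<^sup>2 * ((thR m * X) / N) / N"
      by (simp add: cR_def algebra_simps power2_eq_square flip: X_def)
    also have "thR m * X = G" using Lg(6) unfolding thR_def X_def G_def by simp
    also have "G / N = 1 / G" using pos by simp
    also have "4 * (real K)\<^sup>2 * (1 / G) / N \<le> 4 * (real K)\<^sup>2 * (1 / G)"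
      using Lg pos by (simp add: divide_le_eq self_le_mult)
    also have "real k * (1 / G) + 4 * (real K)\<^sup>2 * (1 / G) = (real k + 4 * (real K)\<^sup>2) / G" by (simp add: add_divide_distrib)
    also have "\<dots> \<le> 1"
    proof -
      have "real k \<le> real K" using k_le_K by simp
      moreover have "real K \<le> (real K)\<^sup>2" using K6' by (intro self_le_power) auto
      ultimately have "real k + 4 * (real K)\<^sup>2 \<le> 1000 * (real K)\<^sup>2" by linarith
      then have "real k + 4 * (real K)\<^sup>2 \<le> G" using L_bounds(3) pos by linarith
      then show ?thesis using pos by simp
    qed
    finally show ?thesis by simp
  qed
  have "(D C)\<^sup>2 \<le> 2 * (real k * X / N) * l C + 2 * (cR m)\<^sup>2" if C: "C \<in> A" for C
  proof -
    have "(D C)\<^sup>2 \<le> (l C + cR m)\<^sup>2" using D[OF C] by (metis abs_ge_zero power2_abs power_mono)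
    also have "\<dots> \<le> 2 * (l C * l C) + 2 * (cR m)\<^sup>2"
      using sum_squares_bound[of "l C" "cR m"] by (simp add: power2_eq_square algebra_simps)
    also have "l C * l C \<le> (real k * X / N) * l C" using l[OF C] by (intro mult_right_mono) (auto simp: X_def)
    finally show ?thesis by simp
  qed
  then have "(\<Sum>C\<in>A. (D C)\<^sup>2) \<le> (\<Sum>C\<in>A. 2 * (real k * X / N) * l C + 2 * (cR m)\<^sup>2)" by (rule sum_mono)
  also have "\<dots> = 2 * (real k * X / N) * (\<Sum>C\<in>A. l C) + 2 * (cR m)\<^sup>2 * real (card A)"
    by (simp add: sum.distrib sum_distrib_left)
  also have "\<dots> \<le> 2 * (real k * X / N) * (16 * (real K)\<^sup>2 * X / N\<^sup>2 * real (card A)) + 2 * (cR m)\<^sup>2 * real (card A)"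
  proof (intro add_right_mono mult_left_mono)
    have e2: "eps 2 p \<le> traj 2 p" "eps m p \<le> traj m p"
      using eps_le[of 2] eps_le[of m] m k traj_pos[of 2] traj_pos[of m] by auto
    \<comment> \<open>Counts, degrees and number of copies are each within a factor 2 of their
      trajectories; with \<open>h = 2 * K / N\<^sup>2\<close> this produces the constant 16.\<close>
    have "Rv * (real (kap m) * (traj 2 p + eps 2 p)) \<le> (2 * traj m p) * (real K * (2 * traj 2 p))"
      using Rv e2 kap_facts(5)[OF m] traj_pos[of 2] traj_pos[of m] eps_pos(1)[of 2] by (intro mult_mono) auto
    also have "\<dots> = 4 * real K * (h / p * traj m p) * q p" unfolding traj2_q by simp
    also have "\<dots> \<le> 4 * real K * (h * X) * (2 * real (card A))"
    proof (rule mult_mono)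
      have "h / p * traj m p \<le> h / p * (X * p)" using traj_le_p[OF m] y_pos by (intro mult_left_mono) (auto simp: X_def)
      then have "h / p * traj m p \<le> h * X" using p_pos by (simp add: mult_ac)
      then show "4 * real K * (h / p * traj m p) \<le> 4 * real K * (h * X)" by (intro mult_left_mono) auto
      show "q p \<le> 2 * real (card A)" using card Aq_q q_pos by linarith
    qed (use q_pos h_pos pos in auto)
    also have "\<dots> = 16 * (real K)\<^sup>2 * X / N\<^sup>2 * real (card A)" by (simp add: h_def power2_eq_square)
    finally show "(\<Sum>C\<in>A. l C) \<le> 16 * (real K)\<^sup>2 * X / N\<^sup>2 * real (card A)" using hi by linarith
  qed (use pos Lg in auto)
  also have "2 * (real k * X / N) * (16 * (real K)\<^sup>2 * X / N\<^sup>2 * real (card A)) + 2 * (cR m)\<^sup>2 * real (card A)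
     = (32 * (real k * (real K)\<^sup>2) * X\<^sup>2 / N ^ 3 + 32 * real K ^ 4 * X\<^sup>2 / N ^ 4) * real (card A)"
    by (simp add: cR_def X_def[symmetric] algebra_simps power2_eq_square power3_eq_cube power4_eq_xxxx)
  also have "\<dots> \<le> vR m * real (card A)"
  proof (rule mult_right_mono)
    have "real k \<le> real K" using k_le_K by simp
    moreover have "real K \<le> (real K)\<^sup>2" using K6' by (intro self_le_power) auto
    ultimately have "real k * (real K)\<^sup>2 \<le> (real K)\<^sup>2 * (real K)\<^sup>2" by (intro mult_right_mono) auto
    also have "\<dots> = real K ^ 4" by (simp flip: power_add)
    finally have "32 * (real k * (real K)\<^sup>2) * X\<^sup>2 / N ^ 3 \<le> 32 * real K ^ 4 * X\<^sup>2 / N ^ 3"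
      using Lg by (intro divide_right_mono mult_right_mono) auto
    moreover have "32 * real K ^ 4 * X\<^sup>2 / N ^ 4 \<le> 32 * real K ^ 4 * X\<^sup>2 / N ^ 3"
      using Lg by (intro divide_left_mono power_increasing) auto
    moreover have "vR m = 2 * (32 * real K ^ 4 * X\<^sup>2 / N ^ 3)" by (simp add: vR_def X_def)
    ultimately show "32 * (real k * (real K)\<^sup>2) * X\<^sup>2 / N ^ 3 + 32 * real K ^ 4 * X\<^sup>2 / N ^ 4 \<le> vR m"
      by linarith
  qed simp
  finally show "(\<Sum>C\<in>A. (D C)\<^sup>2) \<le> vR m * real (card A)" .
qed

text \<open>Of the growth \<open>K / 2 * (h / p) * om m\<close> of the allowance one half is spent
  in \<open>upper_drift_arith\<close>; the other half is at least \<open>dR m\<close>.\<close>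

lemma R_upper_step:
  fixes l :: "'a \<Rightarrow> real"
  assumes m: "2 \<le> m" "m \<le> k - 1" and A: "finite A"
    and l: "\<And>C. C \<in> A \<Longrightarrow> 0 \<le> l C \<and> l C \<le> real k * N ^ (k - m) / N"
    and lo: "Rv * (real (kap m) * (traj 2 p - eps 2 p) - (real (kap m))\<^sup>2 * N ^ (k - 3)) \<le> (\<Sum>C\<in>A. l C)"
    and hi: "(\<Sum>C\<in>A. l C) \<le> Rv * (real (kap m) * (traj 2 p + eps 2 p))"
    and card: "q p - Aq p \<le> real (card A)" "real (card A) \<le> q p + Bq p"
    and Rv: "0 \<le> Rv" "Rv \<le> traj m p + eps m p"
  shows "(\<Sum>C\<in>A. exp (thR m * (Rv - l C - traj m (p - h) - eps m (p - h))))
     \<le> real (card A) * (exp (thR m * (Rv - traj m p - eps m p)) + exp (1 - thR m * (om m / 8)))"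
proof (rule exp_supermartingale_step[OF A thR_pos])
  let ?y = "h / p" and ?D = "\<lambda>C. Rv - l C - traj m (p - h) - eps m (p - h) - (Rv - traj m p - eps m p)"
  have D: "\<bar>?D C\<bar> \<le> l C + cR m" if "C \<in> A" for C
    using l[OF that] traj_diff[of m] eps_diff[of m] traj_eps_diff_le[OF m] y_pos om_pos[of m]
      mult_pos_pos[OF mult_pos_pos[OF _ y_pos(1)] om_pos[of m], of "real K / 2"] K6'
    by (simp add: abs_le_iff)
  note sb = R_step_bounds[where D = ?D, OF m A l hi card(1) Rv D]
  show "thR m * \<bar>?D C\<bar> \<le> 1" if "C \<in> A" for C by (rule sb(1)) (use that in auto)
  show "(\<Sum>C\<in>A. (?D C)\<^sup>2) \<le> vR m * real (card A)" by (rule sb(2)) auto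
  show "thR m * vR m \<le> dR m" by (rule thR_vR[OF m])
  assume "- (om m / 8) \<le> Rv - traj m p - eps m p"
  then have Rl: "traj m p + eps m p - om m / 8 \<le> Rv" by linarith
  have nn: "0 \<le> traj 2 p" "0 \<le> eps 2 p" "0 \<le> N ^ (k - 3)" "0 \<le> ?y * Bq p" "0 \<le> om m"
    "0 \<le> real (kap m)" "real (kap m) \<le> real K" "0 \<le> traj m p" "0 \<le> ?y"
    using traj_pos[of 2] traj_pos[of m] eps_pos(1)[of 2] Bq_pos h_pos p_pos om_pos[of m] by auto
  have e: "eps m p \<le> traj m p" using eps_le[OF m] nn by linarith
  \<comment> \<open>The sign is required to replace \<open>card A\<close> by its upper bound in
    front of this factor.\<close>
  have T: "0 \<le> real (kap m) * traj m p - real K * om m / 4"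
  proof -
    have "om m * (1000 * L) \<le> eps m p * L ^ 8" using eps_pos[of m] L_pow Lg nn by (intro mult_mono) auto
    also have "\<dots> \<le> traj m p" by (rule eps_le_traj[OF m])
    finally have "om m * (1000 * L) \<le> traj m p" .
    moreover have "om m * real K \<le> om m * (1000 * L)" using nn L_bounds by (intro mult_left_mono) auto
    moreover have "1 * traj m p \<le> real (kap m) * traj m p" using kap_facts[OF m] nn by (intro mult_right_mono) auto
    moreover have "0 \<le> om m * real K" using nn by auto
    ultimately show ?thesis by (simp add: mult.commute)
  qed
  have "real (card A) * (?y * (real (kap m) * traj m p - real K * om m / 4))
     \<le> (q p + Bq p) * (?y * (real (kap m) * traj m p - real K * om m / 4))"
    by (intro mult_right_mono mult_nonneg_nonneg card T nn)
  also have "\<dots> = (traj 2 p + ?y * Bq p) * (real (kap m) * traj m p - real K * om m / 4)"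
    unfolding traj2_q by (simp add: algebra_simps add_divide_distrib diff_divide_distrib)
  also have "\<dots> \<le> Rv * (real (kap m) * (traj 2 p - eps 2 p) - (real (kap m))\<^sup>2 * N ^ (k - 3))"
    by (rule upper_drift_arith[where e = "eps m p" and om = "om m"])
      (use nn traj_eps2[OF m] eps_eps2[OF m] traj_n3[OF m] e traj_yB[OF m] Rl Rv in auto)
  also have "\<dots> \<le> (\<Sum>C\<in>A. l C)" by (rule lo)
  finally have 1: "real (card A) * (?y * (real (kap m) * traj m p - real K * om m / 4)) \<le> (\<Sum>C\<in>A. l C)" .
  have "(\<Sum>C\<in>A. ?D C) = real (card A) * ((traj m p - traj m (p - h)) - (eps m (p - h) - eps m p)) - (\<Sum>C\<in>A. l C)"
    by (simp add: sum_subtractf sum.distrib algebra_simps)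
  also have "\<dots> \<le> real (card A) * (real (kap m) * ?y * traj m p - real K / 2 * ?y * om m) - (\<Sum>C\<in>A. l C)"
    using traj_diff(1)[of m] eps_diff(1)[of m] by (intro diff_right_mono mult_left_mono) auto
  also have "\<dots> \<le> - (?y * real K * om m / 4) * real (card A)"
    using 1 by (simp add: algebra_simps)
  also have "\<dots> \<le> - dR m * real (card A)"
  proof -
    have "h * (real K * om m / 4) \<le> ?y * (real K * om m / 4)" using y_pos nn by (intro mult_right_mono) auto
    then have "dR m \<le> ?y * real K * om m / 4" by (simp add: dR_def)
    from mult_right_mono[OF this, of "real (card A)"] show ?thesis by simp
  qed
  finally show "(\<Sum>C\<in>A. ?D C) \<le> - dR m * real (card A)" .
qed

text \<open>The union bound on the loss suffices in this direction. The allowance grows by 1/2 in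
  units of \<open>(h / p) * K * om m\<close>, of which 3/16 goes to \<open>lower_drift_arith\<close>
  and 1/16 to curvature, leaving 1/4.\<close>

lemma R_lower_step:
  fixes l :: "'a \<Rightarrow> real"
  assumes m: "2 \<le> m" "m \<le> k - 1" and A: "finite A"
    and l: "\<And>C. C \<in> A \<Longrightarrow> 0 \<le> l C \<and> l C \<le> real k * N ^ (k - m) / N"
    and hi: "(\<Sum>C\<in>A. l C) \<le> Rv * (real (kap m) * (traj 2 p + eps 2 p))"
    and card: "q p - Aq p \<le> real (card A)"
    and Rv: "0 \<le> Rv" "Rv \<le> traj m p + eps m p"
  shows "(\<Sum>C\<in>A. exp (thR m * (traj m (p - h) - eps m (p - h) - (Rv - l C))))
     \<le> real (card A) * (exp (thR m * (traj m p - eps m p - Rv)) + exp (1 - thR m * (om m / 8)))"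
proof (rule exp_supermartingale_step[OF A thR_pos])
  let ?y = "h / p" and ?D = "\<lambda>C. traj m (p - h) - eps m (p - h) - (Rv - l C) - (traj m p - eps m p - Rv)"
  have D: "\<bar>?D C\<bar> \<le> l C + cR m" if "C \<in> A" for C
    using l[OF that] traj_diff[of m] eps_diff[of m] traj_eps_diff_le[OF m] y_pos om_pos[of m]
      mult_pos_pos[OF mult_pos_pos[OF _ y_pos(1)] om_pos[of m], of "real K / 2"] K6'
    by (simp add: abs_le_iff)
  note sb = R_step_bounds[where D = ?D, OF m A l hi card Rv D]
  show "thR m * \<bar>?D C\<bar> \<le> 1" if "C \<in> A" for C by (rule sb(1)) (use that in auto)
  show "(\<Sum>C\<in>A. (?D C)\<^sup>2) \<le> vR m * real (card A)" by (rule sb(2)) auto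
  show "thR m * vR m \<le> dR m" by (rule thR_vR[OF m])
  assume "- (om m / 8) \<le> traj m p - eps m p - Rv"
  then have Rl: "Rv \<le> traj m p - eps m p + om m / 8" by linarith
  have nn: "0 \<le> traj 2 p" "0 \<le> eps 2 p" "0 \<le> ?y * Aq p" "0 \<le> om m"
    "0 \<le> real (kap m)" "real (kap m) \<le> real K" "0 \<le> traj m p" "0 \<le> ?y"
    using traj_pos[of 2] traj_pos[of m] eps_pos(1)[of 2] Aq_pos h_pos p_pos om_pos[of m] by auto
  have A2: "?y * Aq p \<le> traj 2 p / 1000" unfolding traj2_q
    using mult_left_mono[OF Aq_q nn(8)] by simp
  \<comment> \<open>The trajectory is convex in the density, so it falls by less than its tangent
    predicts, which works against the lower bound.\<close>
  have second: "(real (kap m))\<^sup>2 * h\<^sup>2 * N ^ (k - m) \<le> ?y * real K * om m / 16"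
  proof -
    define X where "X = N ^ (k - m)"
    have X: "0 < X" using Lg by (simp add: X_def)
    have "32 * (real K)\<^sup>2 \<le> L\<^sup>2" using L_pow(5) zero_le_power2[of "real K"] by linarith
    then have "32 * (real K)\<^sup>2 * X \<le> L\<^sup>2 * X" using X by (intro mult_right_mono) auto
    also have "\<dots> \<le> om m * g ^ (K - 1)" using om_ge[OF m(2,1)] by (simp add: X_def mult.commute)
    also have "\<dots> \<le> om m * N" using N_gg(2) nn by (intro mult_left_mono) auto
    also have "\<dots> \<le> om m * N\<^sup>2" using Lg nn by (intro mult_left_mono) (auto intro: self_le_power)
    finally have "(32 * (real K)\<^sup>2 * X) / N\<^sup>2 \<le> om m" using Lg by (simp add: divide_le_eq)
    then have 2: "h * real K * X \<le> om m / 16" by (simp add: h_def power2_eq_square)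
    have "(real (kap m))\<^sup>2 * h\<^sup>2 * X \<le> (real K)\<^sup>2 * h\<^sup>2 * X" using nn X by (intro mult_right_mono power_mono) auto
    also have "\<dots> = real K * h * (h * real K * X)" by (simp add: power2_eq_square)
    also have "\<dots> \<le> real K * h * (om m / 16)" using 2 h_pos by (intro mult_left_mono) auto
    also have "\<dots> \<le> real K * ?y * (om m / 16)" using y_pos nn by (intro mult_right_mono mult_left_mono) auto
    finally show ?thesis by (simp add: X_def mult_ac)
  qed
  have "(\<Sum>C\<in>A. l C) \<le> Rv * (real (kap m) * (traj 2 p + eps 2 p))" by (rule hi)
  also have "\<dots> \<le> (traj 2 p - ?y * Aq p) * (real (kap m) * traj m p + 3 / 16 * (real K * om m))"
    by (rule lower_drift_arith[OF nn(1-6) traj_eps2[OF m] _ traj_yA[OF m] A2 Rl])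
      (use eps_pos(2)[of m] nn(4) in linarith)
  also have "\<dots> = (q p - Aq p) * (?y * (real (kap m) * traj m p + 3 / 16 * (real K * om m)))"
    unfolding traj2_q by (simp add: algebra_simps add_divide_distrib diff_divide_distrib)
  also have "\<dots> \<le> real (card A) * (?y * (real (kap m) * traj m p + 3 / 16 * (real K * om m)))"
    using mult_nonneg_nonneg[of "real K" "om m"] by (intro mult_right_mono mult_nonneg_nonneg add_nonneg_nonneg card nn) auto
  finally have 1: "(\<Sum>C\<in>A. l C) \<le> real (card A) * (?y * (real (kap m) * traj m p + 3 / 16 * (real K * om m)))" .
  have "(\<Sum>C\<in>A. ?D C) = (\<Sum>C\<in>A. l C) - real (card A) * ((traj m p - traj m (p - h)) + (eps m (p - h) - eps m p))"
    by (simp add: sum_subtractf sum.distrib algebra_simps)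
  also have "\<dots> \<le> (\<Sum>C\<in>A. l C) - real (card A) * (real (kap m) * ?y * traj m p - ?y * real K * om m / 16 + real K / 2 * ?y * om m)"
  proof (intro diff_left_mono mult_left_mono)
    show "real (kap m) * ?y * traj m p - ?y * real K * om m / 16 + real K / 2 * ?y * om m
      \<le> (traj m p - traj m (p - h)) + (eps m (p - h) - eps m p)"
      using traj_diff(3)[of m] eps_diff(1)[of m] second by linarith
  qed simp
  also have "\<dots> \<le> - (?y * real K * om m / 4) * real (card A)"
    using 1 by (simp add: algebra_simps)
  also have "\<dots> \<le> - dR m * real (card A)"
  proof -
    have "h * (real K * om m / 4) \<le> ?y * (real K * om m / 4)" using y_pos nn by (intro mult_right_mono) auto
    then have "dR m \<le> ?y * real K * om m / 4" by (simp add: dR_def)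
    from mult_right_mono[OF this, of "real (card A)"] show ?thesis by simp
  qed
  finally show "(\<Sum>C\<in>A. ?D C) \<le> - dR m * real (card A)" .
qed

end

section \<open>Drift of the number of copies\<close>

text \<open>Both parts come from the identity \<open>ex\<close> for deviations about a centre
  \<open>a\<close>: the mean \<open>T / M\<close> gives Cauchy--Schwarz, and \<open>a = r\<close>
  gives the upper bound because the mean square deviation is least about the mean.\<close>

lemma sum_squares_deviation:
  fixes d :: "'a \<Rightarrow> real"
  assumes "finite E" "E \<noteq> {}" and T: "(\<Sum>e\<in>E. d e) = T"
    and dev: "\<And>e. e \<in> E \<Longrightarrow> \<bar>d e - r\<bar> \<le> \<epsilon>"
  shows "T\<^sup>2 / real (card E) \<le> (\<Sum>e\<in>E. (d e)\<^sup>2)"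
    and "(\<Sum>e\<in>E. (d e)\<^sup>2) \<le> T\<^sup>2 / real (card E) + real (card E) * \<epsilon>\<^sup>2"
proof -
  define M where "M = real (card E)"
  have M: "0 < M" using assms by (simp add: M_def card_gt_0_iff)
  have ex: "(\<Sum>e\<in>E. (d e - a)\<^sup>2) = (\<Sum>e\<in>E. (d e)\<^sup>2) - T\<^sup>2 / M + M * (a - T / M)\<^sup>2" for a
  proof -
    have "(\<Sum>e\<in>E. (d e - a)\<^sup>2) = (\<Sum>e\<in>E. (d e)\<^sup>2 - 2 * a * d e + a\<^sup>2)"
      by (intro sum.cong refl) (simp add: power2_eq_square algebra_simps)
    also have "\<dots> = (\<Sum>e\<in>E. (d e)\<^sup>2) - 2 * a * T + M * a\<^sup>2"
      by (simp add: sum.distrib sum_subtractf sum_distrib_left[symmetric] T M_def)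
    also have "\<dots> = (\<Sum>e\<in>E. (d e)\<^sup>2) - T\<^sup>2 / M + M * (a - T / M)\<^sup>2"
      using M by (simp add: field_simps power2_eq_square)
    finally show ?thesis .
  qed
  have "0 \<le> (\<Sum>e\<in>E. (d e - T / M)\<^sup>2)" by (rule sum_nonneg) simp
  then show "T\<^sup>2 / real (card E) \<le> (\<Sum>e\<in>E. (d e)\<^sup>2)" unfolding ex M_def[symmetric] by simp
  have "(\<Sum>e\<in>E. (d e - r)\<^sup>2) \<le> M * \<epsilon>\<^sup>2"
    unfolding M_def using dev by (intro sum_bounded_above) (auto intro: power2_le_iff_abs_le[THEN iffD2] simp: abs_le_square_iff[symmetric] order_trans[OF _ abs_ge_self])
  moreover have "0 \<le> M * (r - T / M)\<^sup>2" using M by simp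
  ultimately show "(\<Sum>e\<in>E. (d e)\<^sup>2) \<le> T\<^sup>2 / real (card E) + real (card E) * \<epsilon>\<^sup>2"
    unfolding ex M_def[symmetric] by linarith
qed

context removal_density
begin

section \<open>The errors of the number of copies as powers of G\<close>

lemma G_facts: "0 < G" "1 \<le> G" "L \<le> G" "N = G\<^sup>2" "g ^ 5 \<le> G" "g\<^sup>2 \<le> G" "L ^ 8 \<le> G" "L ^ 8 \<le> g ^ 4" "G = g ^ 4 * g ^ (K - 5)"
proof -
  show "0 < G" "1 \<le> G" "L \<le> G" unfolding G_def using Lg N_gg by auto
  show "N = G\<^sup>2" unfolding G_def using N_gg(1) by (simp add: power2_eq_square)
  show "g ^ 5 \<le> G" "g\<^sup>2 \<le> G" unfolding G_def using K6 by (intro N_gg; simp)+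
  have "g \<le> g ^ 4" using Lg by (intro self_le_power) auto
  then show "L ^ 8 \<le> g ^ 4" using g_large by linarith
  have "g \<le> G" unfolding G_def using Lg K6 by (intro self_le_power) auto
  then show "L ^ 8 \<le> G" using g_large by linarith
  show "G = g ^ 4 * g ^ (K - 5)" unfolding G_def using K6 by (simp flip: power_add)
qed

lemma X_facts: "0 < X" "N ^ k = X * G ^ 4" "N ^ (k - 1) = X * G\<^sup>2" "N ^ (k - 3) = X / G\<^sup>2" "N ^ (k - 4) = X / G ^ 4"
  "om 2 = X * L\<^sup>2 / G" "h = 2 * real K / G ^ 4"
proof -
  show "0 < X" using Lg by (simp add: X_def)
  have "k = (k - 2) + 2" "k - 1 = (k - 2) + 1" "k - 2 = (k - 3) + 1" "k - 2 = (k - 4) + 2" using k by auto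
  then have 1: "N ^ k = X * N ^ 2" "N ^ (k - 1) = X * N" "X = N ^ (k - 3) * N" "X = N ^ (k - 4) * N ^ 2"
    unfolding X_def by (metis power_add power_one_right)+
  have N2: "N ^ 2 = G ^ 4" using G_facts(4) by simp
  show "N ^ k = X * G ^ 4" "N ^ (k - 1) = X * G\<^sup>2" using 1(1,2) N2 G_facts(4) by metis+
  have "N ^ (k - 3) * N / N = N ^ (k - 3)" "N ^ (k - 4) * N ^ 2 / N ^ 2 = N ^ (k - 4)" using Lg(6) by simp_all
  then show "N ^ (k - 3) = X / G\<^sup>2" "N ^ (k - 4) = X / G ^ 4" using 1(3,4) N2 G_facts(4) by metis+
  show "om 2 = X * L\<^sup>2 / G" unfolding om_def X_def G_def kap_small ..
  show "h = 2 * real K / G ^ 4" unfolding h_def N2 ..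
qed

lemma p_pow: "1 \<le> p ^ j * g ^ j"
  using P_facts(2) one_le_power[of "p * g" j] by (simp add: power_mult_distrib)

text \<open>For \<open>Q\<close> the square of the maximal step serves as second moment;
  \<open>dQ\<close> is exactly the drift that this choice demands.\<close>

lemma thQ_facts: "thQ * NQ \<le> 1" "thQ * NQ\<^sup>2 = dQ" "0 < NQ"
proof -
  show "0 < NQ" using X_facts(1) G_facts(1) Lg by (auto simp: NQ_def)
  have "thQ * NQ = L ^ 4 / G\<^sup>2" using X_facts(1) G_facts(1) by (simp add: thQ_def NQ_def power2_eq_square)
  also have "L ^ 4 \<le> G\<^sup>2"
  proof -
    have "L ^ 4 \<le> L ^ 8" using L_bounds by (intro power_increasing) auto
    moreover have "G \<le> G\<^sup>2" using G_facts by (intro self_le_power) auto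
    ultimately show ?thesis using G_facts(7) by linarith
  qed
  then have "L ^ 4 / G\<^sup>2 \<le> 1" using G_facts(1) by simp
  finally show "thQ * NQ \<le> 1" .
  have "NQ\<^sup>2 = X\<^sup>2 * L ^ 8 / G\<^sup>2" by (simp add: NQ_def power_divide power_mult_distrib)
  then show "thQ * NQ\<^sup>2 = dQ" using X_facts(1) G_facts(1)
    by (simp add: thQ_def dQ_def power2_eq_square power3_eq_cube)
qed

lemma yBq: "h / p * Bq p = real K * (X / G\<^sup>2) * p ^ (K - 5)"
proof -
  have "K - 4 = Suc (K - 5)" using K6 by simp
  then have "p ^ (K - 4) = p * p ^ (K - 5)" by (simp only: power_Suc)
  then show ?thesis unfolding Bq_def X_facts using p_pos G_facts(1) by (simp add: field_simps power2_eq_square power4_eq_xxxx)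
qed

lemma yAq: "h / p * Aq p = 2 * real K * (sg p)\<^sup>2 * X * L ^ 4 / (G * (p * g)\<^sup>2)"
proof -
  have "g ^ (K + 1) = G * g\<^sup>2" unfolding G_def using K6 by (simp flip: power_add)
  then show ?thesis unfolding Aq_def X_facts using p_pos G_facts(1) Lg
    by (simp add: field_simps power2_eq_square power4_eq_xxxx)
qed

lemma dQ_le_yBq: "dQ \<le> h / p * Bq p"
proof -
  have "L ^ 8 \<le> g ^ 4 * (p ^ (K - 5) * g ^ (K - 5))"
    using G_facts(8) p_pow[of "K - 5"] self_le_mult(1)[of "p ^ (K - 5) * g ^ (K - 5)" "g ^ 4"] by simp
  also have "\<dots> = p ^ (K - 5) * G" unfolding G_facts(9) by simp
  also have "\<dots> \<le> real K * (p ^ (K - 5) * G)" using K6' p_pos G_facts(1) by (intro self_le_mult) auto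
  finally have "X / G ^ 3 * L ^ 8 \<le> X / G ^ 3 * (real K * (p ^ (K - 5) * G))"
    using X_facts(1) G_facts(1) by (intro mult_left_mono) auto
  then show ?thesis unfolding yBq dQ_def using G_facts(1) by (simp add: power2_eq_square power3_eq_cube mult_ac)
qed

lemma yAq_ge: "X * L ^ 4 / (G * g\<^sup>2) \<le> h / p * Aq p"
proof -
  have "X * L ^ 4 / (G * g\<^sup>2) \<le> X * L ^ 4 / (G * (p * g)\<^sup>2)"
    using P_facts X_facts(1) G_facts(1) Lg p_pos by (intro divide_left_mono mult_left_mono power_mono) auto
  also have "\<dots> \<le> (2 * real K * (sg p)\<^sup>2) * (X * L ^ 4 / (G * (p * g)\<^sup>2))"
    using K6' sg2 X_facts(1) G_facts(1) mult_mono[of 1 "2 * real K" 1 "(sg p)\<^sup>2"] by (intro self_le_mult) auto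
  finally show ?thesis unfolding yAq by simp
qed

lemma dQ_le_yAq: "dQ \<le> real K * (h / p * Aq p) / 4"
proof -
  have "L ^ 8 * g\<^sup>2 \<le> G * G" using G_facts Lg by (intro mult_mono) auto
  also have "\<dots> \<le> G\<^sup>2 * L ^ 4" using L_bounds(5) G_facts(1) by (simp add: power2_eq_square self_le_mult)
  finally have "L ^ 8 * g\<^sup>2 * (X / (G ^ 3 * g\<^sup>2)) \<le> G\<^sup>2 * L ^ 4 * (X / (G ^ 3 * g\<^sup>2))"
    using X_facts(1) G_facts(1) Lg by (intro mult_right_mono) auto
  then have "dQ \<le> X * L ^ 4 / (G * g\<^sup>2)"
    unfolding dQ_def using G_facts(1) Lg by (simp add: field_simps power2_eq_square power3_eq_cube)
  also have "\<dots> \<le> h / p * Aq p" by (rule yAq_ge)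
  also have "\<dots> \<le> real K / 4 * (h / p * Aq p)" using K6' h_pos p_pos Aq_pos by (intro self_le_mult) auto
  finally show ?thesis by simp
qed

text \<open>\<open>Bq\<close> shrinks with \<open>p\<close>, but \<open>G * p ^ (K - 4)\<close>
  never falls below \<open>g ^ 3\<close> because \<open>p * g \<ge> 1\<close>, and
  \<open>g ^ 3\<close> exceeds \<open>K * L\<^sup>2\<close>.\<close>

lemma thQ_Bq: "L\<^sup>2 / 8 \<le> thQ * (Bq p / (4 * real K))"
proof -
  have "K - 4 = Suc (K - 5)" using K6 by simp
  then have gK: "G = g ^ 3 * g ^ (K - 4)" unfolding G_facts(9) by (simp add: power_numeral_reduce)
  have "real K * L\<^sup>2 \<le> L * L\<^sup>2" using L_bounds by (intro mult_right_mono) auto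
  also have "\<dots> \<le> g * g\<^sup>2" using Lg by (intro mult_mono power_mono) auto
  also have "\<dots> = g ^ 3" by (simp flip: power_Suc)
  also have "\<dots> \<le> g ^ 3 * (p ^ (K - 4) * g ^ (K - 4))" using p_pow[of "K - 4"] Lg by (intro self_le_mult) auto
  also have "\<dots> = p ^ (K - 4) * G" unfolding gK by simp
  finally have "real K * L\<^sup>2 / (8 * real K) \<le> p ^ (K - 4) * G / (8 * real K)" by (intro divide_right_mono) auto
  then have "L\<^sup>2 / 8 \<le> p ^ (K - 4) * G / (8 * real K)" using K6' by simp
  also have "\<dots> = thQ * (Bq p / (4 * real K))" unfolding thQ_def Bq_def X_facts
    using X_facts(1) G_facts(1) by (simp add: power2_eq_square)
  finally show ?thesis .
qed

lemma thQ_Aq: "L\<^sup>2 / 8 \<le> thQ * (Aq p / 2)"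
proof -
  have gK: "g ^ (K + 1) = G * g\<^sup>2" unfolding G_def using K6 by (simp flip: power_add)
  have "L\<^sup>2 / 8 \<le> L ^ 4 / 2" using L_bounds power_increasing[of 2 4 L] zero_le_power2[of L] by linarith
  also have "\<dots> \<le> L ^ 4 / 2 * ((sg p)\<^sup>2 * ((G / g\<^sup>2) * (G * (1 / p))))"
  proof -
    have a: "1 \<le> G / g\<^sup>2" "1 \<le> 1 / p" using G_facts Lg p_pos p1 by auto
    have "1 * 1 \<le> G * (1 / p)" using a G_facts by (intro mult_mono) auto
    then have "1 * 1 \<le> (G / g\<^sup>2) * (G * (1 / p))" using a by (intro mult_mono) auto
    then have "1 * 1 \<le> (sg p)\<^sup>2 * ((G / g\<^sup>2) * (G * (1 / p)))" using sg2 by (intro mult_mono) auto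
    then show ?thesis using Lg by (intro self_le_mult) auto
  qed
  also have "\<dots> = thQ * (Aq p / 2)" unfolding thQ_def Aq_def X_facts gK
    using X_facts(1) G_facts(1) p_pos Lg(4) by (simp add: power2_eq_square power4_eq_xxxx mult_ac)
  finally show ?thesis .
qed

section \<open>One-step changes for the number of copies\<close>

lemma q_diff:
  shows "q p - q (p - h) \<le> real K * traj 2 p" "real K * traj 2 p - (real K)\<^sup>2 * h\<^sup>2 * N ^ k \<le> q p - q (p - h)"
proof -
  have hp: "0 \<le> h" "h \<le> p" "p \<le> 1" "0 < p" using h_pos h_le_p p1 p_pos by auto
  define c where "c = N ^ k / fact k"
  have c: "0 \<le> c" "c \<le> N ^ k" unfolding c_def by (auto simp: divide_le_eq intro: self_le_mult)
  have t: "q x = c * x ^ K" for x by (simp add: q_def c_def)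
  have "c * (p ^ K - real K * h * p ^ K / p) \<le> c * (p - h) ^ K"
    using c power_diff_bounds(1)[OF hp] by (intro mult_left_mono) auto
  then show "q p - q (p - h) \<le> real K * traj 2 p" unfolding traj2_q t by (simp add: algebra_simps)
  have "c * (p - h) ^ K \<le> c * (p ^ K - real K * h * p ^ K / p + (real K)\<^sup>2 * h\<^sup>2)"
    using c power_diff_bounds(2)[OF hp] by (intro mult_left_mono) auto
  moreover have "c * ((real K)\<^sup>2 * h\<^sup>2) \<le> N ^ k * ((real K)\<^sup>2 * h\<^sup>2)"
    using c by (intro mult_right_mono) auto
  ultimately show "real K * traj 2 p - (real K)\<^sup>2 * h\<^sup>2 * N ^ k \<le> q p - q (p - h)"
    unfolding traj2_q t by (simp add: algebra_simps)
qed

lemma Bq_diff: "0 \<le> Bq p - Bq (p - h)" "Bq p - Bq (p - h) \<le> (real K - 4) * (h / p * Bq p)"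
proof -
  have hp: "0 \<le> h" "h \<le> p" "p \<le> 1" "0 < p" using h_pos h_le_p p1 p_pos by auto
  define c where "c = N ^ (k - 1) / 2"
  have c: "0 \<le> c" unfolding c_def by auto
  have t: "Bq x = c * x ^ (K - 4)" for x by (simp add: Bq_def c_def)
  have "c * (p - h) ^ (K - 4) \<le> c * p ^ (K - 4)" using c hp by (intro mult_left_mono power_mono) auto
  then show "0 \<le> Bq p - Bq (p - h)" unfolding t by simp
  have "c * (p ^ (K - 4) - real (K - 4) * h * p ^ (K - 4) / p) \<le> c * (p - h) ^ (K - 4)"
    using c power_diff_bounds(1)[OF hp] by (intro mult_left_mono) auto
  moreover have "real (K - 4) = real K - 4" using K6 by simp
  ultimately show "Bq p - Bq (p - h) \<le> (real K - 4) * (h / p * Bq p)" unfolding t by (simp add: algebra_simps)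
qed

text \<open>The loss of a single step and the drop of \<open>q\<close> both equal
  \<open>K * traj 2 p\<close> up to these errors. The main terms therefore cancel in every
  individual step, not only on average, which is why \<open>NQ\<close> has the extra factor
  \<open>1 / G\<close>.\<close>

lemma NQ_parts: "real K * eps 2 p \<le> NQ / 4" "(real K)\<^sup>2 * N ^ (k - 3) \<le> NQ / 8" "(real K)\<^sup>2 * h\<^sup>2 * N ^ k \<le> NQ / 8"
proof -
  define c where "c = X / G"
  have c: "0 < c" using X_facts(1) G_facts(1) by (simp add: c_def)
  have NQ: "NQ = c * L ^ 4" by (simp add: NQ_def c_def)
  have "4 * real K * sg p \<le> L * L" using sg_bounds L_bounds K6' by (intro mult_mono) auto
  then have "4 * real K * sg p * L\<^sup>2 \<le> L * L * L\<^sup>2" by (intro mult_right_mono) auto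
  also have "\<dots> = L ^ 4" by (simp add: power2_eq_square power4_eq_xxxx)
  finally have "c * (4 * real K * sg p * L\<^sup>2) \<le> c * L ^ 4" using c by (intro mult_left_mono) auto
  moreover have "real K * eps 2 p = c * (4 * real K * sg p * L\<^sup>2) / 4"
    unfolding eps_def X_facts c_def by simp
  ultimately show "real K * eps 2 p \<le> NQ / 4" unfolding NQ by linarith
  have L4: "L \<le> L ^ 4" using L_bounds by (intro self_le_power) auto
  have "c * ((real K)\<^sup>2 / G) \<le> c * (real K)\<^sup>2" using c G_facts by (intro mult_left_mono) (auto simp: divide_le_eq self_le_mult)
  also have "\<dots> \<le> c * (L ^ 4 / 8)"
    using c L_bounds(3) L4 zero_le_power2[of "real K"] by (intro mult_left_mono; linarith)
  finally show "(real K)\<^sup>2 * N ^ (k - 3) \<le> NQ / 8" unfolding NQ X_facts c_def by (simp add: power2_eq_square mult_ac)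
  have "1 \<le> G ^ 3" using G_facts by simp
  then have "c * (4 * real K ^ 4 / G ^ 3) \<le> c * (4 * real K ^ 4)" using c G_facts by (intro mult_left_mono) (auto simp: divide_le_eq self_le_mult)
  also have "\<dots> \<le> c * (L ^ 4 / 8)"
    using c L_bounds(1) L4 zero_le_power[of "real K" 4] by (intro mult_left_mono; linarith)
  also have "c * (4 * real K ^ 4 / G ^ 3) = (real K)\<^sup>2 * h\<^sup>2 * N ^ k"
    unfolding X_facts c_def using G_facts(1) by (simp add: power2_eq_square power3_eq_cube power4_eq_xxxx mult_ac)
  finally show "(real K)\<^sup>2 * h\<^sup>2 * N ^ k \<le> NQ / 8" unfolding NQ by simp
qed

lemma yBq_le: "(real K - 4) * (h / p * Bq p) \<le> NQ / 8"
proof -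
  have "(real K - 4) * (h / p * Bq p) \<le> real K * (h / p * Bq p)"
    using h_pos p_pos Bq_pos by (intro mult_right_mono) auto
  also have "\<dots> \<le> (real K)\<^sup>2 * N ^ (k - 3)"
  proof -
    have "p ^ (K - 5) \<le> 1" using p_pos p1 by (intro power_le_one) auto
    then have "(real K)\<^sup>2 * (X / G\<^sup>2) * p ^ (K - 5) \<le> (real K)\<^sup>2 * (X / G\<^sup>2) * 1"
      using X_facts(1) by (intro mult_left_mono) auto
    then show ?thesis unfolding yBq X_facts(4) by (simp add: power2_eq_square mult_ac)
  qed
  also have "\<dots> \<le> NQ / 8" by (rule NQ_parts)
  finally show ?thesis .
qed

text \<open>\<open>Aq\<close> grows as the density falls. In the drift of the lower bound its growth
  only helps, so the sign is enough there; the size matters for the step bound.\<close>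

lemma Aq_diff:
  assumes pL': "L ^ 4 \<le> (p - h) * g"
  shows "0 \<le> Aq (p - h) - Aq p" "Aq (p - h) - Aq p \<le> NQ / 4"
proof -
  \<comment> \<open>Provides \<open>sg (p - h) \<le> L\<close>.\<close>
  interpret P': removal_density k n K g L "p - h"
    using pL' p1 h_pos by unfold_locales auto
  define s s' p' where "s = sg p" and "s' = sg (p - h)" and "p' = p - h"
  have "0 \<le> real K / 2 * (h / p)" using h_pos p_pos by (intro mult_nonneg_nonneg) auto
  then have s: "1 \<le> s" "s \<le> s'" "s' \<le> L" "s' - s \<le> real K * (h / p)"
    unfolding s_def s'_def using sg_bounds P'.sg_bounds sg_diff by linarith+
  have p': "0 < p'" "p' \<le> p" "p / 2 \<le> p'" unfolding p'_def using h_pos h_le_p p_pos by auto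
  define W where "W = N ^ k * L ^ 4 / g ^ (K + 1)"
  have W: "0 < W" unfolding W_def using Lg by auto
  have A: "Aq p = W * (s\<^sup>2 / p)" "Aq (p - h) = W * (s'\<^sup>2 / p')"
    unfolding Aq_def W_def s_def s'_def p'_def by simp_all
  have "s\<^sup>2 / p \<le> s'\<^sup>2 / p'" using s p' by (intro frac_le power_mono) auto
  then have "W * (s\<^sup>2 / p) \<le> W * (s'\<^sup>2 / p')" using W by (intro mult_left_mono) auto
  then show "0 \<le> Aq (p - h) - Aq p" unfolding A by linarith
  have sq: "s'\<^sup>2 \<le> s\<^sup>2 + 2 * real K * L * (h / p)"
  proof -
    have "s'\<^sup>2 - s\<^sup>2 = (s' - s) * (s' + s)" by (simp add: power2_eq_square algebra_simps)
    also have "\<dots> \<le> (real K * (h / p)) * (L + L)" using s y_pos by (intro mult_mono) auto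
    finally show ?thesis by (simp add: algebra_simps)
  qed
  have "1 / p' \<le> (1 + 2 * (h / p)) / p"
  proof -
    have "h * 2 * p' \<ge> h * p" using p' h_pos by (simp add: mult_left_mono[of p "2 * p'" h, simplified] )
    then have "p * p \<le> (p + 2 * h) * p'" unfolding p'_def by (simp add: algebra_simps)
    then show ?thesis using p' p_pos by (simp add: field_simps)
  qed
  then have "s'\<^sup>2 / p' \<le> s'\<^sup>2 * ((1 + 2 * (h / p)) / p)"
    using mult_left_mono[of "1 / p'" "(1 + 2 * (h / p)) / p" "s'\<^sup>2"] by simp
  also have "\<dots> = s'\<^sup>2 / p + 2 * s'\<^sup>2 * (h / p) / p" by (simp add: add_divide_distrib distrib_left)
  also have "\<dots> \<le> (s\<^sup>2 + 2 * real K * L * (h / p)) / p + 2 * L\<^sup>2 * (h / p) / p"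
    using sq s p_pos y_pos by (intro add_mono divide_right_mono mult_right_mono mult_left_mono power_mono) auto
  also have "\<dots> = s\<^sup>2 / p + (2 * real K * L + 2 * L\<^sup>2) * (h / p\<^sup>2)"
    by (simp add: add_divide_distrib distrib_right power2_eq_square)
  also have "\<dots> \<le> s\<^sup>2 / p + (4 * L\<^sup>2) * (h / p\<^sup>2)"
  proof -
    have "real K * L \<le> L * L" using L_bounds by (intro mult_right_mono) auto
    then have "2 * real K * L + 2 * L\<^sup>2 \<le> 4 * L\<^sup>2" by (simp add: power2_eq_square)
    then show ?thesis using h_pos by (intro add_left_mono mult_right_mono) auto
  qed
  finally have "Aq (p - h) - Aq p \<le> W * ((4 * L\<^sup>2) * (h / p\<^sup>2))"
    unfolding A using W mult_left_mono[of "s'\<^sup>2 / p'" "s\<^sup>2 / p + (4 * L\<^sup>2) * (h / p\<^sup>2)" W]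
    by (simp add: algebra_simps)
  also have "\<dots> = X * L ^ 4 / G * (8 * real K * L\<^sup>2 / (p * g)\<^sup>2)"
  proof -
    have gK: "g ^ (K + 1) = G * g\<^sup>2" unfolding G_def using K6 by (simp flip: power_add)
    show ?thesis unfolding W_def gK X_facts using G_facts(1) Lg p_pos
      by (simp add: field_simps power2_eq_square power4_eq_xxxx)
  qed
  also have "\<dots> \<le> NQ * (1 / 4)"
    unfolding NQ_def
  proof (rule mult_left_mono)
    have "32 * real K * L\<^sup>2 \<le> L * L\<^sup>2" using L_bounds by (intro mult_right_mono) auto
    also have "\<dots> = L ^ 3" by (simp flip: power_Suc)
    also have "\<dots> \<le> L ^ (4 * 2)" using L_bounds by (intro power_increasing) auto
    also have "\<dots> \<le> (p * g)\<^sup>2" by (rule P_facts(1))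
    finally have "32 * real K * L\<^sup>2 \<le> (p * g)\<^sup>2" .
    moreover have "0 < (p * g)\<^sup>2" using p_pos Lg by simp
    ultimately show "8 * real K * L\<^sup>2 / (p * g)\<^sup>2 \<le> 1 / 4" by (simp add: divide_le_eq)
  qed (use X_facts(1) G_facts(1) in auto)
  finally show "Aq (p - h) - Aq p \<le> NQ / 4" by simp
qed

text \<open>Bounds the number of copies that share several edges with the deleted one and are therefore
  counted repeatedly by the sum of its edge degrees. Its comparison with the drift of \<open>Bq\<close> is what
  uses the tracking of \<open>R\<close> for triples.\<close>

definition ov :: real where
  "ov = real K * (real k - 2) * (traj 3 p + eps 3 p) + (real K)\<^sup>2 / 2 * N ^ (k - 4)"

text \<open>The main term is governed by \<open>(k - 2) / fact (k - 3)\<close>, which is at most 2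
  with equality for \<open>k = 4\<close>. The remaining 1/2 has room for \<open>eps 3\<close> and
  for the overlaps on four vertices.\<close>

lemma ov_le: "ov \<le> 5 / 2 * (h / p * Bq p)"
proof -
  define Y where "Y = X / G\<^sup>2 * p ^ (K - 5)"
  have Y: "0 < Y" unfolding Y_def using X_facts(1) G_facts(1) p_pos by auto
  have yB: "h / p * Bq p = real K * Y" unfolding yBq Y_def by simp
  have t3: "traj 3 p \<le> Y / fact (k - 3)"
  proof -
    have "p ^ (K - 3) \<le> p ^ (K - 5)" using p_pos p1 by (intro power_decreasing) auto
    then have "N ^ (k - 3) / fact (k - 3) * p ^ (K - 3) \<le> N ^ (k - 3) / fact (k - 3) * p ^ (K - 5)"
      by (intro mult_left_mono) auto
    then show ?thesis unfolding traj_def kap_small X_facts(4) Y_def by simp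
  qed
  have k2: "real k - 2 \<le> 2 * fact (k - 3)"
  proof -
    have "k - 3 \<le> fact (k - 3)" "1 \<le> (fact (k - 3) :: nat)" by (rule fact_ge_self, simp)
    then have "k - 2 \<le> 2 * fact (k - 3)" using k by linarith
    then have "real (k - 2) \<le> real (2 * fact (k - 3))" by (rule of_nat_mono)
    then show ?thesis using k by (simp add: of_nat_diff)
  qed
  have e3: "eps 3 p \<le> traj 3 p / 1000" using k by (intro eps_le) auto
  have "(real k - 2) * (traj 3 p + eps 3 p) \<le> (2 * fact (k - 3)) * (1001 / 1000 * (Y / fact (k - 3)))"
    using k2 e3 t3 traj_pos[of 3] eps_pos(1)[of 3] k by (intro mult_mono) auto
  also have "\<dots> = 2002 / 1000 * Y" by simp
  finally have "real K * ((real k - 2) * (traj 3 p + eps 3 p)) \<le> real K * (2002 / 1000 * Y)"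
    by (intro mult_left_mono) auto
  moreover have "(real K)\<^sup>2 / 2 * N ^ (k - 4) \<le> real K * (Y / 10)"
  proof -
    have "5 * real K \<le> L" using L_bounds K6' by linarith
    also have "L \<le> G" by (rule G_facts)
    also have "\<dots> \<le> G * (g ^ 4 * (p ^ (K - 5) * g ^ (K - 5)))"
    proof -
      have "1 * 1 \<le> g ^ 4 * (p ^ (K - 5) * g ^ (K - 5))" using p_pow[of "K - 5"] Lg by (intro mult_mono) auto
      then show ?thesis using G_facts(1) by (intro self_le_mult) auto
    qed
    also have "\<dots> = G * (p ^ (K - 5) * G)" unfolding G_facts(9) by simp
    also have "\<dots> = G\<^sup>2 * p ^ (K - 5)" by (simp add: power2_eq_square)
    finally have "real K * X / G ^ 4 * (5 * real K) \<le> real K * X / G ^ 4 * (G\<^sup>2 * p ^ (K - 5))"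
      using X_facts(1) by (intro mult_left_mono) auto
    then have "real K * X / G ^ 4 * (5 * real K) / 10 \<le> real K * X / G ^ 4 * (G\<^sup>2 * p ^ (K - 5)) / 10"
      by (intro divide_right_mono) auto
    moreover have "(real K)\<^sup>2 / 2 * N ^ (k - 4) = real K * X / G ^ 4 * (5 * real K) / 10"
      unfolding X_facts by (simp add: power2_eq_square)
    moreover have "real K * (Y / 10) = real K * X / G ^ 4 * (G\<^sup>2 * p ^ (K - 5)) / 10"
      unfolding Y_def using G_facts(1) by (simp add: power2_eq_square power4_eq_xxxx)
    ultimately show ?thesis by simp
  qed
  ultimately have "ov \<le> real K * (2002 / 1000 * Y) + real K * (Y / 10)" unfolding ov_def by linarith
  also have "\<dots> \<le> 5 / 2 * (real K * Y)" using Y mult_nonneg_nonneg[of "real K" Y] by simp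
  finally show ?thesis unfolding yB .
qed

text \<open>\<open>M\<close> is the exact number of edges, the complete graph having
  \<open>N\<^sup>2 / 2 - N / 2\<close>. Replacing it by \<open>N\<^sup>2 * p / 2\<close> errs in the
  favourable direction for the upper bound on \<open>Q\<close>; the lower bound has to pay the
  factor \<open>1 + 2 / (N * p)\<close>.\<close>

lemma edge_count:
  defines "M \<equiv> N\<^sup>2 * p / 2 - N / 2"
  shows "0 < M" "real K * (h / p) \<le> (real K)\<^sup>2 / M"
    "(real K)\<^sup>2 / M \<le> real K * (h / p) * (1 + 2 / (N * p))" "M \<le> N\<^sup>2 * p / 2"
proof -
  have Np: "2 \<le> N * p"
  proof -
    have "2 \<le> g ^ 6" using L_bounds(4) Lg self_le_power[of g 6] by linarith
    moreover have "p ^ 4 \<le> p ^ 1" using p_pos p1 by (intro power_decreasing) auto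
    then have "N * p ^ 4 \<le> N * p" using Lg by (intro mult_left_mono) auto
    ultimately show ?thesis using Np4_ge by linarith
  qed
  have Mx: "M = N * (N * p - 1) / 2" unfolding M_def by (simp add: power2_eq_square algebra_simps)
  show M0: "0 < M" unfolding Mx using Np Lg by simp
  show M1: "M \<le> N\<^sup>2 * p / 2" unfolding M_def using Lg by simp
  have hy: "real K * (h / p) = (real K)\<^sup>2 / (N\<^sup>2 * p / 2)" unfolding h_def using p_pos Lg by (simp add: power2_eq_square)
  show "real K * (h / p) \<le> (real K)\<^sup>2 / M" unfolding hy using M0 M1 by (intro divide_left_mono) auto
  define x where "x = N * p"
  have x: "2 \<le> x" "N\<^sup>2 * p / 2 = N * x / 2" "M = N * (x - 1) / 2" using Np by (auto simp: x_def Mx power2_eq_square)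
  have "1 / (x - 1) \<le> (1 + 2 / x) / x" using x by (simp add: field_simps)
  then have "2 * (real K)\<^sup>2 / N * (1 / (x - 1)) \<le> 2 * (real K)\<^sup>2 / N * ((1 + 2 / x) / x)"
    using Lg by (intro mult_left_mono) auto
  then show "(real K)\<^sup>2 / M \<le> real K * (h / p) * (1 + 2 / (N * p))"
    unfolding hy x(2,3) x_def[symmetric] by (simp add: mult_ac)
qed

text \<open>In units of \<open>(h / p) * Bq p\<close>, an excess of \<open>Q\<close> contracts at
  rate \<open>K\<close> and \<open>Bq\<close> shrinks at rate at most \<open>K - 4\<close>. Of the
  difference 4, the window \<open>Bq p / (4 * K)\<close> takes 1/4 and \<open>ov\<close> at most
  5/2; what is left exceeds \<open>dQ\<close>.\<close>

lemma Q_upper_step: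
  fixes l :: "'a \<Rightarrow> real"
  assumes A: "finite A"
    and l: "\<And>C. C \<in> A \<Longrightarrow> real K * traj 2 p - real K * eps 2 p - (real K)\<^sup>2 * N ^ (k - 3) \<le> l C"
      "\<And>C. C \<in> A \<Longrightarrow> l C \<le> real K * traj 2 p + real K * eps 2 p"
    and lo: "(real K * real (card A))\<^sup>2 / (N\<^sup>2 * p / 2 - N / 2) - real (card A) * ov \<le> (\<Sum>C\<in>A. l C)"
  shows "(\<Sum>C\<in>A. exp (thQ * (real (card A) - l C - q (p - h) - Bq (p - h))))
     \<le> real (card A) * (exp (thQ * (real (card A) - q p - Bq p)) + exp (1 - thQ * (Bq p / (4 * real K))))"
proof (rule exp_supermartingale_step[OF A thQ_pos, where V = "NQ\<^sup>2" and d = dQ])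
  let ?y = "h / p" and ?c = "real (card A)"
  let ?D = "\<lambda>C. ?c - l C - q (p - h) - Bq (p - h) - (?c - q p - Bq p)"
  have D: "\<bar>?D C\<bar> \<le> NQ" if "C \<in> A" for C
    using l[OF that] q_diff Bq_diff yBq_le NQ_parts thQ_facts(3)
    unfolding abs_le_iff by (intro conjI; linarith)
  show "thQ * \<bar>?D C\<bar> \<le> 1" if "C \<in> A" for C
    using mult_left_mono[OF D[OF that], of thQ] thQ_facts thQ_pos by linarith
  have "(?D C)\<^sup>2 \<le> NQ\<^sup>2" if "C \<in> A" for C using D[OF that] by (metis abs_ge_zero power2_abs power_mono)
  then show "(\<Sum>C\<in>A. (?D C)\<^sup>2) \<le> NQ\<^sup>2 * ?c" using sum_bounded_above[of A "\<lambda>C. (?D C)\<^sup>2" "NQ\<^sup>2"] by (simp add: mult.commute)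
  show "thQ * NQ\<^sup>2 \<le> dQ" using thQ_facts by simp
  assume "- (Bq p / (4 * real K)) \<le> ?c - q p - Bq p"
  then have c: "q p + Bq p - Bq p / (4 * real K) \<le> ?c" by linarith
  have Ky: "0 \<le> real K * ?y" using h_pos p_pos by simp
  \<comment> \<open>Only one factor \<open>?c\<close> of the square is estimated; the other is the
    number of summands and divides out of the average.\<close>
  have "(real K * ?y) * (?c * (q p + Bq p - Bq p / (4 * real K))) \<le> (real K * ?y) * (?c * ?c)"
    using c Ky by (intro mult_left_mono) auto
  also have "\<dots> \<le> (real K)\<^sup>2 / (N\<^sup>2 * p / 2 - N / 2) * (?c * ?c)"
    using edge_count(2) by (intro mult_right_mono) auto
  also have "\<dots> = (real K * ?c)\<^sup>2 / (N\<^sup>2 * p / 2 - N / 2)" by (simp add: power2_eq_square)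
  finally have 0: "(real K * ?y) * (?c * (q p + Bq p - Bq p / (4 * real K))) \<le> (real K * ?c)\<^sup>2 / (N\<^sup>2 * p / 2 - N / 2)" .
  have 1: "?c * ((real K * ?y) * (q p + Bq p - Bq p / (4 * real K)) - ov) \<le> (\<Sum>C\<in>A. l C)"
  proof -
    have "c * (a * b - o') = a * (c * b) - c * o'" for a b c o' :: real by (simp add: algebra_simps)
    from this[of ?c "real K * ?y" _ ov] show ?thesis using lo 0 by simp
  qed
  have e: "(real K * ?y) * (q p + Bq p - Bq p / (4 * real K)) = real K * traj 2 p + real K * (?y * Bq p) - (?y * Bq p) / 4"
  proof -
    have "real K * ?y * (Bq p / (4 * real K)) = ?y * Bq p / 4" using K6 by simp
    moreover have "a * (b + c - d) = a * b + a * c - a * d" for a b c d :: real by (simp add: algebra_simps)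
    ultimately show ?thesis unfolding traj2_q by (simp only: mult.assoc)
  qed
  have "(\<Sum>C\<in>A. ?D C) = ?c * ((q p - q (p - h)) + (Bq p - Bq (p - h))) - (\<Sum>C\<in>A. l C)"
    by (simp add: sum_subtractf sum.distrib algebra_simps)
  also have "\<dots> \<le> ?c * (real K * traj 2 p + (real K - 4) * (?y * Bq p)) - (\<Sum>C\<in>A. l C)"
    using q_diff Bq_diff by (intro diff_right_mono mult_left_mono add_mono) auto
  also have "\<dots> \<le> ?c * (ov - 15 / 4 * (?y * Bq p))"
  proof -
    have "c * (a + b * z - z / 4 - w) \<le> S \<Longrightarrow> c * (a + (b - 4) * z) - S \<le> c * (w - 15 / 4 * z)"
      for a b c w z S :: real by (simp add: algebra_simps)
    from this[OF 1[unfolded e]] show ?thesis .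
  qed
  also have "\<dots> \<le> ?c * (- dQ)"
  proof (rule mult_left_mono)
    have "0 \<le> ?y * Bq p" using h_pos p_pos Bq_pos by simp
    then show "ov - 15 / 4 * (?y * Bq p) \<le> - dQ" using ov_le dQ_le_yBq by linarith
  qed simp
  finally show "(\<Sum>C\<in>A. ?D C) \<le> - dQ * ?c" by (simp add: mult.commute)
qed

text \<open>Inside the window \<open>Q\<close> is short by at least \<open>Aq p / 2\<close>, which
  gains half of \<open>K * (h / p) * Aq p\<close>. The edge count \<open>t1\<close>, the spread of
  the degrees \<open>t2\<close> and the curvature \<open>t3\<close> cost one sixteenth each, so a
  quarter certainly remains.\<close>

lemma Q_lower_step:
  fixes l :: "'a \<Rightarrow> real"
  assumes A: "finite A" and pL': "L ^ 4 \<le> (p - h) * g"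
    and l: "\<And>C. C \<in> A \<Longrightarrow> real K * traj 2 p - real K * eps 2 p - (real K)\<^sup>2 * N ^ (k - 3) \<le> l C"
      "\<And>C. C \<in> A \<Longrightarrow> l C \<le> real K * traj 2 p + real K * eps 2 p"
    and hi: "(\<Sum>C\<in>A. l C) \<le> (real K * real (card A))\<^sup>2 / (N\<^sup>2 * p / 2 - N / 2) + (N\<^sup>2 * p / 2 - N / 2) * (eps 2 p)\<^sup>2"
    and card: "q p - Aq p \<le> real (card A)"
  shows "(\<Sum>C\<in>A. exp (thQ * (q (p - h) - Aq (p - h) - (real (card A) - l C))))
     \<le> real (card A) * (exp (thQ * (q p - Aq p - real (card A))) + exp (1 - thQ * (Aq p / 2)))"
proof (rule exp_supermartingale_step[OF A thQ_pos, where V = "NQ\<^sup>2" and d = dQ])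
  let ?y = "h / p" and ?c = "real (card A)"
  let ?D = "\<lambda>C. q (p - h) - Aq (p - h) - (?c - l C) - (q p - Aq p - ?c)"
  have D: "\<bar>?D C\<bar> \<le> NQ" if "C \<in> A" for C
    using l[OF that] q_diff Aq_diff[OF pL'] NQ_parts thQ_facts(3)
    unfolding abs_le_iff by (intro conjI; linarith)
  show "thQ * \<bar>?D C\<bar> \<le> 1" if "C \<in> A" for C
    using mult_left_mono[OF D[OF that], of thQ] thQ_facts thQ_pos by linarith
  have "(?D C)\<^sup>2 \<le> NQ\<^sup>2" if "C \<in> A" for C using D[OF that] by (metis abs_ge_zero power2_abs power_mono)
  then show "(\<Sum>C\<in>A. (?D C)\<^sup>2) \<le> NQ\<^sup>2 * ?c" using sum_bounded_above[of A "\<lambda>C. (?D C)\<^sup>2" "NQ\<^sup>2"] by (simp add: mult.commute)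
  show "thQ * NQ\<^sup>2 \<le> dQ" using thQ_facts by simp
  assume "- (Aq p / 2) \<le> q p - Aq p - ?c"
  then have c: "?c \<le> q p - Aq p / 2" by linarith
  define M where "M = N\<^sup>2 * p / 2 - N / 2"
  note ec = edge_count[folded M_def]
  have Ky: "0 \<le> real K * ?y" using h_pos p_pos by simp
  have c2: "q p \<le> 2 * ?c" "?c \<le> q p" using card c Aq_q q_pos Aq_pos by auto
  have yA0: "0 < ?y * Aq p" using h_pos p_pos Aq_pos by simp
  have t1: "real K * ?y * ?c * (2 / (N * p)) \<le> real K * (?y * Aq p) / 16"
  proof -
    have "real K * ?y * ?c * (2 / (N * p)) \<le> real K * ?y * q p * (2 / (N * p))"
      using c2 Ky Lg p_pos by (intro mult_right_mono mult_left_mono) auto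
    also have "\<dots> = 2 * real K * (traj 2 p / p) / N" unfolding traj2_q by (simp add: mult_ac)
    also have "\<dots> \<le> 2 * real K * X / N"
    proof -
      have "traj 2 p \<le> X * p" unfolding X_def using k by (intro traj_le_p) auto
      then have "traj 2 p / p \<le> X" using p_pos by (simp add: divide_le_eq)
      then show ?thesis using Lg by (intro divide_right_mono mult_left_mono) auto
    qed
    also have "\<dots> = real K * (X / (G * G) * 2)" unfolding G_facts(4) by (simp add: power2_eq_square)
    also have "\<dots> \<le> real K * (X / (G * g\<^sup>2) * (L ^ 4 / 16))"
    proof (intro mult_left_mono mult_mono divide_left_mono)
      have "L \<le> L ^ 4" using L_bounds by (intro self_le_power) auto
      then show "2 \<le> L ^ 4 / 16" using L_bounds(4) by linarith
    qed (use G_facts X_facts(1) Lg in auto)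
    also have "\<dots> = real K * ((X * L ^ 4 / (G * g\<^sup>2)) / 16)" by simp
    also have "\<dots> \<le> real K * ((?y * Aq p) / 16)" using yAq_ge by (intro mult_left_mono divide_right_mono) auto
    finally show ?thesis by simp
  qed
  have t3: "(real K)\<^sup>2 * h\<^sup>2 * N ^ k \<le> real K * (?y * Aq p) / 16"
  proof -
    have "(real K)\<^sup>2 * h\<^sup>2 * N ^ k = real K * (X / (G * (G * G\<^sup>2)) * (4 * real K ^ 3))"
      unfolding X_facts using G_facts(1) by (simp add: power2_eq_square power3_eq_cube power4_eq_xxxx)
    also have "\<dots> \<le> real K * (X / (G * g\<^sup>2) * (L ^ 4 / 16))"
    proof (intro mult_left_mono mult_mono divide_left_mono)
      have "L \<le> L ^ 4" using L_bounds by (intro self_le_power) auto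
      moreover have "real K ^ 3 \<le> real K ^ 4" using K6' by (intro power_increasing) auto
      ultimately show "4 * real K ^ 3 \<le> L ^ 4 / 16" using L_bounds(1) zero_le_power[of "real K" 4] by linarith
      have "1 \<le> G\<^sup>2" using G_facts by simp
      then have "G * 1 \<le> G * G\<^sup>2" using G_facts(1) by (intro mult_left_mono) auto
      then show "g\<^sup>2 \<le> G * G\<^sup>2" using G_facts by linarith
    qed (use G_facts X_facts(1) Lg in auto)
    also have "\<dots> = real K * ((X * L ^ 4 / (G * g\<^sup>2)) / 16)" by simp
    also have "\<dots> \<le> real K * ((?y * Aq p) / 16)" using yAq_ge by (intro mult_left_mono divide_right_mono) auto
    finally show ?thesis by simp
  qed
  \<comment> \<open>After the common factors cancel, the comparison is between
    \<open>(p * g)\<^sup>2\<close> and \<open>(p * g) ^ (K - 1)\<close> up to constants. The powers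
    of n on both sides agree when \<open>p * g\<close> is constant; the surplus exponent
    \<open>K - 3\<close> absorbs \<open>fact k\<close>.\<close>
  have t2: "M * (eps 2 p)\<^sup>2 \<le> ?c * (real K * (?y * Aq p) / 16)"
  proof -
    define s where "s = (sg p)\<^sup>2 * X * L ^ 4 / G"
    have s: "0 < s" unfolding s_def using sg2 X_facts(1) G_facts(1) Lg by auto
    have P: "p * g \<ge> 1" "0 < p * g" using P_facts p_pos Lg by auto
    have gp: "G * p ^ (K - 1) = (p * g) ^ (K - 1)" unfolding G_def by (simp add: power_mult_distrib)
    have pK: "p ^ K = p * p ^ (K - 1)" using K6 by (simp flip: power_Suc)
    have "fact k * 16 \<le> 1000 * (real K * fact k)" using K6' mult_right_mono[of 1 "real K" "fact k"] by simp
    also have "\<dots> \<le> p * g" using L_bounds(6) P_facts(4) by linarith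
    also have "\<dots> \<le> (p * g) ^ (K - 3)" using K6 P by (intro self_le_power) auto
    finally have "(fact k * 16) * (p * g)\<^sup>2 \<le> (p * g) ^ (K - 3) * (p * g)\<^sup>2" by (intro mult_right_mono) auto
    also have "\<dots> = G * p ^ (K - 1)"
    proof -
      have "K - 1 = (K - 3) + 2" using K6 by simp
      then show ?thesis unfolding gp by (simp only: power_add)
    qed
    also have "\<dots> \<le> G * p ^ (K - 1) * (2 * (real K)\<^sup>2)"
    proof -
      have "1 \<le> (real K)\<^sup>2" using K6' by (intro one_le_power) linarith
      then show ?thesis using G_facts(1) p_pos by (intro self_le_mult) auto
    qed
    finally have i: "fact k * (p * g)\<^sup>2 \<le> G * p ^ (K - 1) * (2 * (real K)\<^sup>2 / 16)" by simp
    have "N\<^sup>2 * p * (eps 2 p)\<^sup>2 = q p * (s * (fact k / (G * p ^ (K - 1))))"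
      unfolding q_def eps_def X_facts s_def pK unfolding G_facts(4) using G_facts(1) p_pos X_facts(1)
      by (simp add: field_simps power2_eq_square power4_eq_xxxx)
    also have "\<dots> \<le> q p * (s * ((2 * (real K)\<^sup>2 / 16) / (p * g)\<^sup>2))"
    proof (intro mult_left_mono)
      show "fact k / (G * p ^ (K - 1)) \<le> (2 * (real K)\<^sup>2 / 16) / (p * g)\<^sup>2"
      proof -
        have "a * c \<le> b * d \<Longrightarrow> 0 < b \<Longrightarrow> 0 < c \<Longrightarrow> a / b \<le> d / c" for a b c d :: real
          by (simp add: field_simps)
        from this[OF i] show ?thesis using G_facts(1) p_pos P(2) Lg(4) by (simp del: power_mult_distrib)
      qed
    qed (use s q_pos in auto)
    also have "\<dots> = q p * (real K * (?y * Aq p) / 16)" unfolding yAq s_def by (simp add: power2_eq_square mult_ac)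
    also have "\<dots> \<le> (2 * ?c) * (real K * (?y * Aq p) / 16)" using c2 h_pos p_pos Aq_pos by (intro mult_right_mono) auto
    finally have "N\<^sup>2 * p / 2 * (eps 2 p)\<^sup>2 \<le> ?c * (real K * (?y * Aq p) / 16)" by simp
    moreover have "M * (eps 2 p)\<^sup>2 \<le> N\<^sup>2 * p / 2 * (eps 2 p)\<^sup>2" using ec(4) by (intro mult_right_mono) auto
    ultimately show ?thesis by linarith
  qed
  have "(real K * ?c)\<^sup>2 / M = ?c * ?c * ((real K)\<^sup>2 / M)" by (simp add: power2_eq_square)
  also have "\<dots> \<le> ?c * ?c * (real K * ?y * (1 + 2 / (N * p)))" using ec(3) by (intro mult_left_mono) auto
  also have "\<dots> = ?c * (real K * ?y * ?c + real K * ?y * ?c * (2 / (N * p)))" by (simp add: algebra_simps)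
  also have "\<dots> \<le> ?c * (real K * ?y * (q p - Aq p / 2) + real K * (?y * Aq p) / 16)"
    by (intro mult_left_mono[OF add_mono[OF mult_left_mono[OF c Ky] t1]]) simp
  also have "\<dots> = ?c * (real K * traj 2 p - 7 / 16 * (real K * (?y * Aq p)))"
  proof -
    have "c * (b * y * (q' - a / 2) + b * (y * a) / 16) = c * (b * (y * q') - 7 / 16 * (b * (y * a)))"
      for a b c y q' :: real by (simp add: field_simps)
    then show ?thesis unfolding traj2_q .
  qed
  finally have S: "(\<Sum>C\<in>A. l C) \<le> ?c * (real K * traj 2 p - 7 / 16 * (real K * (?y * Aq p))) + ?c * (real K * (?y * Aq p) / 16)"
    using hi[folded M_def] t2 by linarith
  have "(\<Sum>C\<in>A. ?D C) = (\<Sum>C\<in>A. l C) - ?c * ((q p - q (p - h)) + (Aq (p - h) - Aq p))"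
    by (simp add: sum_subtractf sum.distrib algebra_simps)
  also have "\<dots> \<le> (\<Sum>C\<in>A. l C) - ?c * (real K * traj 2 p - real K * (?y * Aq p) / 16)"
    using q_diff(2) Aq_diff(1)[OF pL'] t3 by (intro diff_left_mono mult_left_mono) auto
  also have "\<dots> \<le> ?c * (- (real K * (?y * Aq p) / 4))"
  proof -
    have "0 \<le> ?c * (real K * (?y * Aq p))" using h_pos p_pos Aq_pos by simp
    then show ?thesis using S by (simp add: algebra_simps)
  qed
  also have "\<dots> \<le> ?c * (- dQ)" using dQ_le_yAq by (intro mult_left_mono) auto
  finally show "(\<Sum>C\<in>A. ?D C) \<le> - dQ * ?c" by (simp add: mult.commute)
qed

end

section \<open>The failure probability\<close>

lemma binomial_fact_ge: "j \<le> n \<Longrightarrow> (real n - real j) ^ j \<le> real (n choose j) * fact j"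
proof (induction j)
  case (Suc j)
  have "Suc j * (n choose Suc j) = (n - j) * (n choose j)"
    using binomial_absorption[of j n] binomial_absorb_comp[of n j] by simp
  then have "real (Suc j * (n choose Suc j)) = real ((n - j) * (n choose j))" by (rule arg_cong)
  then have eq: "real (Suc j) * real (n choose Suc j) = (real n - real j) * real (n choose j)"
    using Suc.prems by (simp only: of_nat_mult of_nat_diff Suc_leD)
  have "(real n - real (Suc j)) ^ Suc j \<le> (real n - real j) * (real n - real j) ^ j"
    unfolding power_Suc using Suc.prems by (intro mult_mono power_mono) auto
  also have "\<dots> \<le> (real n - real j) * (real (n choose j) * fact j)"
    using Suc by (intro mult_left_mono) auto
  also have "\<dots> = (real (Suc j) * real (n choose Suc j)) * fact j" unfolding eq by (rule mult.assoc[symmetric])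
  also have "\<dots> = real (n choose Suc j) * fact (Suc j)" unfolding fact_Suc by (simp only: mult_ac)
  finally show ?case .
qed simp

lemma binomial_ge_leading_term:
  assumes "j \<le> k" "m + j = k" "k \<le> n" "0 < n"
  shows "real n ^ j / fact j - (real k)\<^sup>2 * real n ^ j / real n \<le> real ((n - m) choose j)"
proof -
  have "real k / real n \<le> 1" using assms by simp
  have "1 + real j * (- (real k / real n)) \<le> (1 + (- (real k / real n))) ^ j"
    using assms by (intro Bernoulli_inequality) simp
  then have "real n ^ j * (1 - real j * (real k / real n)) \<le> real n ^ j * (1 - real k / real n) ^ j"
    by (intro mult_left_mono) auto
  also have "\<dots> = (real n * (1 - real k / real n)) ^ j" by (simp add: power_mult_distrib)
  also have "real n * (1 - real k / real n) = real (n - m) - real j"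
  proof -
    have "real n * (1 - real k / real n) = real n - real k" using assms(4) by (simp add: field_simps)
    moreover have "real k = real m + real j" using assms(2) by (metis of_nat_add)
    moreover have "real (n - m) = real n - real m" using assms by (intro of_nat_diff) linarith
    ultimately show ?thesis by linarith
  qed
  also have "(real (n - m) - real j) ^ j \<le> real ((n - m) choose j) * fact j"
    using assms by (intro binomial_fact_ge) auto
  finally have 1: "real n ^ j * (1 - real j * (real k / real n)) / fact j \<le> real ((n - m) choose j)"
    by (simp add: divide_le_eq)
  have "real j * real k / fact j \<le> real k * real k / 1"
    using assms by (intro frac_le mult_right_mono) auto
  then have "real n ^ j / real n * (real j * real k / fact j) \<le> real n ^ j / real n * (real k)\<^sup>2"
    by (intro mult_left_mono) (auto simp: power2_eq_square)
  with 1 show ?thesis by (simp add: algebra_simps diff_divide_distrib)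
qed

lemma binomial_le_power_fact: "real ((n - m) choose j) \<le> real n ^ j / fact j"
proof -
  have "real (((n - m) choose j) * fact j) \<le> real ((n - m) ^ j)"
    by (intro of_nat_mono binomial_fact_pow)
  also have "\<dots> \<le> real (n ^ j)" by (intro of_nat_mono power_mono) auto
  finally show ?thesis by (simp add: le_divide_eq)
qed

lemma card_exts_complete:
  assumes "U \<subseteq> {1..n}" "card U = m" "m \<le> k"
  shows "card (exts k n U (nsets {1..n} 2)) = (n - m) choose (k - m)"
proof -
  have "ext_edges U S \<subseteq> nsets {1..n} 2" if "S \<subseteq> {1..n} - U" for S
  proof -
    have "nsets (S \<union> U) 2 \<subseteq> nsets {1..n} 2" using assms that by (intro nsets_mono) auto
    then show ?thesis by (auto simp: ext_edges_def)
  qed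
  then have "exts k n U (nsets {1..n} 2) = nsets ({1..n} - U) (k - m)"
    using assms by (auto simp: exts_def nsets_def)
  moreover have "card ({1..n} - U) = n - m" using assms by (simp add: card_Diff_subset finite_subset)
  ultimately show ?thesis by simp
qed

context removal_regime
begin

section \<open>The potential summed over all constraints\<close>

definition base_sets :: "nat set set" where
  "base_sets = {U. U \<subseteq> {1..n} \<and> 2 \<le> card U \<and> card U \<le> k - 1}"

text \<open>All constraints are tracked jointly: every drift uses the degrees (size 2) and those of
  \<open>R\<close> also use \<open>Q\<close>, while the upper bound on \<open>Q\<close> uses triples
  (size 3).\<close>

definition good :: "real \<Rightarrow> nat set set \<Rightarrow> bool" where
  "good p E \<longleftrightarrow>
    real (Q k n E) \<le> q p + Bq p \<and> q p - Aq p \<le> real (Q k n E) \<and>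
    (\<forall>U\<in>base_sets. \<bar>real (card (exts k n U E)) - traj (card U) p\<bar> \<le> eps (card U) p)"

definition estimator :: "real \<Rightarrow> nat set set \<Rightarrow> real" where
  "estimator p E = exp (thQ * (real (Q k n E) - q p - Bq p)) + exp (thQ * (q p - Aq p - real (Q k n E)))
    + (\<Sum>U\<in>base_sets. exp (thR (card U) * (real (card (exts k n U E)) - traj (card U) p - eps (card U) p))
        + exp (thR (card U) * (traj (card U) p - eps (card U) p - real (card (exts k n U E)))))"

text \<open>The number of edges is deterministic: every step deletes exactly \<open>K\<close> of
  them, which lowers the density by \<open>h\<close>.\<close>

definition valid :: "real \<Rightarrow> nat set set \<Rightarrow> bool" where
  "valid p E \<longleftrightarrow> E \<subseteq> nsets {1..n} 2 \<and> real (card E) = N\<^sup>2 * p / 2 - N / 2"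

definition constraint_count :: real where "constraint_count = 2 + 2 * real (card base_sets)"

lemma finite_base_sets [simp]: "finite base_sets"
  by (rule finite_subset[of _ "Pow {1..n}"]) (auto simp: base_sets_def)

lemma estimator_nonneg: "0 \<le> estimator p E"
  unfolding estimator_def by (intro add_nonneg_nonneg sum_nonneg) auto

lemma estimator_bad:
  assumes "\<not> good p E"
  shows "1 \<le> estimator p E"
proof -
  let ?f = "\<lambda>U. exp (thR (card U) * (real (card (exts k n U E)) - traj (card U) p - eps (card U) p))
        + exp (thR (card U) * (traj (card U) p - eps (card U) p - real (card (exts k n U E))))"
  have s0: "0 \<le> (\<Sum>U\<in>base_sets. ?f U)" by (intro sum_nonneg add_nonneg_nonneg) auto
  have ex: "1 \<le> exp (\<theta> * z)" if "0 < \<theta>" "0 \<le> z" for \<theta> z :: real using that by simp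
  consider "q p + Bq p < real (Q k n E)" | "real (Q k n E) < q p - Aq p"
    | U where "U \<in> base_sets" "eps (card U) p < \<bar>real (card (exts k n U E)) - traj (card U) p\<bar>"
    using assms by (force simp: good_def)
  then show ?thesis
  proof cases
    case 1
    then have "1 \<le> exp (thQ * (real (Q k n E) - q p - Bq p))" by (intro ex thQ_pos) auto
    then show ?thesis unfolding estimator_def using s0 exp_ge_zero[of "thQ * (q p - Aq p - real (Q k n E))"] by linarith
  next
    case 2
    then have "1 \<le> exp (thQ * (q p - Aq p - real (Q k n E)))" by (intro ex thQ_pos) auto
    then show ?thesis unfolding estimator_def using s0 exp_ge_zero[of "thQ * (real (Q k n E) - q p - Bq p)"] by linarith
  next
    case (3 U)
    have "1 \<le> ?f U"
    proof (cases "real (card (exts k n U E)) \<ge> traj (card U) p")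
      case True
      then have "1 \<le> exp (thR (card U) * (real (card (exts k n U E)) - traj (card U) p - eps (card U) p))"
        using 3 by (intro ex thR_pos) auto
      then show ?thesis by (simp add: add_increasing2)
    next
      case False
      then have "1 \<le> exp (thR (card U) * (traj (card U) p - eps (card U) p - real (card (exts k n U E))))"
        using 3 by (intro ex thR_pos) auto
      then show ?thesis by (simp add: add_increasing)
    qed
    also have "?f U \<le> (\<Sum>U\<in>base_sets. ?f U)" using 3 by (intro member_le_sum) auto
    finally show ?thesis unfolding estimator_def
      using exp_ge_zero[of "thQ * (q p - Aq p - real (Q k n E))"] exp_ge_zero[of "thQ * (real (Q k n E) - q p - Bq p)"] by linarith
  qed
qed

lemma card_loss_base_le:
  assumes "U \<in> base_sets" "C \<in> cliques_in k {1..n} E"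
  shows "real (card (loss k n U E C)) \<le> real k * N ^ (k - card U) / N"
proof -
  have "card (loss k n U E C) \<le> k * n ^ (k - card U - 1)"
    using assms k by (intro card_loss_le) (auto simp: base_sets_def cliques_in_def)
  then have "real (card (loss k n U E C)) \<le> real (k * n ^ (k - card U - 1))" by (rule of_nat_mono)
  moreover have "k - card U = Suc (k - card U - 1)" using assms k by (auto simp: base_sets_def)
  then have "N ^ (k - card U) = N * N ^ (k - card U - 1)" by (metis power_Suc)
  ultimately show ?thesis using Lg by simp
qed

end

context removal_density
begin

lemma good_nonempty:
  assumes "good p E"
  shows "cliques_in k {1..n} E \<noteq> {}"
proof -
  have "0 < real (Q k n E)" using assms Aq_q q_pos unfolding good_def by linarith
  then show ?thesis by (auto simp: Q_def)
qed

lemma valid_step: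
  assumes "valid p E" "C \<in> cliques_in k {1..n} E"
  shows "valid (p - h) (E - nsets C 2)"
proof -
  have C: "finite C" "card C = k" "nsets C 2 \<subseteq> E"
    using assms by (auto simp: cliques_in_def clique_iff_nsets_subset nsets_def[of _ k])
  have E: "finite E" using assms(1) finite_subset[OF _ finite_imp_finite_nsets] by (auto simp: valid_def)
  have "card (nsets C 2) \<le> card E" using C E by (intro card_mono) auto
  then have "real (card (E - nsets C 2)) = real (card E) - real (card (nsets C 2))"
    using C E by (simp add: card_Diff_subset finite_imp_finite_nsets of_nat_diff del: card_nsets)
  also have "\<dots> = real (card E) - real K" using C by (simp add: K_eq)
  also have "\<dots> = N\<^sup>2 * (p - h) / 2 - N / 2"
  proof -
    have "N\<^sup>2 * h = 2 * real K" using Lg(6) by (simp add: h_def)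
    then have "N\<^sup>2 * (p - h) / 2 = N\<^sup>2 * p / 2 - real K" by (simp add: right_diff_distrib diff_divide_distrib)
    then show ?thesis using assms(1)[unfolded valid_def, THEN conjunct2] by linarith
  qed
  finally show ?thesis using assms(1) by (auto simp: valid_def)
qed

text \<open>Each exponential gains at most the same amount \<open>exp (1 - L\<^sup>2 / 8)\<close>,
  since every window satisfies \<open>L\<^sup>2 / 8 \<le> \<theta> * w\<close>; adding up produces
  \<open>constraint_count\<close>.\<close>

lemma estimator_step:
  assumes valid: "valid p E" and good: "good p E" and pL': "L ^ 4 \<le> (p - h) * g"
  shows "(\<Sum>C\<in>cliques_in k {1..n} E. estimator (p - h) (E - nsets C 2))
    \<le> real (card (cliques_in k {1..n} E)) * (estimator p E + constraint_count * exp (1 - L\<^sup>2 / 8))"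
proof -
  let ?A = "cliques_in k {1..n} E"
  let ?c = "real (card ?A)"
  let ?r = "exp (1 - L\<^sup>2 / 8)"
  have E: "E \<subseteq> nsets {1..n} 2" and cE: "real (card E) = N\<^sup>2 * p / 2 - N / 2" using valid by (auto simp: valid_def)
  have fE: "finite E" using E finite_subset[OF _ finite_imp_finite_nsets] by auto
  have n1: "1 \<le> n" using Lg(6) by simp
  have Qc: "real (Q k n E) = ?c" by (simp add: Q_def)
  have card: "q p - Aq p \<le> ?c" "?c \<le> q p + Bq p" using good Qc by (auto simp: good_def)
  have Ub: "\<bar>real (card (exts k n U E)) - traj (card U) p\<bar> \<le> eps (card U) p" if "U \<in> base_sets" for U
    using good that by (auto simp: good_def)
  have deg: "\<bar>real (deg k n E e) - traj 2 p\<bar> \<le> eps 2 p" if "e \<in> E" for e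
  proof -
    have "e \<in> base_sets" "card e = 2" using that E k by (auto simp: base_sets_def nsets_def)
    then show ?thesis using Ub[of e] deg_edge[OF E that] k by simp
  qed
  have fC: "finite C" "C \<subseteq> {1..n}" "card C = k" "nsets C 2 \<subseteq> E" if "C \<in> ?A" for C
    using that by (auto simp: cliques_in_def clique_iff_nsets_subset nsets_def[of _ k])
  have le_r: "exp (1 - x) \<le> ?r" if "L\<^sup>2 / 8 \<le> x" for x using that by simp
  have R: "(\<Sum>C\<in>?A. exp (thR (card U) * (real (card (exts k n U (E - nsets C 2))) - traj (card U) (p - h) - eps (card U) (p - h)))
        + exp (thR (card U) * (traj (card U) (p - h) - eps (card U) (p - h) - real (card (exts k n U (E - nsets C 2))))))
      \<le> ?c * (exp (thR (card U) * (real (card (exts k n U E)) - traj (card U) p - eps (card U) p))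
        + exp (thR (card U) * (traj (card U) p - eps (card U) p - real (card (exts k n U E)))) + 2 * ?r)"
    if U: "U \<in> base_sets" for U
  proof -
    define m where "m = card U"
    have m: "2 \<le> m" "m \<le> k - 1" "U \<subseteq> {1..n}" "card U = m" "m \<le> k" using U by (auto simp: base_sets_def m_def)
    define Rv where "Rv = real (card (exts k n U E))"
    define l where "l C = real (card (loss k n U E C))" for C
    have l: "0 \<le> l C \<and> l C \<le> real k * N ^ (k - m) / N" if "C \<in> ?A" for C
      using card_loss_base_le[OF U that] by (simp add: l_def m_def)
    have "traj 2 p - eps 2 p \<le> real (deg k n E e) \<and> real (deg k n E e) \<le> traj 2 p + eps 2 p" if "e \<in> E" for e
      using deg[OF that] unfolding abs_le_iff by linarith
    note sl = sum_loss_bounds[OF E m(3-5) _ n1 this, folded K_eq l_def Rv_def]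
    have lo: "Rv * (real (kap m) * (traj 2 p - eps 2 p) - (real (kap m))\<^sup>2 * N ^ (k - 3)) \<le> (\<Sum>C\<in>?A. l C)"
      using sl(2) k by simp
    have hi: "(\<Sum>C\<in>?A. l C) \<le> Rv * (real (kap m) * (traj 2 p + eps 2 p))"
      using sl(1) k by simp
    have Rv: "0 \<le> Rv" "Rv \<le> traj m p + eps m p" using Ub[OF U] unfolding Rv_def m_def by auto
    have new: "real (card (exts k n U (E - nsets C 2))) = Rv - l C" if "C \<in> ?A" for C
      unfolding Rv_def l_def by (rule card_exts_Diff) (use fC[OF that] in auto)
    have up: "(\<Sum>C\<in>?A. exp (thR m * (Rv - l C - traj m (p - h) - eps m (p - h))))
      \<le> ?c * (exp (thR m * (Rv - traj m p - eps m p)) + ?r)"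
      by (rule order_trans[OF R_upper_step[OF m(1,2) _ l lo hi card Rv]])
        (auto intro!: mult_left_mono add_left_mono le_r simp: thR_om[OF m(1,2)])
    have dn: "(\<Sum>C\<in>?A. exp (thR m * (traj m (p - h) - eps m (p - h) - (Rv - l C))))
      \<le> ?c * (exp (thR m * (traj m p - eps m p - Rv)) + ?r)"
      by (rule order_trans[OF R_lower_step[OF m(1,2) _ l hi card(1) Rv]])
        (auto intro!: mult_left_mono add_left_mono le_r simp: thR_om[OF m(1,2)])
    have "(\<Sum>C\<in>?A. exp (thR m * (real (card (exts k n U (E - nsets C 2))) - traj m (p - h) - eps m (p - h)))
        + exp (thR m * (traj m (p - h) - eps m (p - h) - real (card (exts k n U (E - nsets C 2))))))
      = (\<Sum>C\<in>?A. exp (thR m * (Rv - l C - traj m (p - h) - eps m (p - h)))) +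
        (\<Sum>C\<in>?A. exp (thR m * (traj m (p - h) - eps m (p - h) - (Rv - l C))))"
      unfolding sum.distrib by (intro arg_cong2[of _ _ _ _ "(+)"] sum.cong refl) (simp_all add: new)
    also have "\<dots> \<le> ?c * (exp (thR m * (Rv - traj m p - eps m p)) + ?r) + ?c * (exp (thR m * (traj m p - eps m p - Rv)) + ?r)"
      by (intro add_mono up dn)
    finally show ?thesis unfolding m_def[symmetric] Rv_def[symmetric] by (simp add: algebra_simps)
  qed
  define l where "l C = real (card (loss k n {} E C))" for C
  \<comment> \<open>\<open>s\<close> is the sum of the edge degrees of the deleted copy; the true
    loss \<open>l\<close> lies between \<open>s - ov\<close> and \<open>s\<close>.\<close>
  define s where "s C = (\<Sum>e\<in>nsets C 2. real (deg k n E e))" for C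
  have sb: "real K * traj 2 p - real K * eps 2 p \<le> s C" "s C \<le> real K * traj 2 p + real K * eps 2 p" if C: "C \<in> ?A" for C
  proof -
    have H: "real (card (nsets C 2)) = real K" using fC[OF C] by (simp add: K_eq)
    have b: "traj 2 p - eps 2 p \<le> real (deg k n E e)" "real (deg k n E e) \<le> traj 2 p + eps 2 p" if "e \<in> nsets C 2" for e
      using deg[of e] fC(4)[OF C] that unfolding abs_le_iff by (auto; linarith)+
    show "real K * traj 2 p - real K * eps 2 p \<le> s C"
      using sum_bounded_below[of "nsets C 2", OF b(1)] unfolding H s_def by (simp add: algebra_simps)
    show "s C \<le> real K * traj 2 p + real K * eps 2 p"
      using sum_bounded_above[of "nsets C 2", OF b(2)] unfolding H s_def by (simp add: algebra_simps)
  qed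
  have ls: "l C \<le> s C" "s C - (real K)\<^sup>2 * N ^ (k - 3) \<le> l C" if C: "C \<in> ?A" for C
    using clique_lossQ_bounds[OF E C k n1] unfolding l_def s_def K_eq by auto
  have t3: "real (card (exts k n T E)) \<le> traj 3 p + eps 3 p" if "T \<in> nsets {1..n} 3" for T
  proof -
    have "T \<in> base_sets" "card T = 3" using that k by (auto simp: base_sets_def nsets_def)
    then show ?thesis using Ub[of T] by auto
  qed
  have lov: "s C - ov \<le> l C" if C: "C \<in> ?A" for C
    using clique_lossQ_ge[OF E C k n1 t3, folded K_eq] unfolding l_def s_def ov_def by simp
  have Ene: "E \<noteq> {}" using edge_count(1) cE by auto
  \<comment> \<open>An edge occurs in as many copies as its degree says, so summing degrees over
    copies squares them.\<close>
  have D: "(\<Sum>C\<in>?A. s C) = (\<Sum>e\<in>E. (real (deg k n E e))\<^sup>2)"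
    unfolding s_def sum_deg[OF E] by (simp add: power2_eq_square)
  note dev = sum_squares_deviation[OF fE Ene sum_deg_eq[OF E, of k] deg, folded K_eq D, unfolded cE Qc]
  have l1: "real K * traj 2 p - real K * eps 2 p - (real K)\<^sup>2 * N ^ (k - 3) \<le> l C"
    and l2: "l C \<le> real K * traj 2 p + real K * eps 2 p" if "C \<in> ?A" for C
    using ls[OF that] sb[OF that] by linarith+
  have lo: "(real K * ?c)\<^sup>2 / (N\<^sup>2 * p / 2 - N / 2) - ?c * ov \<le> (\<Sum>C\<in>?A. l C)"
  proof -
    have "(\<Sum>C\<in>?A. s C - ov) \<le> (\<Sum>C\<in>?A. l C)" by (intro sum_mono lov)
    then show ?thesis using dev(1) by (simp add: sum_subtractf)
  qed
  have hi: "(\<Sum>C\<in>?A. l C) \<le> (real K * ?c)\<^sup>2 / (N\<^sup>2 * p / 2 - N / 2) + (N\<^sup>2 * p / 2 - N / 2) * (eps 2 p)\<^sup>2"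
    using sum_mono[of ?A l s, OF ls(1)] dev(2) by linarith
  have newQ: "real (Q k n (E - nsets C 2)) = ?c - l C" if "C \<in> ?A" for C
    using card_exts_Diff[OF fC(1)[OF that], of k n "{}" E]
    unfolding Q_def cliques_in_eq_exts l_def .
  have upQ: "(\<Sum>C\<in>?A. exp (thQ * (?c - l C - q (p - h) - Bq (p - h)))) \<le> ?c * (exp (thQ * (?c - q p - Bq p)) + ?r)"
    by (rule order_trans[OF Q_upper_step[OF _ l1 l2 lo] mult_left_mono[OF add_left_mono[OF le_r[OF thQ_Bq]]]]) auto
  have dnQ: "(\<Sum>C\<in>?A. exp (thQ * (q (p - h) - Aq (p - h) - (?c - l C)))) \<le> ?c * (exp (thQ * (q p - Aq p - ?c)) + ?r)"
    by (rule order_trans[OF Q_lower_step[OF _ pL' l1 l2 hi card(1)] mult_left_mono[OF add_left_mono[OF le_r[OF thQ_Aq]]]]) auto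
  have "(\<Sum>C\<in>?A. estimator (p - h) (E - nsets C 2)) =
     (\<Sum>C\<in>?A. exp (thQ * (?c - l C - q (p - h) - Bq (p - h)))) + (\<Sum>C\<in>?A. exp (thQ * (q (p - h) - Aq (p - h) - (?c - l C))))
     + (\<Sum>U\<in>base_sets. \<Sum>C\<in>?A. exp (thR (card U) * (real (card (exts k n U (E - nsets C 2))) - traj (card U) (p - h) - eps (card U) (p - h)))
        + exp (thR (card U) * (traj (card U) (p - h) - eps (card U) (p - h) - real (card (exts k n U (E - nsets C 2))))))"
    unfolding estimator_def sum.distrib[where A = ?A] sum.swap[where A = ?A and B = base_sets]
    by (intro arg_cong2[of _ _ _ _ "(+)"] sum.cong refl) (simp_all add: newQ)
  also have "\<dots> \<le> ?c * (exp (thQ * (?c - q p - Bq p)) + ?r) + ?c * (exp (thQ * (q p - Aq p - ?c)) + ?r)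
    + (\<Sum>U\<in>base_sets. ?c * (exp (thR (card U) * (real (card (exts k n U E)) - traj (card U) p - eps (card U) p))
        + exp (thR (card U) * (traj (card U) p - eps (card U) p - real (card (exts k n U E)))) + 2 * ?r))"
    by (intro add_mono upQ dnQ sum_mono R)
  also have "\<dots> = ?c * (estimator p E + constraint_count * ?r)"
    unfolding estimator_def constraint_count_def Qc by (simp add: sum_distrib_left[symmetric] sum.distrib algebra_simps)
  finally show ?thesis .
qed

end

context removal_regime
begin

section \<open>Initial value and total failure probability\<close>

lemma density_one: "removal_density k n K g L 1"
proof unfold_locales
  have "L ^ 4 \<le> L ^ 8" using L_bounds by (intro power_increasing) auto
  then show "L ^ 4 \<le> 1 * g" using g_large by simp
qed simp

text \<open>The initial counts are binomial coefficients, whose relative distance from the leading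
  term is of order \<open>1 / N\<close>. This is far inside every allowance, so each constraint
  starts below its window.\<close>

lemma estimator_initial: "estimator 1 (nsets {1..n} 2) \<le> constraint_count * exp (1 - L\<^sup>2 / 8)"
proof -
  interpret I: removal_density k n K g L 1 by (rule density_one)
  let ?E = "nsets {1..n} 2"
  have ex: "exp (\<theta> * z) \<le> exp (1 - L\<^sup>2 / 8)" if "0 < \<theta>" "z \<le> - w" "L\<^sup>2 / 8 \<le> \<theta> * w" for \<theta> z w
  proof -
    have "\<theta> * z \<le> \<theta> * (- w)" using that by (intro mult_left_mono) auto
    then show ?thesis using that by simp
  qed
  have kn: "k \<le> n"
  proof -
    have "real k \<le> L" using L_fact(2)[of k] L_bounds(2) k_le_K by linarith
    then have "real k \<le> real n" using Lg by linarith
    then show ?thesis by simp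
  qed
  have k2: "(real k)\<^sup>2 * 1000 \<le> L"
  proof -
    have "(real k)\<^sup>2 \<le> (real K)\<^sup>2" using k_le_K by (intro power_mono) auto
    then show ?thesis using L_bounds(3) by linarith
  qed
  have Q: "real (Q k n ?E) = real (n choose k)"

    unfolding Q_def cliques_in_eq_exts using card_exts_complete[of "{}" n 0 k] by simp
  have q1: "q 1 = N ^ k / fact k" by (simp add: q_def)
  have sg1: "sg 1 = 1" by (simp add: sg_def)
  have Q1: "exp (thQ * (real (Q k n ?E) - q 1 - Bq 1)) \<le> exp (1 - L\<^sup>2 / 8)"
  proof (rule ex[OF thQ_pos _ I.thQ_Bq])
    have "real (n choose k) \<le> q 1" using binomial_le_power_fact[of n 0 k] q1 by simp
    moreover have "Bq 1 / (4 * real K) \<le> Bq 1" using I.Bq_pos K6' self_le_mult(1)[of "4 * real K" "Bq 1"] by (simp add: divide_le_eq)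
    ultimately show "real (Q k n ?E) - q 1 - Bq 1 \<le> - (Bq 1 / (4 * real K))" unfolding Q by linarith
  qed
  have Q2: "exp (thQ * (q 1 - Aq 1 - real (Q k n ?E))) \<le> exp (1 - L\<^sup>2 / 8)"
  proof (rule ex[OF thQ_pos _ I.thQ_Aq])
    have "q 1 - (real k)\<^sup>2 * N ^ k / N \<le> real (n choose k)"
      using binomial_ge_leading_term[of k k 0 n] kn k q1 by simp
    moreover have "(real k)\<^sup>2 * N ^ k / N \<le> Aq 1 / 2"
    proof -
      have "2 * (real k)\<^sup>2 \<le> L ^ 4" using k2 L_bounds(5) self_le_power[of L 4] zero_le_power2[of "real k"] by linarith
      moreover have "g ^ (K + 1) \<le> N" unfolding n_eq using Lg K6 by (intro power_increasing) auto
      ultimately have "N ^ k * (2 * (real k)\<^sup>2) / N \<le> N ^ k * L ^ 4 / g ^ (K + 1)"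
        using Lg by (intro frac_le mult_left_mono) auto
      moreover have "N ^ k * (2 * (real k)\<^sup>2) / N = 2 * ((real k)\<^sup>2 * N ^ k / N)" by simp
      moreover have "Aq 1 = N ^ k * L ^ 4 / g ^ (K + 1)" by (simp add: Aq_def sg1)
      ultimately show ?thesis by linarith
    qed
    ultimately show "q 1 - Aq 1 - real (Q k n ?E) \<le> - (Aq 1 / 2)" unfolding Q by linarith
  qed
  have R: "exp (thR (card U) * (real (card (exts k n U ?E)) - traj (card U) 1 - eps (card U) 1))
        + exp (thR (card U) * (traj (card U) 1 - eps (card U) 1 - real (card (exts k n U ?E)))) \<le> 2 * exp (1 - L\<^sup>2 / 8)"
    if U: "U \<in> base_sets" for U
  proof -
    define m where "m = card U"
    have m: "2 \<le> m" "m \<le> k - 1" "U \<subseteq> {1..n}" "card U = m" "m \<le> k" using U by (auto simp: base_sets_def m_def)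
    have R: "real (card (exts k n U ?E)) = real ((n - m) choose (k - m))" using card_exts_complete[OF m(3-5)] by simp
    have t1: "traj m 1 = N ^ (k - m) / fact (k - m)" by (simp add: traj_def)
    have e1: "eps m 1 = om m" by (simp add: eps_def sg1)
    have w: "L\<^sup>2 / 8 \<le> thR m * (om m / 8)" using I.thR_om[OF m(1,2)] by simp
    have 1: "exp (thR m * (real (card (exts k n U ?E)) - traj m 1 - eps m 1)) \<le> exp (1 - L\<^sup>2 / 8)"
    proof (rule ex[OF thR_pos _ w])
      show "real (card (exts k n U ?E)) - traj m 1 - eps m 1 \<le> - (om m / 8)"
        using binomial_le_power_fact[of n m "k - m"] om_pos[of m] unfolding R t1 e1 by linarith
    qed
    have 2: "exp (thR m * (traj m 1 - eps m 1 - real (card (exts k n U ?E)))) \<le> exp (1 - L\<^sup>2 / 8)"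
    proof (rule ex[OF thR_pos _ w])
      have "N ^ (k - m) / fact (k - m) - (real k)\<^sup>2 * N ^ (k - m) / N \<le> real ((n - m) choose (k - m))"
        using m kn Lg(6) by (intro binomial_ge_leading_term) auto
      moreover have "(real k)\<^sup>2 * N ^ (k - m) / N \<le> om m / 2"
      proof -
        have "2 * (real k)\<^sup>2 \<le> L\<^sup>2" using k2 L_bounds(5) self_le_power[of L 2] zero_le_power2[of "real k"] by linarith
        moreover have "g ^ kap m \<le> N" unfolding n_eq using Lg K6 by (intro power_increasing) auto
        ultimately have "N ^ (k - m) * (2 * (real k)\<^sup>2) / N \<le> N ^ (k - m) * L\<^sup>2 / g ^ kap m"
          using Lg by (intro frac_le mult_left_mono) auto
        moreover have "N ^ (k - m) * (2 * (real k)\<^sup>2) / N = 2 * ((real k)\<^sup>2 * N ^ (k - m) / N)" by simp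
        ultimately have "2 * ((real k)\<^sup>2 * N ^ (k - m) / N) \<le> om m" unfolding om_def by (simp only:)
        then show ?thesis by linarith
      qed
      ultimately show "traj m 1 - eps m 1 - real (card (exts k n U ?E)) \<le> - (om m / 8)"
        using om_pos[of m] unfolding R t1 e1 by linarith
    qed
    show ?thesis using 1 2 unfolding m_def by linarith
  qed
  have "(\<Sum>U\<in>base_sets. exp (thR (card U) * (real (card (exts k n U ?E)) - traj (card U) 1 - eps (card U) 1))
        + exp (thR (card U) * (traj (card U) 1 - eps (card U) 1 - real (card (exts k n U ?E))))) \<le>
      real (card base_sets) * (2 * exp (1 - L\<^sup>2 / 8))"
    by (rule sum_bounded_above) (rule R)
  moreover have "constraint_count * exp (1 - L\<^sup>2 / 8) = exp (1 - L\<^sup>2 / 8) + exp (1 - L\<^sup>2 / 8) + real (card base_sets) * (2 * exp (1 - L\<^sup>2 / 8))"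
    by (simp add: constraint_count_def algebra_simps)
  ultimately show ?thesis using Q1 Q2 unfolding estimator_def by linarith
qed

lemma constraint_count_le: "constraint_count \<le> N ^ (k + 1)"
proof -
  have "base_sets \<subseteq> (\<Union>m\<in>{2..k - 1}. nsets {1..n} m)"
    by (auto simp: base_sets_def nsets_def dest: finite_subset[OF _ finite_atLeastAtMost])
  then have "card base_sets \<le> card (\<Union>m\<in>{2..k - 1}. nsets {1..n} m)"
    by (intro card_mono) (auto simp: finite_imp_finite_nsets)
  also have "\<dots> \<le> (\<Sum>m\<in>{2..k - 1}. card (nsets {1..n} m))" by (rule card_UN_le) simp
  also have "\<dots> \<le> (\<Sum>m\<in>{2..k - 1}. n ^ k)"
  proof (rule sum_mono)
    fix m assume "m \<in> {2..k - 1}"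
    then have "n ^ m \<le> n ^ k" using Lg(7) by (intro power_increasing) auto
    then show "card (nsets {1..n} m) \<le> n ^ k" using binomial_le_power[of n m] by (simp add: order_trans)
  qed
  also have "\<dots> \<le> k * n ^ k" by simp
  finally have "real (card base_sets) \<le> real (k * n ^ k)" by (rule of_nat_mono)
  then have c: "real (card base_sets) \<le> real k * N ^ k" by simp
  have "1 \<le> N ^ k" using Lg by simp
  moreover have "4 * real k \<le> N" using L_bounds(2) Lg(9) k_le_K by linarith
  moreover have "1 * N ^ k \<le> real k * N ^ k" using k by (intro mult_right_mono) auto
  ultimately have "constraint_count \<le> 4 * real k * N ^ k" unfolding constraint_count_def using c by linarith
  also have "\<dots> \<le> N * N ^ k" using \<open>4 * real k \<le> N\<close> by (intro mult_right_mono) auto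
  finally show ?thesis by simp
qed

text \<open>The initial potential and at most \<open>N\<^sup>2\<close> increments share the factor
  \<open>constraint_count * exp (1 - L\<^sup>2 / 8)\<close>; the count is polynomial in
  \<open>N\<close>, while \<open>L\<^sup>2\<close> is the square of its logarithm.\<close>

theorem failure_probability:
  assumes T: "real T \<le> N\<^sup>2" and reg: "\<And>i. i \<le> T \<Longrightarrow> L ^ 4 \<le> (1 - h * real i) * g"
  shows "measure_pmf.prob (removal_process k n)
     {G. \<not> (\<forall>j. j \<le> T \<longrightarrow> j < length G \<and> G ! j \<subseteq> nsets {1..n} 2 \<and> good (1 - h * real j) (G ! j))} \<le> 1 / N"
proof -
  let ?p = "\<lambda>i. 1 - h * real i"
  let ?r = "exp (1 - L\<^sup>2 / 8)"
  have dens: "removal_density k n K g L (?p i)" if "i \<le> T" for i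
    using reg[OF that] h_pos by unfold_locales auto
  have suc: "?p (Suc i) = ?p i - h" for i by (simp add: algebra_simps)
  have J0: "0 \<le> constraint_count" by (simp add: constraint_count_def)
  have "measure_pmf.prob (removal_run k n (nsets {1..n} 2))
      {G. \<not> (\<forall>j. 0 + j \<le> T \<longrightarrow> j < length G \<and> (G ! j \<subseteq> nsets {1..n} 2 \<and> good (?p (0 + j)) (G ! j)))}
      \<le> estimator (?p 0) (nsets {1..n} 2) + real (T - 0) * (constraint_count * ?r)"
  proof (rule removal_run_failure_bound[where \<Phi> = "\<lambda>i. estimator (?p i)" and good = "\<lambda>i E. E \<subseteq> nsets {1..n} 2 \<and> good (?p i) E" and inv = "\<lambda>i. valid (?p i)"])
    show "2 \<le> k" using k by simp
    show "0 \<le> constraint_count * ?r" using J0 by simp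
    show "0 \<le> estimator (?p i) E" for i E by (rule estimator_nonneg)
    show "1 \<le> estimator (?p i) E" if "valid (?p i) E" "\<not> (E \<subseteq> nsets {1..n} 2 \<and> good (?p i) E)" for i E
      using estimator_bad[of "?p i" E] that by (auto simp: valid_def)
    show "cliques_in k {1..n} E \<noteq> {}" if "i \<le> T" "E \<subseteq> nsets {1..n} 2 \<and> good (?p i) E" for i E
      using removal_density.good_nonempty[OF dens] that by blast
    show "valid (?p (Suc i)) (E - nsets C 2)" if "i < T" "valid (?p i) E" "C \<in> cliques_in k {1..n} E" for i E C
      unfolding suc by (rule removal_density.valid_step[OF dens]) (use that in auto)
    show "(\<Sum>C\<in>cliques_in k {1..n} E. estimator (?p (Suc i)) (E - nsets C 2))
       \<le> real (card (cliques_in k {1..n} E)) * (estimator (?p i) E + constraint_count * ?r)"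
      if "i < T" "valid (?p i) E" "E \<subseteq> nsets {1..n} 2 \<and> good (?p i) E" for i E
      unfolding suc by (rule removal_density.estimator_step[OF dens]) (use that reg[of "Suc i", unfolded suc] in auto)
    show "valid (?p 0) (nsets {1..n} 2)"
    proof -
      have "2 * (n choose 2) = n * (n - 1)" unfolding choose_two by (cases "even n") auto
      then have "real (2 * (n choose 2)) = real (n * (n - 1))" by (rule arg_cong)
      then have "2 * real (n choose 2) = N * (N - 1)" using Lg(6) by (simp add: of_nat_diff)
      then show ?thesis by (simp add: valid_def power2_eq_square algebra_simps)
    qed
  qed simp_all
  also have "\<dots> \<le> constraint_count * ?r + N\<^sup>2 * (constraint_count * ?r)"
    using estimator_initial T J0 by (intro add_mono mult_right_mono) auto
  also have "\<dots> = (1 + N\<^sup>2) * (constraint_count * ?r)" by (simp add: algebra_simps)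
  also have "\<dots> \<le> N ^ 3 * (N ^ (k + 1) * ?r)"
  proof (intro mult_mono constraint_count_le)
    have "1 \<le> N\<^sup>2" using Lg by simp
    moreover have "2 \<le> N" using Lg L_bounds(4) by linarith
    then have "2 * N\<^sup>2 \<le> N * N\<^sup>2" by (intro mult_right_mono) auto
    ultimately show "1 + N\<^sup>2 \<le> N ^ 3" by (simp add: power2_eq_square power3_eq_cube)
  qed (use J0 in auto)
  also have "\<dots> = N ^ (k + 4) * ?r"
  proof -
    have "k + 4 = 3 + (k + 1)" by simp
    then have "N ^ (k + 4) = N ^ 3 * N ^ (k + 1)" by (simp only: power_add)
    then show ?thesis by simp
  qed
  also have "\<dots> \<le> 1 / N"
  proof -
    have NL: "exp (real j * L) = N ^ j" for j using Lg(6) by (simp add: L_eq exp_of_nat_mult)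
    \<comment> \<open>With \<open>N = exp L\<close>, the claim is
      \<open>(k + 5) * L + 1 \<le> L\<^sup>2 / 8\<close>. Asking for \<open>k + 6\<close> leaves one
      \<open>L\<close> to cover the summand 1.\<close>
    have "k + 6 \<le> 2 * K" using k_le_K K6 by linarith
    then have "real (k + 6) \<le> real (2 * K)" by (rule of_nat_mono)
    then have "8 * (real k + 6) \<le> 16 * real K" by simp
    then have "8 * (real k + 6) \<le> L" using L_bounds(2) K6' by linarith
    then have "8 * (real k + 6) * L \<le> L * L" using Lg by (intro mult_right_mono) auto
    moreover have "8 \<le> 8 * L" using L_bounds by simp
    ultimately have "real (k + 5) * L + (1 - L\<^sup>2 / 8) \<le> 0" by (simp add: power2_eq_square algebra_simps)
    then have "exp (real (k + 5) * L) * ?r \<le> 1" unfolding exp_add[symmetric] by simp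
    moreover have "N ^ (k + 5) = N * N ^ (k + 4)" using power_Suc[of N "k + 4"] by (simp add: eval_nat_numeral)
    ultimately have "N ^ (k + 4) * ?r * N \<le> 1" unfolding NL by (simp only: mult_ac)
    then show ?thesis using Lg(6) by (simp add: le_divide_eq)
  qed
  finally show ?thesis by (simp add: removal_process_def)
qed

end

section \<open>Return to the original exponents\<close>

theorem theorem3p1:
  fixes k :: nat
  assumes "k \<ge> 4"
  shows "\<exists>(mu :: real) (lam :: real) (gam :: nat \<Rightarrow> real).
    (\<lambda>n. measure_pmf.prob (removal_process k n)
      {G. \<forall>i. real i \<le> last_step k lam n \<longrightarrow>
         i < length G \<and>
         real (Q k n (G ! i)) \<le>
           real n ^ k / fact k * density k n i ^ (k choose 2)
           + real n ^ (k - 1) / 2 * density k n i ^ ((k choose 2) - 4) \<and>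
         real (Q k n (G ! i)) \<ge>
           real n ^ k / fact k * density k n i ^ (k choose 2)
           - sigma k n i ^ 2 * real n powr alpha k / density k n i * ln (real n) powr mu \<and>
         (\<forall>m\<in>{2..k - 1}. \<forall>U\<in>nsets {1..n} m.
            \<bar>real (R k n U (G ! i))
              - real n ^ (k - m) / fact (k - m)
                * density k n i ^ ((k choose 2) - (m choose 2))\<bar>
            \<le> sigma k n i * real n powr beta k m * ln (real n) powr gam m)})
    \<longlonglongrightarrow> 1"
proof (intro exI)
  define K where "K = k choose 2"
  define c :: real where "c = 1 / (2 * real K - 2)"
  define g where "g n = real n powr c" for n :: nat
  let ?ok = "\<lambda>n. {G. \<forall>i. real i \<le> last_step k 4 n \<longrightarrow>
         i < length G \<and>
         real (Q k n (G ! i)) \<le>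
           real n ^ k / fact k * density k n i ^ (k choose 2)
           + real n ^ (k - 1) / 2 * density k n i ^ ((k choose 2) - 4) \<and>
         real (Q k n (G ! i)) \<ge>
           real n ^ k / fact k * density k n i ^ (k choose 2)
           - sigma k n i ^ 2 * real n powr alpha k / density k n i * ln (real n) powr 4 \<and>
         (\<forall>m\<in>{2..k - 1}. \<forall>U\<in>nsets {1..n} m.
            \<bar>real (R k n U (G ! i))
              - real n ^ (k - m) / fact (k - m)
                * density k n i ^ ((k choose 2) - (m choose 2))\<bar>
            \<le> sigma k n i * real n powr beta k m * ln (real n) powr 2)}"
  have K4: "6 \<le> K"
  proof -
    have "(4::nat) choose 2 \<le> K" unfolding K_def using assms by (intro binomial_right_mono)
    then show ?thesis by (simp add: choose_two)
  qed
  then have K6: "6 \<le> real K" by simp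
  then have c: "0 < c" by (simp add: c_def)
  have kk: "real (k * (k - 1)) = 2 * real K"
  proof -
    have "2 * K = k * (k - 1)" unfolding K_def choose_two using assms by (cases "even k") auto
    then have "real (2 * K) = real (k * (k - 1))" by (rule arg_cong)
    then show ?thesis by simp
  qed
  have "\<forall>\<^sub>F n in sequentially. ln (real n) ^ 8 \<le> real n powr c"
    using c by real_asymp
  moreover have "\<forall>\<^sub>F n in sequentially. 2 ^ 10 * real K ^ 4 * fact k \<le> ln (real n)"
    by real_asymp
  moreover have "\<forall>\<^sub>F n :: nat in sequentially. 1 < n" by (rule eventually_gt_at_top)
  ultimately have ev: "\<forall>\<^sub>F n in sequentially. 1 - 1 / real n \<le> measure_pmf.prob (removal_process k n) (?ok n)"
  proof eventually_elim
    case (elim n)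
    define L where "L = ln (real n)"
    have n: "1 < real n" using elim by simp
    have g_pow: "g n ^ j = real n powr (real j * c)" for j
      using n by (simp add: g_def powr_powr mult.commute flip: powr_realpow)
    interpret removal_regime k n K "g n" L
    proof unfold_locales
      have "real (2 * K - 2) * c = 1" using K4 K6 by (simp add: c_def of_nat_diff)
      then show "real n = g n ^ (2 * K - 2)" unfolding g_pow using n by (simp only:) simp
    qed (use assms elim in \<open>auto simp: K_def L_def g_def\<close>)
    have dens: "density k n i = 1 - h * real i" for i
      unfolding density_def kk h_def by simp
    have sig: "sigma k n i = sg (1 - h * real i)" for i
      unfolding sigma_def sg_def kk dens by simp
    \<comment> \<open>Since \<open>k * (k - 1) - 2 = 2 * K - 2\<close>, the density at
      \<open>last_step\<close> is \<open>root 3 2 * L ^ 4 / g n\<close>; the choice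
      \<open>lam = 4\<close> is what yields the power \<open>L ^ 4\<close>.\<close>
    have reg: "L ^ 4 \<le> (1 - h * real i) * g n" if "real i \<le> last_step k 4 n" for i
    proof -
      define s where "s = root 3 2 * (real n powr (2 - c) * L ^ 4)"
      have L4: "ln (real n) powr 4 = L ^ 4" using Lg(5) unfolding L_def by simp
      have "last_step k 4 n = (real n ^ 2 - s) / (2 * real K)"
        unfolding last_step_def kk c_def s_def L4 by (simp add: diff_divide_distrib mult.assoc)
      then have "2 * real K * real i \<le> real n ^ 2 - s" using that K6 by (simp add: pos_le_divide_eq mult.commute)
      then have "2 * real K * real i / real n ^ 2 \<le> (real n ^ 2 - s) / real n ^ 2" by (intro divide_right_mono) auto
      also have "\<dots> = 1 - s / real n ^ 2" using n by (simp add: diff_divide_distrib)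
      finally have "s / real n ^ 2 \<le> 1 - h * real i" unfolding h_def by simp
      then have "s / real n ^ 2 * g n \<le> (1 - h * real i) * g n" using Lg by (intro mult_right_mono) auto
      moreover have "s / real n ^ 2 * g n = root 3 2 * L ^ 4"
      proof -
        have "real n powr (2 - c) * g n = real n ^ 2" unfolding g_def powr_add[symmetric] using n by simp
        then have "s * g n = root 3 2 * L ^ 4 * real n ^ 2" unfolding s_def by (simp add: mult_ac)
        then show ?thesis using n by simp
      qed
      moreover have "1 * L ^ 4 \<le> root 3 2 * L ^ 4" by (intro mult_right_mono) auto
      ultimately show ?thesis by linarith
    qed
    show ?case
    proof (cases "0 \<le> last_step k 4 n")
      \<comment> \<open>If \<open>last_step\<close> is negative, no index satisfies the bound and
        the event is certain. The other case can then take the floor as a natural number.\<close>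
      case False
      then have "?ok n = UNIV" by (auto simp: not_le intro: order_less_le_trans)
      then show ?thesis by simp
    next
      case True
      define T where "T = nat \<lfloor>last_step k 4 n\<rfloor>"
      have T: "i \<le> T \<longleftrightarrow> real i \<le> last_step k 4 n" for i
        unfolding T_def using True by (simp add: le_nat_iff le_floor_iff)
      have TN: "real T \<le> (real n)\<^sup>2"
      proof -
        have "last_step k 4 n \<le> real n ^ 2 / (2 * real K)"
          unfolding last_step_def kk using K6 by simp
        also have "\<dots> \<le> real n ^ 2" using K6 by (simp add: divide_le_eq self_le_mult)
        finally have "last_step k 4 n \<le> real n ^ 2" .
        moreover have "real T \<le> last_step k 4 n" using T[of T] by simp
        ultimately show ?thesis by linarith
      qed
      \<comment> \<open>The inclusion in \<open>nsets {1..n} 2\<close> belongs to the event because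
        it is the hypothesis under which \<open>R\<close> is identified with the number of
        extensions.\<close>
      let ?A = "{G. \<forall>j. j \<le> T \<longrightarrow> j < length G \<and> G ! j \<subseteq> nsets {1..n} 2 \<and> good (1 - h * real j) (G ! j)}"
      have "?A \<subseteq> ?ok n"
      proof (intro subsetI CollectI allI impI)
        fix G i assume G: "G \<in> ?A" and i: "real i \<le> last_step k 4 n"
        define E where "E = G ! i"
        have len: "i < length G" and E: "E \<subseteq> nsets {1..n} 2" and good: "good (density k n i) E"
          using G i T[of i] unfolding E_def dens by auto
        have L2: "ln (real n) powr 4 = L ^ 4" "ln (real n) powr 2 = L\<^sup>2" using Lg(5) unfolding L_def by simp_all
        have al: "real n powr alpha k = real n ^ k / g n ^ (K + 1)"
        proof -
          have "alpha k = real k - real (K + 1) * c" unfolding alpha_def c_def K_def by simp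
          then show ?thesis unfolding g_pow using n by (simp add: powr_diff powr_realpow)
        qed
        have Aq: "sigma k n i ^ 2 * real n powr alpha k / density k n i * ln (real n) powr 4 = Aq (density k n i)"
          unfolding L2 al Aq_def sig dens by simp
        have "\<bar>real (R k n U E) - real n ^ (k - m) / fact (k - m) * density k n i ^ ((k choose 2) - (m choose 2))\<bar>
            \<le> sigma k n i * real n powr beta k m * ln (real n) powr 2"
          if m: "m \<in> {2..k - 1}" and U: "U \<in> nsets {1..n} m" for m U
        proof -
          have m': "2 \<le> m" "m \<le> k - 1" "m \<le> k" using m by auto
          have U': "U \<subseteq> {1..n}" "card U = m" "U \<noteq> {}" using U m' by (auto simp: nsets_def)
          then have "U \<in> base_sets" using m' by (simp add: base_sets_def)
          then have *: "\<bar>real (card (exts k n U E)) - traj m (density k n i)\<bar> \<le> eps m (density k n i)"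
            using good U'(2) by (auto simp: good_def)
          have be: "real n powr beta k m = real n ^ (k - m) / g n ^ kap m"
          proof -
            have "real (kap m) = real K - real (m choose 2)" using kap_facts(4)[OF m'(1,2)] by (simp add: of_nat_diff)
            then have "beta k m = real (k - m) - real (kap m) * c"
              unfolding beta_def c_def using m'(3) by (simp add: K_def of_nat_diff)
            then show ?thesis unfolding g_pow using n by (simp add: powr_diff powr_realpow)
          qed
          have "sigma k n i * real n powr beta k m * ln (real n) powr 2 = eps m (density k n i)"
            unfolding L2 be eps_def om_def sig dens by simp
          moreover have "real n ^ (k - m) / fact (k - m) * density k n i ^ ((k choose 2) - (m choose 2)) = traj m (density k n i)"
            unfolding traj_def unfolding K_def by simp
          ultimately show ?thesis using * R_eq_card_exts[OF E U'(1,3)] by simp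
        qed
        moreover have "real (Q k n E) \<le> q (density k n i) + Bq (density k n i)" "q (density k n i) - Aq (density k n i) \<le> real (Q k n E)"
          using good by (auto simp: good_def)
        ultimately show "i < length G \<and>
         real (Q k n (G ! i)) \<le>
           real n ^ k / fact k * density k n i ^ (k choose 2)
           + real n ^ (k - 1) / 2 * density k n i ^ ((k choose 2) - 4) \<and>
         real (Q k n (G ! i)) \<ge>
           real n ^ k / fact k * density k n i ^ (k choose 2)
           - sigma k n i ^ 2 * real n powr alpha k / density k n i * ln (real n) powr 4 \<and>
         (\<forall>m\<in>{2..k - 1}. \<forall>U\<in>nsets {1..n} m.
            \<bar>real (R k n U (G ! i))
              - real n ^ (k - m) / fact (k - m)
                * density k n i ^ ((k choose 2) - (m choose 2))\<bar>
            \<le> sigma k n i * real n powr beta k m * ln (real n) powr 2)"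
          unfolding Aq E_def[symmetric] q_def Bq_def K_def[symmetric] using len by blast
      qed
      then have "measure_pmf.prob (removal_process k n) ?A \<le> measure_pmf.prob (removal_process k n) (?ok n)"
        by (intro measure_pmf.finite_measure_mono) auto
      moreover have "1 - 1 / real n \<le> measure_pmf.prob (removal_process k n) ?A"
      proof -
        have "UNIV - ?A = {G. \<not> (\<forall>j. j \<le> T \<longrightarrow> j < length G \<and> G ! j \<subseteq> nsets {1..n} 2 \<and> good (1 - h * real j) (G ! j))}" by auto
        then have "measure_pmf.prob (removal_process k n) (UNIV - ?A) \<le> 1 / real n"
          using failure_probability[OF TN reg] T by simp
        then show ?thesis using measure_pmf.prob_compl[of ?A "removal_process k n"] by simp
      qed
      ultimately show ?thesis by linarith
    qed
  qed
  have lim: "(\<lambda>n. 1 - 1 / real n) \<longlonglongrightarrow> 1" by real_asymp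
  show "(\<lambda>n. measure_pmf.prob (removal_process k n) (?ok n)) \<longlonglongrightarrow> 1"
    by (rule tendsto_sandwich[OF ev _ lim tendsto_const]) auto
qed

end
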